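(* Let $\mathbb{K}$ be a field of characteristic $0$, let $A$ be a (unital) $A_\infty$-category over $\mathbb{K}$, and let $i\ge0$. Then $$\pi_i\big(Map_{N_{A_\infty}(\mathcal{A}_\infty(A,A))}(Id_A,Id_A)\big)\;=\;HH^{-i}(A,A),$$ where $\mathcal{A}_\infty(A,A)$ is the $A_\infty$-category of unital $A_\infty$-functors from $A$ to $A$, $N_{A_\infty}$ is the $A_\infty$-nerve, $Map$ is the mapping space in the $(\infty,1)$-category $N_{A_\infty}(\mathcal{A}_\infty(A,A))$, and $HH^\bullet(A,A)$ is the Hochschild cohomology of $A$.
   Context: Conventions. $\mathbb{K}$ is a field of characteristic $0$; complexes are cohomologically graded. $A_\infty$-categories and functors. Write $s:V\to V[1]$ for the degree $-1$ suspension; the Koszul sign rule is used throughout, and strings of morphisms are written in the order $Hom(x_0,x_1)\otimes\cdots\otimes Hom(x_{n-1},x_n)$. A (strictly unital) $A_\infty$-category $A$ consists of a set of objects, graded vector spaces $Hom_A^\bullet(x,y)$, and operations $m_k:Hom_A^\bullet(x_0,x_1)\otimes\cdots\otimes Hom_A^\bullet(x_{k-1},x_k)\to Hom_A^\bullet(x_0,x_k)$ of degree $2-k$, $k\ge1$, such that the degree $1$ maps $b_k=s\,m_k\,(s^{-1})^{\otimes k}$ satisfy $\sum_{i+k+j=n}b_{i+j+1}(\mathrm{Id}^{\otimes i}\otimes b_k\otimes \mathrm{Id}^{\otimes j})=0$ for all $n\ge1$, together with units $1_x\in Hom^0_A(x,x)$ such that $m_1(1_x)=0$, $m_2$ with a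 unit in either slot is the identity, and $m_k$ ($k\ge3$) vanishes if any argument is a unit. A dg-category is an $A_\infty$-category with $m_k=0$ for $k\ge3$. A unital $A_\infty$-functor $f:A\to B$ is a map on objects with maps $f_n:Hom^\bullet_A(x_0,x_1)\otimes\cdots\otimes Hom^\bullet_A(x_{n-1},x_n)\to Hom^\bullet_B(f(x_0),f(x_n))$ of degree $1-n$, $n\ge1$, such that the degree $0$ maps $F_n=s f_n (s^{-1})^{\otimes n}$ satisfy $\sum F_{i+j+1}(\mathrm{Id}^{\otimes i}\otimes b_k\otimes \mathrm{Id}^{\otimes j})=\sum_{r,\ i_1+\cdots+i_r=n}b_r(F_{i_1}\otimes\cdots\otimes F_{i_r})$ for all $n\ge 1$, with $f_1(1_x)=1_{f(x)}$ and $f_n=0$ for $n\ge2$ whenever some argument is a unit. $Id_A$ is the identity functor ($f_1=\mathrm{Id}$, $f_n=0$ for $n\ge2$). The $A_\infty$-category $\mathcal{A}_\infty(A,B)$. Its objects are the unital $A_\infty$-functors $A\to B$. A degree $d$ element $r\in Hom^d_{\mathcal{A}_\infty(A,B)}(f,g)$ is a family of graded maps $r_n:Hom^\bullet_A(x_0,x_1)\otimes\cdots\otimes Hom^\bullet_A(x_{n-1},x_n)\to Hom^\bullet_B(f(x_0),g(x_n))$ of degree $d-n$, for $n\ge0$ and all $x_0,\dots,x_n$. With $R_n=s r_n(s^{-1})^{\otimes n}$ (degree $d-1$), the $A_\infty$-operations, in shifted form, are $$b_1(R)=\sum b^B(F_{i_1}\otimes\cdots\otimes F_{i_p}\otimes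 R_s\otimes G_{j_1}\otimes\cdots\otimes G_{j_q})-(-1)^{d-1}\sum R\,(\mathrm{Id}^{\otimes u}\otimes b^A\otimes \mathrm{Id}^{\otimes t}),$$ and, for $k\ge2$ and $R^{(i)}$ from $f^{(i-1)}$ to $f^{(i)}$, $b_k(R^{(1)}\otimes\cdots\otimes R^{(k)})$ is the sum of all terms $b^B(F^{(0)}_\bullet\otimes\cdots\otimes F^{(0)}_\bullet\otimes R^{(1)}_\bullet\otimes F^{(1)}_\bullet\otimes\cdots\otimes R^{(k)}_\bullet\otimes F^{(k)}_\bullet\otimes\cdots\otimes F^{(k)}_\bullet)$, with any number ($\ge0$) of factors $F^{(i)}_\bullet$ between consecutive $R$'s and at both ends. Hochschild cohomology. The Hochschild complex of an $A_\infty$-category $A$ is by definition $\mathbb{HH}(A,A)=Hom^\bullet_{\mathcal{A}_\infty(A,A)}(Id_A,Id_A)$ with differential $m_1$, and $HH^{j}(A,A)=H^{j}(\mathbb{HH}(A,A))$. Nerve and mapping space. $dg[\Delta^n]$ is the dg-category with objects $0,\dots,n$, $Hom^\bullet(i,j)=\mathbb{K}\cdot(i,j)$ in degree $0$ for $i\le j$ and $0$ for $i>j$, zero differential, and composition of $(i,j)$ with $(j,k)$ equal to $(i,k)$; it is cosimplicial in $[n]$. For an $A_\infty$-category $B$, $N_{A_\infty}(B)$ is the simplicial set whose $n$-simplices are the unital $A_\infty$-functors $dg[\Delta^n]\to B$; it is known to be a weak Kan complex ($(\infty,1)$-category). For a weak Kan complex $X$ and vertices $x,y$, $Map_X(x,y)$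 is the mapping space, which may be modelled by the left mapping space, the Kan complex whose $n$-simplices are the maps $\Delta^{n+1}\to X$ sending vertex $0$ to $x$ and whose restriction to the face opposite to vertex $0$ is the constant simplex at $y$. The equality in the claim is a bijection for $i=0$ and a group isomorphism for $i\ge1$, with base point the vertex given by the identity (degenerate) morphism of $Id_A$. *)

theory Defs
  imports Complex_Main "HOL-Library.Function_Algebras" "HOL-Library.FuncSet" "HOL-Algebra.Coset"
begin

section \<open>Strings of homogeneous morphisms and Koszul signs\<close>

text \<open>
  A homogeneous morphism is recorded together with its source, its target and its
  (unshifted) degree, so that the sign rule can be read off from the data.  A multilinear
  family on tensor products of graded Hom spaces is given by its values on strings of
  homogeneous morphisms.
\<close>

datatype ('o, 'v) arr = Arr (src: 'o) (tgt: 'o) (deg: int) (val: 'v)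

definition sg :: "int \<Rightarrow> 'v::ab_group_add \<Rightarrow> 'v" where
  "sg n v = (if even n then v else - v)"

text \<open>The degree of \<open>s a\<^sub>1 \<otimes> \<dots> \<otimes> s a\<^sub>n\<close>.\<close>

definition sdeg :: "('o, 'v) arr list \<Rightarrow> int" where
  "sdeg as = (\<Sum>a\<leftarrow>as. deg a - 1)"

text \<open>
  The Koszul sign of desuspension: \<open>(s\<^sup>-\<^sup>1)\<^sup>\<otimes>\<^sup>n (s a\<^sub>1 \<otimes> \<dots> \<otimes> s a\<^sub>n)\<close> equals
  \<open>a\<^sub>1 \<otimes> \<dots> \<otimes> a\<^sub>n\<close> up to the sign with exponent \<open>\<Sum>\<^sub>i (n - i) (deg a\<^sub>i - 1)\<close>,
  because each of the \<open>n - i\<close> maps \<open>s\<^sup>-\<^sup>1\<close> (of degree 1) to the right of position \<open>i\<close>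
  has to pass \<open>s a\<^sub>i\<close>.
\<close>

fun susp :: "('o, 'v) arr list \<Rightarrow> int" where
  "susp [] = 0"
| "susp (a # as) = int (length as) * (deg a - 1) + susp as"

text \<open>The endpoint of a string starting at \<open>x\<close>; the string may be empty.\<close>

definition fin :: "'o \<Rightarrow> ('o, 'v) arr list \<Rightarrow> 'o" where
  "fin x as = (if as = [] then x else tgt (last as))"

text \<open>All ways of writing a string as \<open>p @ q @ t\<close> with \<open>q\<close> nonempty.\<close>

definition splits :: "'a list \<Rightarrow> ('a list \<times> 'a list \<times> 'a list) set" where
  "splits as = {(p, q, t). p @ q @ t = as \<and> q \<noteq> []}"


section \<open>Strictly unital A-infinity categories\<close>

text \<open>
  The degree \<open>d\<close> part of the graded vector space of morphisms from \<open>x\<close> to \<open>y\<close> is a linear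
  subspace \<open>Hom A x y d\<close> of one ambient vector space \<open>'v\<close> with scalar multiplication
  \<open>scl A\<close>.  This is no restriction, since any family of vector spaces embeds into its direct
  sum; no relation between different \<open>Hom A x y d\<close> is imposed or used.
  \<open>ops A [a\<^sub>1, \<dots>, a\<^sub>k]\<close> is \<open>m\<^sub>k(a\<^sub>1, \<dots>, a\<^sub>k)\<close>, and its values are irrelevant on lists which are
  not composable strings.
\<close>

record ('o, 'v, 'k) ainf =
  Obj :: "'o set"
  Hom :: "'o \<Rightarrow> 'o \<Rightarrow> int \<Rightarrow> 'v set"
  scl :: "'k \<Rightarrow> 'v \<Rightarrow> 'v"
  ops :: "('o, 'v) arr list \<Rightarrow> 'v"
  unt :: "'o \<Rightarrow> 'v"

text \<open>\<open>as\<close> is a composable string of homogeneous morphisms of \<open>A\<close> from \<open>x\<close> to \<open>y\<close>.\<close>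

fun string :: "('o, 'v, 'k) ainf \<Rightarrow> 'o \<Rightarrow> ('o, 'v) arr list \<Rightarrow> 'o \<Rightarrow> bool" where
  "string A x [] y \<longleftrightarrow> x \<in> Obj A \<and> x = y"
| "string A x (a # as) y \<longleftrightarrow>
     x \<in> Obj A \<and> src a = x \<and> val a \<in> Hom A x (tgt a) (deg a) \<and> string A (tgt a) as y"

text \<open>
  A family of graded multilinear maps of degree \<open>e - n\<close>
  \<open>Hom\<^sub>A(x\<^sub>0, x\<^sub>1) \<otimes> \<dots> \<otimes> Hom\<^sub>A(x\<^sub>n\<^sub>-\<^sub>1, x\<^sub>n) \<rightarrow> Hom\<^sub>B(p x\<^sub>0, q x\<^sub>n)\<close>, for all \<open>n \<ge> N\<close>.  The initial
  object \<open>x\<^sub>0\<close> is passed separately because of the case \<open>n = 0\<close>.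
\<close>

definition graded_multilinear ::
  "('o, 'v::ab_group_add, 'k) ainf \<Rightarrow> ('p, 'w::ab_group_add, 'k) ainf \<Rightarrow> ('o \<Rightarrow> 'p) \<Rightarrow> ('o \<Rightarrow> 'p)
    \<Rightarrow> int \<Rightarrow> nat \<Rightarrow> ('o \<Rightarrow> ('o, 'v) arr list \<Rightarrow> 'w) \<Rightarrow> bool" where
  "graded_multilinear A B p q e N \<phi> \<longleftrightarrow>
     (\<forall>x as y. string A x as y \<and> N \<le> length as \<longrightarrow>
        \<phi> x as \<in> Hom B (p x) (q y) ((\<Sum>a\<leftarrow>as. deg a) + e - int (length as))) \<and>
     (\<forall>x as z w d u v bs y.
        string A x (as @ Arr z w d u # bs) y \<and> string A x (as @ Arr z w d v # bs) y \<and>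
        N \<le> Suc (length as + length bs) \<longrightarrow>
        \<phi> x (as @ Arr z w d (u + v) # bs)
          = \<phi> x (as @ Arr z w d u # bs) + \<phi> x (as @ Arr z w d v # bs)) \<and>
     (\<forall>x as z w d u c bs y.
        string A x (as @ Arr z w d u # bs) y \<and> N \<le> Suc (length as + length bs) \<longrightarrow>
        \<phi> x (as @ Arr z w d (scl A c u) # bs) = scl B c (\<phi> x (as @ Arr z w d u # bs)))"

text \<open>
  The shifted operations \<open>b\<^sub>k = s m\<^sub>k (s\<^sup>-\<^sup>1)\<^sup>\<otimes>\<^sup>k\<close>: the element \<open>b\<^sub>k(s a\<^sub>1, \<dots>, s a\<^sub>k)\<close> is
  \<open>s\<close> applied to \<open>b_op A [a\<^sub>1, \<dots>, a\<^sub>k]\<close>.  Its shifted degree is \<open>sdeg as + 1\<close>, hence its unshifted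
  degree is \<open>sdeg as + 2\<close>.
\<close>

definition b_op :: "('o, 'v::ab_group_add, 'k) ainf \<Rightarrow> ('o, 'v) arr list \<Rightarrow> 'v" where
  "b_op A as = sg (susp as) (ops A as)"

definition b_arr :: "('o, 'v::ab_group_add, 'k) ainf \<Rightarrow> ('o, 'v) arr list \<Rightarrow> ('o, 'v) arr" where
  "b_arr A as = Arr (src (hd as)) (tgt (last as)) (sdeg as + 2) (b_op A as)"

definition unit_arr :: "('o, 'v, 'k) ainf \<Rightarrow> 'o \<Rightarrow> ('o, 'v) arr" where
  "unit_arr A x = Arr x x 0 (unt A x)"

definition ainf_category :: "('o, 'v::ab_group_add, 'k::field) ainf \<Rightarrow> bool" where
  "ainf_category A \<longleftrightarrow>
     vector_space (scl A) \<and>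
     (\<forall>x\<in>Obj A. \<forall>y\<in>Obj A. \<forall>d. module.subspace (scl A) (Hom A x y d)) \<and>
     graded_multilinear A A (\<lambda>x. x) (\<lambda>x. x) 2 1 (\<lambda>_. ops A) \<and>
     (\<forall>x as y. string A x as y \<and> as \<noteq> [] \<longrightarrow>
        (\<Sum>(p, q, t)\<in>splits as. sg (sdeg p) (b_op A (p @ b_arr A q # t))) = 0) \<and>
     (\<forall>x\<in>Obj A. unt A x \<in> Hom A x x 0 \<and> ops A [unit_arr A x] = 0) \<and>
     (\<forall>x\<in>Obj A. \<forall>y\<in>Obj A. \<forall>d. \<forall>v\<in>Hom A x y d.
        ops A [unit_arr A x, Arr x y d v] = v \<and> ops A [Arr x y d v, unit_arr A y] = v) \<and>
     (\<forall>x as y z. string A x as y \<and> 3 \<le> length as \<and> unit_arr A z \<in> set as \<longrightarrow> ops A as = 0)"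


section \<open>Unital A-infinity functors\<close>

datatype ('o, 'v, 'p, 'w) afun =
  AFun (fob: "'o \<Rightarrow> 'p") (fcomp: "('o, 'v) arr list \<Rightarrow> 'w")

text \<open>\<open>s\<close> applied to the value of \<open>F\<^sub>n = s f\<^sub>n (s\<^sup>-\<^sup>1)\<^sup>\<otimes>\<^sup>n\<close>, as for \<open>b_op\<close> and \<open>b_arr\<close>.\<close>

definition F_op :: "('o, 'v, 'p, 'w::ab_group_add) afun \<Rightarrow> ('o, 'v) arr list \<Rightarrow> 'w" where
  "F_op f as = sg (susp as) (fcomp f as)"

definition F_arr ::
  "('o, 'v, 'p, 'w::ab_group_add) afun \<Rightarrow> ('o, 'v) arr list \<Rightarrow> ('p, 'w) arr" where
  "F_arr f as = Arr (fob f (src (hd as))) (fob f (tgt (last as))) (sdeg as + 1) (F_op f as)"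

text \<open>
  The object map and the components are normalised outside of their domains, so that equality
  of functors is equality in HOL.
\<close>

definition ainf_functor ::
  "('o, 'v::ab_group_add, 'k) ainf \<Rightarrow> ('p, 'w::ab_group_add, 'k) ainf
    \<Rightarrow> ('o, 'v, 'p, 'w) afun \<Rightarrow> bool" where
  "ainf_functor A B f \<longleftrightarrow>
     fob f \<in> Obj A \<rightarrow>\<^sub>E Obj B \<and>
     (\<forall>as. as = [] \<or> (\<nexists>x y. string A x as y) \<longrightarrow> fcomp f as = 0) \<and>
     graded_multilinear A B (fob f) (fob f) 1 1 (\<lambda>_. fcomp f) \<and>
     (\<forall>x as y. string A x as y \<and> as \<noteq> [] \<longrightarrow>
        (\<Sum>(p, q, t)\<in>splits as. sg (sdeg p) (F_op f (p @ b_arr A q # t)))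
          = (\<Sum>qs\<in>{qs. concat qs = as \<and> [] \<notin> set qs}. b_op B (map (F_arr f) qs))) \<and>
     (\<forall>x\<in>Obj A. fcomp f [unit_arr A x] = unt B (fob f x)) \<and>
     (\<forall>x as y z. string A x as y \<and> 2 \<le> length as \<and> unit_arr A z \<in> set as \<longrightarrow> fcomp f as = 0)"

definition id_functor :: "('o, 'v::ab_group_add, 'k) ainf \<Rightarrow> ('o, 'v, 'o, 'v) afun" where
  "id_functor A = AFun (\<lambda>x\<in>Obj A. x)
     (\<lambda>as. case as of [a] \<Rightarrow> (if \<exists>x y. string A x [a] y then val a else 0) | _ \<Rightarrow> 0)"


section \<open>The A-infinity category of unital A-infinity functors\<close>

text \<open>
  Elements of \<open>Hom\<^sup>d(f, g)\<close>: the family \<open>(r\<^sub>n)\<close> for \<open>n \<ge> 0\<close>, where \<open>r x [a\<^sub>1, \<dots>, a\<^sub>n]\<close> is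
  \<open>r\<^sub>n(a\<^sub>1, \<dots>, a\<^sub>n)\<close> for a string starting at \<open>x\<close>, normalised to be zero on all other arguments.
\<close>

definition transformations ::
  "('o, 'v::ab_group_add, 'k) ainf \<Rightarrow> ('p, 'w::ab_group_add, 'k) ainf
    \<Rightarrow> ('o, 'v, 'p, 'w) afun \<Rightarrow> ('o, 'v, 'p, 'w) afun \<Rightarrow> int
    \<Rightarrow> ('o \<Rightarrow> ('o, 'v) arr list \<Rightarrow> 'w) set" where
  "transformations A B f g d =
     {r. graded_multilinear A B (fob f) (fob g) d 0 r \<and>
         (\<forall>x as. (\<nexists>y. string A x as y) \<longrightarrow> r x as = 0)}"

type_synonym ('o, 'v, 'p, 'w) tarr =
  "(('o, 'v, 'p, 'w) afun, 'o \<Rightarrow> ('o, 'v) arr list \<Rightarrow> 'w) arr"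

text \<open>
  \<open>R_op \<rho> x as\<close> is the value of \<open>R\<^sub>n = s r\<^sub>n (s\<^sup>-\<^sup>1)\<^sup>\<otimes>\<^sup>n\<close> (up to applying \<open>s\<close>), a map of
  degree \<open>deg \<rho> - 1\<close>.
\<close>

definition R_op :: "('o, 'v, 'p, 'w::ab_group_add) tarr \<Rightarrow> 'o \<Rightarrow> ('o, 'v) arr list \<Rightarrow> 'w" where
  "R_op \<rho> x as = sg (susp as) (val \<rho> x as)"

definition R_arr ::
  "('o, 'v, 'p, 'w::ab_group_add) tarr \<Rightarrow> 'o \<Rightarrow> ('o, 'v) arr list \<Rightarrow> ('p, 'w) arr" where
  "R_arr \<rho> x as =
     Arr (fob (src \<rho>) x) (fob (tgt \<rho>) (fin x as)) (sdeg as + deg \<rho>) (R_op \<rho> x as)"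

text \<open>
  The terms of \<open>b\<^sub>k(R\<^sup>1 \<otimes> \<dots> \<otimes> R\<^sup>k)\<close> on a string \<open>as\<close> are indexed by the decompositions of
  \<open>as\<close> into consecutive blocks, of which exactly \<open>k\<close> are fed to the \<open>R\<^sup>i\<close> (these may be empty)
  and all others are fed to functors (these are nonempty).
\<close>

datatype 'a block = FBlock (body: "'a list") | RBlock (body: "'a list")

definition is_R :: "'a block \<Rightarrow> bool" where
  "is_R D = (case D of FBlock _ \<Rightarrow> False | RBlock _ \<Rightarrow> True)"

definition decompositions :: "nat \<Rightarrow> 'a list \<Rightarrow> 'a block list set" where
  "decompositions k as =
     {Ds. concat (map body Ds) = as \<and> FBlock [] \<notin> set Ds \<and> length (filter is_R Ds) = k}"

text \<open>
  The string of \<open>F\<close>s and \<open>R\<close>s obtained from a decomposition; the first two arguments are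
  the functor to be applied to the next block and the remaining \<open>R\<close>s, the third is the current
  object of \<open>A\<close>.
\<close>

fun fill :: "('o, 'v, 'p, 'w::ab_group_add) afun \<Rightarrow> ('o, 'v, 'p, 'w) tarr list \<Rightarrow> 'o
    \<Rightarrow> ('o, 'v) arr block list \<Rightarrow> ('p, 'w) arr list" where
  "fill f \<rho>s x [] = []"
| "fill f \<rho>s x (FBlock p # Ds) = F_arr f p # fill f \<rho>s (fin x p) Ds"
| "fill f (\<rho> # \<rho>s) x (RBlock p # Ds) = R_arr \<rho> x p # fill (tgt \<rho>) \<rho>s (fin x p) Ds"
| "fill f [] x (RBlock p # Ds) = []"

text \<open>
  The Koszul sign for applying the tensor product of the \<open>F\<close>s (of degree 0) and the \<open>R\<close>s (of
  degree \<open>deg \<rho> - 1\<close>): each \<open>R\<close> passes everything to the left of its block, which has shifted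
  degree \<open>e\<close>.
\<close>

fun fill_sign :: "('o, 'v, 'p, 'w) tarr list \<Rightarrow> int \<Rightarrow> ('o, 'v) arr block list \<Rightarrow> int" where
  "fill_sign \<rho>s e [] = 0"
| "fill_sign \<rho>s e (FBlock p # Ds) = fill_sign \<rho>s (e + sdeg p) Ds"
| "fill_sign (\<rho> # \<rho>s) e (RBlock p # Ds) = (deg \<rho> - 1) * e + fill_sign \<rho>s (e + sdeg p) Ds"
| "fill_sign [] e (RBlock p # Ds) = 0"

text \<open>The value of \<open>b\<^sub>k(R\<^sup>1 \<otimes> \<dots> \<otimes> R\<^sup>k)\<close> on a string starting at \<open>x\<close>.\<close>

definition bR_op ::
  "('o, 'v::ab_group_add, 'k) ainf \<Rightarrow> ('p, 'w::ab_group_add, 'k) ainf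
    \<Rightarrow> ('o, 'v, 'p, 'w) tarr list \<Rightarrow> 'o \<Rightarrow> ('o, 'v) arr list \<Rightarrow> 'w" where
  "bR_op A B \<rho>s x as =
     (\<Sum>Ds\<in>decompositions (length \<rho>s) as.
        sg (fill_sign \<rho>s 0 Ds) (b_op B (fill (src (hd \<rho>s)) \<rho>s x Ds)))
     - (case \<rho>s of
          [\<rho>] \<Rightarrow> sg (deg \<rho> - 1)
                  (\<Sum>(p, q, t)\<in>splits as. sg (sdeg p) (R_op \<rho> x (p @ b_arr A q # t)))
        | _ \<Rightarrow> 0)"

text \<open>
  In \<open>ops\<close>, one sign desuspends the arguments of the resulting transformation, and the other one
  converts \<open>b\<^sub>k\<close> into \<open>m\<^sub>k\<close>.  The unit of \<open>f\<close> is the transformation with \<open>r\<^sub>0\<close> given by the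
  units of \<open>B\<close> and \<open>r\<^sub>n = 0\<close> for \<open>n \<ge> 1\<close>.
\<close>

definition functor_category ::
  "('o, 'v::ab_group_add, 'k) ainf \<Rightarrow> ('p, 'w::ab_group_add, 'k) ainf
    \<Rightarrow> (('o, 'v, 'p, 'w) afun, 'o \<Rightarrow> ('o, 'v) arr list \<Rightarrow> 'w, 'k) ainf" where
  "functor_category A B = \<lparr>
     Obj = {f. ainf_functor A B f},
     Hom = transformations A B,
     scl = (\<lambda>c r x as. scl B c (r x as)),
     ops = (\<lambda>\<rho>s x as. if \<exists>y. string A x as y
                       then sg (susp \<rho>s) (sg (susp as) (bR_op A B \<rho>s x as)) else 0),
     unt = (\<lambda>f x as. if x \<in> Obj A \<and> as = [] then unt B (fob f x) else 0) \<rparr>"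


section \<open>Hochschild cohomology\<close>

definition hom_cocycles ::
  "('o, 'v::ab_group_add, 'k) ainf \<Rightarrow> 'o \<Rightarrow> 'o \<Rightarrow> int \<Rightarrow> 'v set" where
  "hom_cocycles B x y j = {v \<in> Hom B x y j. ops B [Arr x y j v] = 0}"

definition hom_coboundaries ::
  "('o, 'v::ab_group_add, 'k) ainf \<Rightarrow> 'o \<Rightarrow> 'o \<Rightarrow> int \<Rightarrow> 'v set" where
  "hom_coboundaries B x y j = (\<lambda>u. ops B [Arr x y (j - 1) u]) ` Hom B x y (j - 1)"

definition hom_cohomology ::
  "('o, 'v::ab_group_add, 'k) ainf \<Rightarrow> 'o \<Rightarrow> 'o \<Rightarrow> int \<Rightarrow> 'v set monoid" where
  "hom_cohomology B x y j =
     \<lparr>carrier = hom_cocycles B x y j, mult = (+), one = 0\<rparr> Mod hom_coboundaries B x y j"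

definition HH :: "('o, 'v::ab_group_add, 'k) ainf \<Rightarrow> int
    \<Rightarrow> ('o \<Rightarrow> ('o, 'v) arr list \<Rightarrow> 'v) set monoid" where
  "HH A j = hom_cohomology (functor_category A A) (id_functor A) (id_functor A) j"


section \<open>Simplicial sets, the nerve and mapping spaces\<close>

text \<open>
  \<open>act X m n \<alpha>\<close> is the map \<open>X\<^sub>n \<rightarrow> X\<^sub>m\<close> induced by a monotone map \<open>\<alpha>: [m] \<rightarrow> [n]\<close>, which is
  represented by a function on the naturals whose values outside of \<open>{0..m}\<close> are irrelevant.
\<close>

record 's sset =
  spx :: "nat \<Rightarrow> 's set"
  act :: "nat \<Rightarrow> nat \<Rightarrow> (nat \<Rightarrow> nat) \<Rightarrow> 's \<Rightarrow> 's"

definition coface :: "nat \<Rightarrow> nat \<Rightarrow> nat" where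
  "coface i j = (if j < i then j else Suc j)"

text \<open>The face \<open>d\<^sub>i\<close> of an \<open>n\<close>-simplex (\<open>n \<ge> 1\<close>), and the constant \<open>n\<close>-simplex at a vertex.\<close>

definition face :: "'s sset \<Rightarrow> nat \<Rightarrow> nat \<Rightarrow> 's \<Rightarrow> 's" where
  "face X n i = act X (n - 1) n (coface i)"

definition const_spx :: "'s sset \<Rightarrow> nat \<Rightarrow> 's \<Rightarrow> 's" where
  "const_spx X n = act X n 0 (\<lambda>_. 0)"

text \<open>The dg-category \<open>dg[\<Delta>\<^sup>n]\<close>; the basis vector \<open>(i, j)\<close> is the element \<open>1\<close> of \<open>'k\<close>.\<close>

definition dg_simplex :: "nat \<Rightarrow> (nat, 'k::field, 'k) ainf" where
  "dg_simplex n = \<lparr>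
     Obj = {..n},
     Hom = (\<lambda>i j d. if i \<le> j \<and> d = 0 then UNIV else {0}),
     scl = (*),
     ops = (\<lambda>as. case as of [a, b] \<Rightarrow> val a * val b | _ \<Rightarrow> 0),
     unt = (\<lambda>_. 1) \<rparr>"

text \<open>Simplicial operators act by precomposition with the strict functor induced by \<open>\<alpha>\<close>.\<close>

definition nerve ::
  "('p, 'w::ab_group_add, 'k::field) ainf \<Rightarrow> (nat, 'k, 'p, 'w) afun sset" where
  "nerve B = \<lparr>
     spx = (\<lambda>n. {\<sigma>. ainf_functor (dg_simplex n) B \<sigma>}),
     act = (\<lambda>m n \<alpha> \<sigma>. AFun
       (\<lambda>i\<in>{..m}. fob \<sigma> (\<alpha> i))
       (\<lambda>as. if as \<noteq> [] \<and> (\<exists>i j. string (dg_simplex m :: (nat, 'k, 'k) ainf) i as j)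
              then fcomp \<sigma> (map (map_arr \<alpha> id) as) else 0)) \<rparr>"

text \<open>The vertex of the nerve given by an object.\<close>

definition nerve_vertex ::
  "('p, 'w::ab_group_add, 'k::field) ainf \<Rightarrow> 'p \<Rightarrow> (nat, 'k, 'p, 'w) afun" where
  "nerve_vertex B x = AFun
     (\<lambda>i\<in>{..0}. x)
     (\<lambda>as. case as of
        [a] \<Rightarrow> (if string (dg_simplex 0 :: (nat, 'k, 'k) ainf) 0 [a] 0
                then scl B (val a) (unt B x) else 0)
      | _ \<Rightarrow> 0)"

text \<open>
  The left mapping space.  Maps \<open>\<Delta>\<^sup>n\<^sup>+\<^sup>1 \<rightarrow> X\<close> are identified with \<open>(n+1)\<close>-simplices of \<open>X\<close>;
  \<open>\<alpha>: [m] \<rightarrow> [n]\<close> acts through its extension \<open>[m+1] \<rightarrow> [n+1]\<close>, \<open>0 \<mapsto> 0\<close>, \<open>i + 1 \<mapsto> \<alpha> i + 1\<close>.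
\<close>

definition left_mapping_space :: "'s sset \<Rightarrow> 's \<Rightarrow> 's \<Rightarrow> 's sset" where
  "left_mapping_space X x y = \<lparr>
     spx = (\<lambda>n. {\<sigma> \<in> spx X (Suc n).
              act X 0 (Suc n) (\<lambda>_. 0) \<sigma> = x \<and> face X (Suc n) 0 \<sigma> = const_spx X n y}),
     act = (\<lambda>m n \<alpha>. act X (Suc m) (Suc n) (case_nat 0 (\<lambda>i. Suc (\<alpha> i)))) \<rparr>"


section \<open>Simplicial homotopy groups of a Kan complex\<close>

text \<open>
  The combinatorial description for a Kan complex \<open>K\<close> with base vertex \<open>v\<close>: elements of
  \<open>\<pi>\<^sub>n\<close> are classes of \<open>n\<close>-simplices whose whole boundary is at the base point, where
  \<open>\<sigma> \<sim> \<tau>\<close> if there is an \<open>(n+1)\<close>-simplex with faces \<open>(v, \<dots>, v, \<sigma>, \<tau>)\<close>, and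
  \<open>[\<sigma>] \<cdot> [\<tau>] = [d\<^sub>n w]\<close> for any \<open>(n+1)\<close>-simplex \<open>w\<close> with faces \<open>(v, \<dots>, v, \<sigma>, d\<^sub>n w, \<tau>)\<close>.
  For \<open>n = 0\<close> this is the set of vertices modulo the relation of being joined by an edge.
\<close>

definition spheres :: "'s sset \<Rightarrow> 's \<Rightarrow> nat \<Rightarrow> 's set" where
  "spheres K v n = {\<sigma> \<in> spx K n. n \<noteq> 0 \<longrightarrow> (\<forall>i\<le>n. face K n i \<sigma> = const_spx K (n - 1) v)}"

definition htpy :: "'s sset \<Rightarrow> 's \<Rightarrow> nat \<Rightarrow> ('s \<times> 's) set" where
  "htpy K v n = {(\<sigma>, \<tau>). \<sigma> \<in> spheres K v n \<and> \<tau> \<in> spheres K v n \<and>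
     (\<exists>w\<in>spx K (Suc n). (\<forall>i<n. face K (Suc n) i w = const_spx K n v) \<and>
        face K (Suc n) n w = \<sigma> \<and> face K (Suc n) (Suc n) w = \<tau>)}"

definition homotopy_set :: "'s sset \<Rightarrow> 's \<Rightarrow> nat \<Rightarrow> 's set set" where
  "homotopy_set K v n = spheres K v n // htpy K v n"

text \<open>
  For \<open>n \<ge> 1\<close>.  The product of two classes is written as the union of the classes of all
  \<open>d\<^sub>n w\<close>; in a Kan complex these classes agree.
\<close>

definition homotopy_group :: "'s sset \<Rightarrow> 's \<Rightarrow> nat \<Rightarrow> 's set monoid" where
  "homotopy_group K v n = \<lparr>
     carrier = homotopy_set K v n,
     mult = (\<lambda>C D. \<Union>w\<in>{w \<in> spx K (Suc n).
               (\<forall>i<n - 1. face K (Suc n) i w = const_spx K n v) \<and>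
               face K (Suc n) (n - 1) w \<in> C \<and> face K (Suc n) (Suc n) w \<in> D}.
             htpy K v n `` {face K (Suc n) n w}),
     one = htpy K v n `` {const_spx K n v} \<rparr>"

end

(*
  An n-simplex of the left mapping space from x to x in the nerve of B is a unital A-infinity functor
  on dg[Delta^(n+1)] whose restriction to the face opposite to vertex 0 is constant.  By unitality, all
  products in the functor equations that involve this face are trivial, so the only data are the values
  g(S) in Hom(x, x) of degree 1 - |S| on the nonempty faces S of Delta^n, and the equations say that
  m_1 g(S) is the alternating sum of the g(S - s).  Thus the mapping space is the simplicial set that
  the Dold-Kan correspondence attaches to the endomorphism complex of x, translated by the identity:
  spheres are cocycles, homotopies are coboundaries, and the product of spheres is their sum.

  For B the functor category and x the identity functor, the differential is the bracket with the
  A-infinity structure b of A, and its square vanishes by b o b = 0 and the pre-Lie identity for the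
  Gerstenhaber composition.
*)
theory Submission
  imports Defs
begin

text \<open>Why unitality suffices: in the functor equation on a chain of the simplex with n + 2
  vertices, cut into blocks, look at the vertex shared by the first two blocks. If it is 0, the
  first block sits at the source vertex; otherwise the second lies in the constant face. That block
  carries a multiple of the unit or 0, so three or more blocks contribute nothing and two blocks
  contribute only extremal deletions. The obstacle is the degenerate chains: a chain with two
  vertices carries the unit, a longer one carries 0, so their equations need a separate check. The
  two halves meet in a locale that records what the mapping space sees of its target: a complex,
  homogeneity of each m_k in every slot, and strict units. The functor category is then checked
  against it. On the Hochschild side, transformations have a component r_0, so insertions of the
  empty string occur, and b gets the value 0 there. Suspension signs are absorbed into the families;
  what remains is (-1)^((e - 1) * sdeg p) for an operator of shifted degree e - 1 passing the prefix
  p, an exponent additive in both degrees.\<close>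

lemma sg_0 [simp]: "sg n (0::'v::ab_group_add) = 0"
  by (simp add: sg_def)

lemma sg_zero [simp]: "sg 0 v = v"
  by (simp add: sg_def)

lemma sg_add: "sg n (u + v) = sg n u + sg n v"
  by (simp add: sg_def)

lemma sg_diff: "sg n (u - v) = sg n u - sg n v"
  by (simp add: sg_def)

lemma sg_sg: "sg m (sg n v) = sg (m + n) v"
  by (auto simp: sg_def)

lemma sg_sum: "sg n (sum f S) = (\<Sum>x\<in>S. sg n (f x))"
  by (simp add: sg_def sum_negf)

lemma sg_self [simp]: "sg n (sg n v) = v"
  by (simp add: sg_def)

lemma sg_inject [simp]: "sg n u = sg n v \<longleftrightarrow> u = v"
  by (simp add: sg_def)

section \<open>Degrees, composable strings and finite index sets\<close>

lemma sdeg_simps [simp]: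
  "sdeg [] = 0" "sdeg (a # as) = deg a - 1 + sdeg as" "sdeg (as @ bs) = sdeg as + sdeg bs"
  by (simp_all add: sdeg_def)

lemma sdeg_eq: "sdeg as = (\<Sum>a\<leftarrow>as. deg a) - int (length as)"
  by (induction as) auto

lemma fin_simps [simp]:
  "fin x [] = x" "fin x (a # as) = fin (tgt a) as" "fin x (as @ bs) = fin (fin x as) bs"
  by (auto simp: fin_def)

lemma string_obj: "string A x as y \<Longrightarrow> x \<in> Obj A \<and> y \<in> Obj A"
  by (induction as arbitrary: x) auto

lemma string_fin: "string A x as y \<Longrightarrow> y = fin x as"
  by (induction as arbitrary: x) auto

lemma string_append: "string A x (as @ bs) y \<longleftrightarrow> (\<exists>z. string A x as z \<and> string A z bs y)"
  by (induction as arbitrary: x) (auto dest: string_obj)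

lemma string_src_hd: "string A x as y \<Longrightarrow> as \<noteq> [] \<Longrightarrow> src (hd as) = x"
  by (cases as) auto

lemma string_tgt_last: "string A x as y \<Longrightarrow> as \<noteq> [] \<Longrightarrow> tgt (last as) = y"
  by (metis string_fin fin_def)

text \<open>A sum over an infinite set is 0 in HOL, so index sets have to be proved finite before
  their sums can be manipulated. Nonempty blocks bound the number of blocks by the length of the
  string.\<close>

lemma finite_parts: "finite {qs. concat qs = as \<and> [] \<notin> set qs}"
proof (rule finite_subset)
  show "{qs. concat qs = as \<and> [] \<notin> set qs}
    \<subseteq> {qs. set qs \<subseteq> {q. set q \<subseteq> set as \<and> length q \<le> length as} \<and> length qs \<le> length as}"
  proof (intro subsetI, clarsimp)
    fix qs :: "'a list list" assume "[] \<notin> set qs"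
    then have "length qs \<le> length (concat qs) \<and> (\<forall>q\<in>set qs. length q \<le> length (concat qs))"
    proof (induction qs)
      case (Cons a qs)
      then have "length a \<ge> 1" by (cases a) auto
      with Cons show ?case by fastforce
    qed simp
    then show "set qs \<subseteq> {q. set q \<subseteq> (\<Union>a\<in>set qs. set a) \<and> length q \<le> length (concat qs)} \<and>
      length qs \<le> length (concat qs)" by auto
  qed
  show "finite {qs. set qs \<subseteq> {q. set q \<subseteq> set as \<and> length q \<le> length as} \<and> length qs \<le> length as}"
    by (intro finite_lists_length_le) auto
qed

lemma finite_splits: "finite (splits as)"
proof (rule finite_subset)
  let ?S = "{q. set q \<subseteq> set as \<and> length q \<le> length as}"
  show "splits as \<subseteq> ?S \<times> ?S \<times> ?S" by (auto simp: splits_def)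
  show "finite (?S \<times> ?S \<times> ?S)"
    by (intro finite_cartesian_product finite_lists_length_le) auto
qed

lemma graded_multilinear_mem: "graded_multilinear A B p q e N \<phi> \<Longrightarrow> string A x as y \<Longrightarrow> N \<le> length as \<Longrightarrow>
    \<phi> x as \<in> Hom B (p x) (q y) ((\<Sum>a\<leftarrow>as. deg a) + e - int (length as))"
  by (simp add: graded_multilinear_def)

lemma graded_multilinear_scale:
  assumes "graded_multilinear A B p q e N \<phi>" "string A x (as @ Arr z w d u # bs) y"
    "N \<le> Suc (length as + length bs)"
  shows "\<phi> x (as @ Arr z w d (scl A c u) # bs) = scl B c (\<phi> x (as @ Arr z w d u # bs))"
proof -
  have "\<forall>x as z w d u c bs y.
        string A x (as @ Arr z w d u # bs) y \<and> N \<le> Suc (length as + length bs) \<longrightarrow>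
        \<phi> x (as @ Arr z w d (scl A c u) # bs) = scl B c (\<phi> x (as @ Arr z w d u # bs))"
    using assms(1) unfolding graded_multilinear_def by (elim conjE)
  with assms(2,3) show ?thesis by blast
qed

section \<open>Cochains on strings of vertices\<close>

definition del :: "nat \<Rightarrow> 'a list \<Rightarrow> 'a list" where
  "del l xs = take l xs @ drop (Suc l) xs"

lemma length_del: "l < length xs \<Longrightarrow> length (del l xs) = length xs - 1"
  by (simp add: del_def)

lemma set_del: "set (del l xs) \<subseteq> set xs"
  by (auto simp: del_def dest: in_set_takeD in_set_dropD)

lemma del_Cons: "del (Suc l) (x # xs) = x # del l xs" "del 0 (x # xs) = xs"
  by (simp_all add: del_def)

lemma del_last: "xs \<noteq> [] \<Longrightarrow> del (length xs - 1) xs = butlast xs"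
  by (simp add: del_def butlast_conv_take)

lemma nth_del: "l < length xs \<Longrightarrow> m < length xs - 1 \<Longrightarrow>
    del l xs ! m = (if m < l then xs ! m else xs ! Suc m)" by (auto simp: del_def nth_append)

lemma sorted_wrt_del: "sorted_wrt P xs \<Longrightarrow> sorted_wrt P (del l xs)"
proof -
  assume "sorted_wrt P xs"
  then have "sorted_wrt P (take l xs @ drop l xs)" by simp
  then show ?thesis unfolding del_def sorted_wrt_append
    by (metis drop_Suc drop_drop in_set_dropD plus_1_eq_Suc sorted_wrt_drop)
qed

lemma del_nth_eq:
  assumes "xs ! m = xs ! Suc m" "Suc m < length xs"
  shows "del (Suc m) xs = del m xs"
  by (rule nth_equalityI) (use assms in \<open>auto simp: length_del nth_del less_Suc_eq\<close>)

text \<open>The equal neighbours survive the deletion and stay adjacent. In the alternating sum over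
  a degenerate chain this leaves only the deletions of one of the two equal vertices.\<close>

lemma del_not_strict:
  fixes xs :: "'a::preorder list"
  assumes "xs ! m = xs ! Suc m" "Suc m < length xs" "l < length xs" "l \<noteq> m" "l \<noteq> Suc m"
  shows "\<not> sorted_wrt (<) (del l xs)"
proof
  assume s: "sorted_wrt (<) (del l xs)"
  \<comment> \<open>\<open>r\<close> is the position of the equal pair after the deletion.\<close>
  define r where "r = (if l < m then m - 1 else m)"
  have r: "Suc r < length (del l xs)" using assms by (auto simp: r_def length_del)
  have "del l xs ! r = xs ! m" "del l xs ! Suc r = xs ! Suc m"
    using assms by (auto simp: r_def nth_del)
  then show False using sorted_wrt_nth_less[OF s lessI r] assms by simp
qed

lemma not_strict_repeat:
  fixes xs :: "'a::linorder list"
  assumes "sorted xs" "\<not> sorted_wrt (<) xs"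
  shows "\<exists>m. Suc m < length xs \<and> xs ! m = xs ! Suc m"
proof (rule ccontr)
  assume "\<not> ?thesis"
  then have "xs ! m < xs ! Suc m" if "Suc m < length xs" for m
    using that assms(1) by (metis Suc_lessD le_less lessI order.strict_implies_order sorted_iff_nth_mono)
  then have "sorted_wrt (<) xs" by (subst sorted_wrt_iff_nth_Suc_transp) auto
  with assms show False by simp
qed

text \<open>Every nonzero Hom space of the dg-category of a simplex is one-dimensional and in degree
  0, so multilinear families on it are determined by their values on these chains of basis
  vectors.\<close>

fun path :: "nat \<Rightarrow> nat list \<Rightarrow> (nat, 'k::one) arr list" where
  "path i [] = []"
| "path i (j # js) = Arr i j 0 1 # path j js"

lemma length_path [simp]: "length (path i js) = length js"
  by (induction js arbitrary: i) auto

lemma path_eq_Nil [simp]: "path i js = [] \<longleftrightarrow> js = []"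
  by (cases js) auto

lemma map_tgt_path [simp]: "map tgt (path i js) = js"
  by (induction js arbitrary: i) auto

lemma map_val_path [simp]: "map val (path i js :: (nat, 'k::comm_monoid_mult) arr list) = replicate (length js) 1"
  by (induction js arbitrary: i) auto

lemma path_deg: "a \<in> set (path i js) \<Longrightarrow> deg a = 0"
  by (induction js arbitrary: i) auto

lemma path_map: "map (map_arr \<alpha> id) (path i js) = path (\<alpha> i) (map \<alpha> js)"
  by (induction js arbitrary: i) auto

lemma src_hd_path [simp]: "js \<noteq> [] \<Longrightarrow> src (hd (path i js)) = i"
  by (cases js) auto

section \<open>Strings in the dg-category of a simplex\<close>

abbreviation dgs :: "nat \<Rightarrow> (nat, 'k::field, 'k) ainf" where
  "dgs \<equiv> dg_simplex"

abbreviation verts :: "(nat, 'k) arr list \<Rightarrow> nat list" where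
  "verts as \<equiv> src (hd as) # map tgt as"

abbreviation prodv :: "('o, 'k::comm_monoid_mult) arr list \<Rightarrow> 'k" where
  "prodv as \<equiv> prod_list (map val as)"

lemma dgs_simps [simp]:
  "Obj (dgs N) = {..N}" "Hom (dgs N) i j d = (if i \<le> j \<and> d = 0 then UNIV else {0})"
  "scl (dgs N) = (*)" "unt (dgs N) = (\<lambda>_. 1)" by (simp_all add: dg_simplex_def)

lemma dgs_ops: "ops (dgs N) as = (if length as = 2 then prodv as else 0)"
  by (auto simp: dg_simplex_def split: list.splits)

lemma string_path: "string (dgs N) i (path i js) j \<longleftrightarrow>
    sorted (i # js) \<and> set (i # js) \<subseteq> {..N} \<and> j = last (i # js)"
  by (induction js arbitrary: i) auto

text \<open>Zero Hom spaces are \<open>{0}\<close>, not empty, so a composable string may descend or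
  carry a nonzero degree, but only through an arrow of value 0. This is why later arguments split on
  \<open>prodv as = 0\<close>.\<close>

lemma string_dgs_nz:
  "string (dgs N) i as j \<Longrightarrow> prodv as \<noteq> 0 \<Longrightarrow>
    sorted (i # map tgt as) \<and> set (i # map tgt as) \<subseteq> {..N} \<and> (\<forall>a\<in>set as. deg a = 0)"
  by (induction as arbitrary: i) (auto split: if_splits intro: order_trans)

lemma string_map_arr:
  assumes "\<And>i j. i \<le> j \<Longrightarrow> j \<le> m \<Longrightarrow> \<alpha> i \<le> \<alpha> j \<and> \<alpha> j \<le> n"
  shows "string (dgs m) i as j \<Longrightarrow> string (dgs n) (\<alpha> i) (map (map_arr \<alpha> id) as) (\<alpha> j)"
proof (induction as arbitrary: i)
  case (Cons a as)
  moreover from this have "tgt a \<le> m" using string_obj by fastforce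
  moreover have "\<alpha> k \<le> n" if "k \<le> m" for k using assms[of k k] that by simp
  ultimately show ?case using assms by (auto simp: arr.map_sel split: if_splits)
qed (use assms in auto)

lemma susp_map_arr: "susp (map (map_arr \<alpha> id) as) = susp as"
  by (induction as) (auto simp: arr.map_sel)

lemma map_val_map_arr: "map val (map (map_arr \<alpha> id) as) = map val as"
  by (auto simp: arr.map_sel)

lemma verts_map_arr: "as \<noteq> [] \<Longrightarrow> verts (map (map_arr \<alpha> id) as) = map \<alpha> (verts as)"
  by (auto simp: hd_map arr.map_sel)

lemma susp_cong: "map deg as = map deg bs \<Longrightarrow> susp as = susp bs"
proof (induction as arbitrary: bs)
  case (Cons a as)
  then obtain b bs' where "bs = b # bs'" by (cases bs) auto
  with Cons show ?case using map_eq_imp_length_eq[of deg as deg bs'] by auto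
qed auto

text \<open>Applies to \<open>dg[\<Delta>\<^sup>n]\<close>, where \<open>m\<^sub>k\<close> vanishes for \<open>k \<noteq> 2\<close>.\<close>

lemma sum_splits_adjacent:
  fixes f :: "'a list \<Rightarrow> 'a list \<Rightarrow> 'a list \<Rightarrow> 'v::ab_group_add"
  assumes "\<And>p q t. p @ q @ t = as \<Longrightarrow> length q \<noteq> 2 \<Longrightarrow> f p q t = 0"
  shows "(\<Sum>(p, q, t)\<in>splits as. f p q t) =
    (\<Sum>l<length as - 1. f (take l as) [as ! l, as ! Suc l] (drop (Suc (Suc l)) as))"
proof -
  let ?g = "\<lambda>l. (take l as, [as ! l, as ! Suc l], drop (Suc (Suc l)) as)"
  have sub: "?g ` {..<length as - 1} \<subseteq> splits as"
    by (auto simp: splits_def Cons_nth_drop_Suc)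
  have "inj_on ?g {..<length as - 1}"
    by (rule inj_onI) (metis (lifting) length_take lessThan_iff less_diff_conv min.absorb4 
        add_lessD1 prod.inject)
  then have "(\<Sum>l<length as - 1. f (take l as) [as ! l, as ! Suc l] (drop (Suc (Suc l)) as)) =
    (\<Sum>(p, q, t)\<in>?g ` {..<length as - 1}. f p q t)" by (simp add: sum.reindex)
  also have "\<dots> = (\<Sum>(p, q, t)\<in>splits as. f p q t)"
  proof (rule sum.mono_neutral_left[OF finite_splits sub], clarify)
    fix p q t assume s: "(p, q, t) \<in> splits as" and n: "(p, q, t) \<notin> ?g ` {..<length as - 1}"
    have "length q \<noteq> 2"
    proof
      assume "length q = 2"
      then obtain a b where q: "q = [a, b]" by (auto simp: length_Suc_conv numeral_2_eq_2)
      with s have "(p, q, t) = ?g (length p)" "length p < length as - 1"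
        by (auto simp: splits_def nth_append)
      with n show False by blast
    qed
    with s assms show "f p q t = 0" by (auto simp: splits_def)
  qed
  finally show ?thesis ..
qed

text \<open>
  The part of an \<open>A\<^sub>\<infinity>\<close>-category with a distinguished object that its endomorphism mapping space
  depends on: by unitality, no relation beyond \<open>m\<^sub>1\<^sup>2 = 0\<close> enters.
\<close>

locale endo_complex = vector_space "scl B"
  for B :: "('p, 'w::ab_group_add, 'k::field) ainf" +
  fixes x :: 'p
  assumes obj: "x \<in> Obj B"
    and hom_subspace: "subspace (Hom B x x d)"
    and ops_closed: "v \<in> Hom B x x d \<Longrightarrow> ops B [Arr x x d v] \<in> Hom B x x (d + 1)"
    and ops_add: "u \<in> Hom B x x d \<Longrightarrow> v \<in> Hom B x x d \<Longrightarrow>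
        ops B [Arr x x d (u + v)] = ops B [Arr x x d u] + ops B [Arr x x d v]"
    and ops_ops: "v \<in> Hom B x x d \<Longrightarrow> ops B [Arr x x (d + 1) (ops B [Arr x x d v])] = 0"
    and ops_scale: "\<forall>a\<in>set (as @ Arr x x d u # bs).
          src a = x \<and> tgt a = x \<and> val a \<in> Hom B x x (deg a) \<Longrightarrow>
        ops B (as @ Arr x x d (scl B c u) # bs) = scl B c (ops B (as @ Arr x x d u # bs))"
    and unt_in: "unt B x \<in> Hom B x x 0"
    and ops_unt: "ops B [unit_arr B x] = 0"
    and ops_unt_left: "v \<in> Hom B x x d \<Longrightarrow> ops B [unit_arr B x, Arr x x d v] = v"
    and ops_unt_right: "v \<in> Hom B x x d \<Longrightarrow> ops B [Arr x x d v, unit_arr B x] = v"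
    and ops_unt_ge3: "\<forall>a\<in>set as. src a = x \<and> tgt a = x \<and> val a \<in> Hom B x x (deg a) \<Longrightarrow>
        3 \<le> length as \<Longrightarrow> unit_arr B x \<in> set as \<Longrightarrow> ops B as = 0"
begin

abbreviation endo :: "int \<Rightarrow> 'w set" where "endo \<equiv> Hom B x x"

abbreviation idm :: 'w where "idm \<equiv> unt B x"

definition m1 :: "int \<Rightarrow> 'w \<Rightarrow> 'w" where "m1 d v = ops B [Arr x x d v]"

definition loops :: "('p, 'w) arr list \<Rightarrow> bool" where
  "loops as \<longleftrightarrow> (\<forall>a\<in>set as. src a = x \<and> tgt a = x \<and> val a \<in> endo (deg a))"

lemma endo_0 [simp]: "0 \<in> endo d" and endo_add: "u \<in> endo d \<Longrightarrow> v \<in> endo d \<Longrightarrow> u + v \<in> endo d"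
  and endo_scale: "v \<in> endo d \<Longrightarrow> scl B c v \<in> endo d"
  using hom_subspace by (auto simp: subspace_def)

lemma endo_uminus: "v \<in> endo d \<Longrightarrow> - v \<in> endo d"
  using subspace_neg[OF hom_subspace] by simp

lemma endo_sg: "v \<in> endo d \<Longrightarrow> sg n v \<in> endo d"
  by (simp add: sg_def endo_uminus)

lemma scale_sg: "scl B c (sg n v) = sg n (scl B c v)"
  by (simp add: sg_def)

lemma m1_closed: "v \<in> endo d \<Longrightarrow> m1 d v \<in> endo (d + 1)"
  by (simp add: m1_def ops_closed)

lemma m1_add: "u \<in> endo d \<Longrightarrow> v \<in> endo d \<Longrightarrow> m1 d (u + v) = m1 d u + m1 d v"
  by (simp add: m1_def ops_add)

lemma m1_scale: "v \<in> endo d \<Longrightarrow> m1 d (scl B c v) = scl B c (m1 d v)"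
  using ops_scale[of "[]" d v "[]" c] by (simp add: m1_def)

lemma m1_0 [simp]: "m1 d 0 = 0"
  using m1_add[of 0 d 0] by simp

lemma m1_uminus: "v \<in> endo d \<Longrightarrow> m1 d (- v) = - m1 d v"
  using m1_scale[of v d "-1"] by (simp add: scale_minus_left)

lemma m1_unt [simp]: "m1 0 idm = 0"
  using ops_unt by (simp add: m1_def unit_arr_def)

lemma m1_m1: "v \<in> endo d \<Longrightarrow> m1 (d + 1) (m1 d v) = 0"
  by (simp add: m1_def ops_ops)

lemma ops_val_0:
  assumes "loops as" "a \<in> set as" "val a = 0"
  shows "ops B as = 0"
proof -
  from assms(2) obtain bs cs where as: "as = bs @ a # cs" by (meson split_list)
  have a: "a = Arr x x (deg a) (scl B 0 0)" using assms by (cases a) (auto simp: loops_def)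
  show ?thesis using assms(1) ops_scale[of bs "deg a" 0 cs 0] a by (simp add: as loops_def)
qed

text \<open>Homogeneity in the slot extracts \<open>c\<close>, and strict unitality kills the
  remaining term.\<close>

lemma ops_scaled_unit:
  assumes "loops as" "3 \<le> length as" "Arr x x 0 (scl B c idm) \<in> set as"
  shows "ops B as = 0"
proof -
  from assms(3) obtain bs cs where as: "as = bs @ Arr x x 0 (scl B c idm) # cs" by (meson split_list)
  have l: "loops (bs @ Arr x x 0 idm # cs)" using assms(1) by (auto simp: loops_def as unt_in)
  then have "ops B as = scl B c (ops B (bs @ Arr x x 0 idm # cs))"
    unfolding as by (intro ops_scale) (simp add: loops_def)
  also have "ops B (bs @ Arr x x 0 idm # cs) = 0"
    by (rule ops_unt_ge3) (use l assms(2) in \<open>auto simp: loops_def as unit_arr_def\<close>)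
  finally show ?thesis by simp
qed

lemma ops_scaled_unit_right:
  "v \<in> endo d \<Longrightarrow> ops B [Arr x x d v, Arr x x 0 (scl B c idm)] = scl B c v"
  using ops_scale[of "[Arr x x d v]" 0 idm "[]" c] ops_unt_right[of v d]
  by (simp add: unit_arr_def unt_in)

lemma ops_scaled_unit_left:
  "v \<in> endo d \<Longrightarrow> ops B [Arr x x 0 (scl B c idm), Arr x x d v] = scl B c v"
  using ops_scale[of "[]" 0 idm "[Arr x x d v]" c] ops_unt_left[of v d]
  by (simp add: unit_arr_def unt_in)

end

section \<open>Simplices of the left mapping space\<close>

lemma sort_wrt_verts_unit:
  "string A i as j \<Longrightarrow> unit_arr C z \<in> set as \<Longrightarrow> \<not> sorted_wrt (<) (i # map tgt as)"
  for i :: nat by (induction as arbitrary: i) (fastforce simp: unit_arr_def)+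

lemma F_op_scale_eq: "F_op f as = v \<longleftrightarrow> fcomp f as = sg (susp as) v"
  by (auto simp: F_op_def)

lemma verts_merge:
  assumes "Suc l < length as"
  shows "verts (take l as @ Arr (src (as ! l)) (tgt (as ! Suc l)) d v # drop (Suc (Suc l)) as) =
    del (Suc l) (verts as)"
proof -
  have "hd as = as ! 0" using assms by (cases as) auto
  then show ?thesis using assms
    by (cases l) (auto simp: del_def hd_append take_map drop_map hd_conv_nth simp flip: Cons_nth_drop_Suc)
qed

context endo_complex
begin

text \<open>
  A simplex of the left mapping space amounts to a family \<open>g\<close> of shifted values on the faces of
  \<open>\<Delta>\<^sup>n\<close>.  A face is a strictly increasing list of vertices in \<open>{1..n + 1}\<close>, since vertex \<open>0\<close> is the
  source object of the mapping space.  The following is the value on a chain of basis arrows with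
  vertices \<open>vs\<close>, which unitality determines when \<open>vs\<close> avoids \<open>0\<close> or has a repetition.
\<close>

definition cval :: "(nat list \<Rightarrow> 'w) \<Rightarrow> nat list \<Rightarrow> 'w" where
  "cval g vs = (if length vs = 2 then (if hd vs = 0 \<and> vs ! 1 \<noteq> 0 then g (tl vs) else idm)
     else if hd vs = 0 \<and> sorted_wrt (<) vs then g (tl vs) else 0)"

text \<open>\<open>g\<close> holds shifted values while functors store unshifted components, hence
  the sign. The factor \<open>prodv as\<close> is the multilinear extension from chains of basis
  arrows.\<close>

definition simplex :: "nat \<Rightarrow> (nat list \<Rightarrow> 'w) \<Rightarrow> (nat, 'k, 'p, 'w) afun" where
  "simplex n g = AFun (\<lambda>i\<in>{..Suc n}. x)
     (\<lambda>as. if as \<noteq> [] \<and> (\<exists>i j. string (dgs (Suc n) :: (nat, 'k, 'k) ainf) i as j)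
       then sg (susp as) (scl B (prodv as) (cval g (verts as))) else 0)"

definition inner :: "nat \<Rightarrow> nat list \<Rightarrow> bool" where
  "inner n js \<longleftrightarrow> js \<noteq> [] \<and> sorted_wrt (<) js \<and> set js \<subseteq> {1..Suc n}"

definition graded_cochain :: "nat \<Rightarrow> (nat list \<Rightarrow> 'w) \<Rightarrow> bool" where
  "graded_cochain n g \<longleftrightarrow> (\<forall>js. inner n js \<longrightarrow> g js \<in> endo (1 - int (length js)))"

text \<open>Deleting the vertex of a one-element list would produce the empty face, which carries no
  data. The value on a single vertex therefore has to be a cocycle.\<close>

definition closed_at :: "(nat list \<Rightarrow> 'w) \<Rightarrow> nat list \<Rightarrow> bool" where
  "closed_at g js \<longleftrightarrow> m1 (1 - int (length js)) (g js) =
     (if length js = 1 then 0 else (\<Sum>l<length js. sg (int l + 1) (g (del l js))))"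

definition chain_map :: "nat \<Rightarrow> (nat list \<Rightarrow> 'w) \<Rightarrow> bool" where
  "chain_map n g \<longleftrightarrow> graded_cochain n g \<and> (\<forall>js. inner n js \<longrightarrow> closed_at g js)"

lemma innerD: "inner n js \<Longrightarrow> length js \<le> Suc n"
  using card_mono[of "{1..Suc n}" "set js"]
  by (auto simp: inner_def strict_sorted_iff distinct_card)

lemma inner_tl: "sorted_wrt (<) (0 # js) \<Longrightarrow> set js \<subseteq> {..Suc n} \<Longrightarrow> js \<noteq> [] \<Longrightarrow> inner n js"
  by (force simp: inner_def Suc_le_eq)

lemma cval_in:
  assumes "graded_cochain n g" "sorted vs" "set vs \<subseteq> {..Suc n}" "length vs \<ge> 2"
  shows "cval g vs \<in> endo (2 - int (length vs))"
proof -
  obtain a b us where vs: "vs = a # b # us" using assms(4) by (auto simp: Suc_le_length_iff numeral_2_eq_2)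
  have "cval g vs \<in> endo (1 - int (length (b # us)))" if "a = 0" "sorted_wrt (<) vs"
  proof -
    have "inner n (b # us)" using that assms(3) by (intro inner_tl) (auto simp: vs)
    then have "g (b # us) \<in> endo (1 - int (length (b # us)))"
      using assms(1) by (simp only: graded_cochain_def)
    then show ?thesis using that by (cases us) (auto simp: cval_def vs)
  qed
  then show ?thesis using assms by (cases us) (auto simp: cval_def vs unt_in)
qed

lemma cval_degenerate: "Suc m < length vs \<Longrightarrow> vs ! m = vs ! Suc m \<Longrightarrow> 2 < length vs \<Longrightarrow> cval g vs = 0"
  using sorted_wrt_nth_less[of "(<)" vs m "Suc m"] by (auto simp: cval_def)

text \<open>The functor equation on a chain with \<open>k\<close> arrows. On the left are the merges
  of neighbouring arrows, which delete inner vertices; on the right are \<open>m1\<close>, the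
  product with a last arrow that starts away from 0, and the product with a first arrow at 0, both
  arrows carrying the unit. On a strict chain from 0 this is \<open>closed_at\<close>, where the
  product with the last arrow supplies the deletion of the last vertex. On all other chains it has
  to follow from the values that unitality prescribes.\<close>

lemma cval_identity:
  assumes g: "chain_map n g" and vs: "sorted vs" "set vs \<subseteq> {..Suc n}" "length vs = Suc k" "1 \<le> k"
  shows "(\<Sum>l<k - 1. sg (int l + 1) (cval g (del (Suc l) vs))) =
    m1 (1 - int k) (cval g vs)
    + (if 2 \<le> k \<and> vs ! (k - 1) \<noteq> 0 then sg (int k - 1) (cval g (butlast vs)) else 0)
    - (if 2 \<le> k \<and> vs ! 1 = 0 then cval g (tl vs) else 0)"
proof -
  have cl: "closed_at g js" if "vs = 0 # js" "sorted_wrt (<) vs" for js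
    using g that vs inner_tl[of js n] by (auto simp: chain_map_def Suc_le_eq)
  \<comment> \<open>For \<open>k \<le> 2\<close> the deletions or the chain itself have two
    vertices, where degenerate values are \<open>idm\<close> rather than 0, so these cases are
    computed by hand.\<close>
  consider "k = 1" | "k = 2" | "k \<ge> 3" using vs by linarith
  then show ?thesis
  proof cases
    case 1
    then obtain a b where ab: "vs = [a, b]" using vs by (auto simp: length_Suc_conv)
    show ?thesis using 1 vs cl[of "[b]"] by (auto simp: ab cval_def closed_at_def)
  next
    case 2
    then obtain a b c where abc: "vs = [a, b, c]"
      using vs by (auto simp: length_Suc_conv numeral_2_eq_2)
    have *: "a \<le> b" "b \<le> c" using vs by (auto simp: abc)
    show ?thesis using 2 * cl[of "[b, c]"] by (cases "a = 0"; cases "b = 0"; cases "b = c")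
        (auto simp: abc cval_def closed_at_def del_Cons del_def sg_def lessThan_Suc numeral_2_eq_2)
  next
    case 3
    obtain a js where ajs: "vs = a # js" using vs by (cases vs) auto
    have len: "length js = k" using vs ajs by simp
    have mono: "vs ! i \<le> vs ! j" if "i \<le> j" "j \<le> k" for i j
      using vs that by (simp add: sorted_iff_nth_mono)
    have ld: "length (del (Suc l) vs) = k" if "l < k" for l using that vs by (simp add: length_del)
    consider "a \<noteq> 0" | "a = 0" "sorted_wrt (<) vs" | "a = 0" "\<not> sorted_wrt (<) vs" by blast
    then show ?thesis
    proof cases
      case 1
      then have nz: "vs ! j \<noteq> 0" if "j \<le> k" for j
        using mono[of 0 j] that by (simp add: ajs)
      have hd: "hd (del (Suc l) vs) \<noteq> 0" for l using 1 by (simp add: ajs del_Cons)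
      have "cval g (del (Suc l) vs) = 0" if "l < k" for l
        using 3 hd[of l] that by (simp add: cval_def ld)
      moreover have "cval g vs = 0" using 1 3 vs by (auto simp: cval_def ajs)
      moreover have "cval g (butlast vs) = 0" using 1 3 vs len by (auto simp: cval_def ajs)
      ultimately show ?thesis using nz[of 1] 3 by simp
    next
      case 2
      have nz: "vs ! j \<noteq> 0" if "1 \<le> j" "j \<le> k" for j
        using sorted_wrt_nth_less[OF 2(2), of 0 j] that vs by auto
      have h: "cval g (del (Suc l) vs) = g (del l js)" if "l < k" for l
        using 2 3 that ld[OF that] sorted_wrt_del[OF 2(2), of "Suc l"]
        by (auto simp: cval_def ajs del_Cons)
      have "m1 (1 - int k) (cval g vs) = (\<Sum>l<k. sg (int l + 1) (g (del l js)))"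
        using cl[of js] 2 3 len by (auto simp: closed_at_def cval_def ajs)
      also have "\<dots> = (\<Sum>l<k. sg (int l + 1) (cval g (del (Suc l) vs)))" by (simp add: h)
      also have "{..<k} = insert (k - 1) {..<k - 1}" using 3 by auto
      finally have e: "m1 (1 - int k) (cval g vs) =
        sg (int k) (cval g (butlast vs)) + (\<Sum>l<k - 1. sg (int l + 1) (cval g (del (Suc l) vs)))"
        using 3 del_last[of vs] vs(3) by (cases "vs = []") (auto simp: of_nat_diff)
      show ?thesis unfolding e using 3 nz[of 1] nz[of "k - 1"] by (simp add: sg_def)
    next
      case 3
      then obtain m where m: "Suc m < length vs" "vs ! m = vs ! Suc m"
        using not_strict_repeat vs(1) by blast
      have h0: "cval g vs = 0" using 3 \<open>k \<ge> 3\<close> vs by (simp add: cval_def)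
      have hd0: "cval g (del (Suc l) vs) = 0" if "l < k" "Suc l \<noteq> r" "l \<noteq> r"
        "Suc r < length vs" "vs ! r = vs ! Suc r" for l r
        using del_not_strict[of vs r "Suc l"] that ld[OF that(1)] \<open>k \<ge> 3\<close> vs by (auto simp: cval_def)
      have bl: "cval g (butlast vs) = 0" if "Suc r < k" "vs ! r = vs ! Suc r" for r
        using that cval_degenerate[of r "butlast vs"] \<open>k \<ge> 3\<close> vs by (simp add: nth_butlast)
      show ?thesis
      \<comment> \<open>If the chain starts with 0, 0, only the deletion at position 1 survives; it
        equals the tail and cancels the product with the unit in front.\<close>
      proof (cases "vs ! 1 = 0")
        case True
        then have v01: "vs ! 0 = vs ! Suc 0" using 3 by (simp add: ajs)
        have "(\<Sum>l<k - 1. sg (int l + 1) (cval g (del (Suc l) vs))) =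
          (\<Sum>l<k - 1. if l = 0 then - cval g (tl vs) else 0)"
        proof (rule sum.cong[OF refl])
          fix l assume l: "l \<in> {..<k - 1}"
          show "sg (int l + 1) (cval g (del (Suc l) vs)) = (if l = 0 then - cval g (tl vs) else 0)"
          proof (cases "l = 0")
            case True
            have "del (Suc 0) vs = del 0 vs" by (rule del_nth_eq[OF v01]) (use vs in simp)
            then have "del (Suc 0) vs = tl vs" by (simp add: ajs del_Cons)
            then show ?thesis using True by (simp add: sg_def)
          next
            case False
            then show ?thesis using hd0[of l 0] l v01 vs by auto
          qed
        qed
        also have "\<dots> = - cval g (tl vs)" using \<open>k \<ge> 3\<close> by simp
        finally show ?thesis using h0 bl[of 0] v01 True \<open>k \<ge> 3\<close> by simp
      next
        case False
        have m0: "m \<noteq> 0"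
        proof
          assume "m = 0"
          then show False using m(2) False 3(1) by (simp add: ajs)
        qed
        have mltk: "m < k" using m vs by simp
        have "vs ! 1 \<le> vs ! (k - 1)" by (rule mono) (use \<open>k \<ge> 3\<close> in linarith)+
        then have nz: "vs ! (k - 1) \<noteq> 0" using False by linarith
        have de: "del (Suc m) vs = del m vs" using del_nth_eq m by blast
        obtain m' where m': "m = Suc m'" using m0 by (cases m) auto
        let ?f = "\<lambda>l. sg (int l + 1) (cval g (del (Suc l) vs))"
        have z: "?f l = 0" if "l < k" "l \<noteq> m'" "l \<noteq> m" for l
          using hd0[of l m] that m m' by auto
        show ?thesis
        \<comment> \<open>A repetition at the end leaves one inner deletion, which matches the
          product with the unit on the last arrow. A repetition further inside leaves two equal
          deletions with opposite signs.\<close>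
        proof (cases "m = k - 1")
          case True
          have "(\<Sum>l<k - 1. ?f l) = (\<Sum>l<k - 1. if l = m' then ?f m' else 0)"
            by (rule sum.cong) (use z True m' mltk in \<open>auto\<close>)
          also have "\<dots> = ?f m'" using m' True \<open>k \<ge> 3\<close> by auto
          also have "\<dots> = sg (int k - 1) (cval g (butlast vs))"
          proof -
            have "vs \<noteq> []" "Suc m = length vs - 1" using vs(3) True \<open>k \<ge> 3\<close> by auto
            then have "del (Suc m') vs = butlast vs" using de del_last[of vs] m' by simp
            moreover have "int m' + 1 = int k - 1" using True m' \<open>k \<ge> 3\<close> by linarith
            ultimately show ?thesis by (simp only:)
          qed
          finally show ?thesis using h0 nz False \<open>k \<ge> 3\<close> by simp
        next
          case False
          then have mlt: "m < k - 1" using mltk by simp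
          have "(\<Sum>l<k - 1. ?f l) = (\<Sum>l<k - 1. (if l = m' then ?f m' else 0) + (if l = m then ?f m else 0))"
            by (rule sum.cong) (use z m' mltk in \<open>auto\<close>)
          also have "\<dots> = ?f m' + ?f m" using m' mlt by (simp add: sum.distrib)
          also have "\<dots> = 0" using de m' by (simp add: sg_def)
          finally show ?thesis using h0 nz \<open>vs ! 1 \<noteq> 0\<close> bl[of m] m mlt by simp
        qed
      qed
    qed
  qed
qed

end

section \<open>The functor equation for the data of a simplex\<close>

lemma prodv_merge: "prodv (p @ b_arr (dgs N) q # t) =
    (if length q = 2 then sg (susp q) (prodv (p @ q @ t)) else 0)"
  by (auto simp: b_arr_def b_op_def dgs_ops sg_def algebra_simps)

lemma sdeg_deg0: "\<forall>a\<in>set as. deg a = 0 \<Longrightarrow> sdeg as = - int (length as)"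
  by (induction as) auto

lemma map_eq_ConsD2: "length qs \<ge> 3 \<Longrightarrow> \<exists>a b c r. qs = a # b # c # r"
  by (auto simp: Suc_le_length_iff numeral_3_eq_3)

lemma string_decompose: "string A x (p @ q @ t) y \<Longrightarrow> q \<noteq> [] \<Longrightarrow> string A (src (hd q)) q (tgt (last q))"
  by (auto simp: string_append dest: string_src_hd string_tgt_last)

lemma string_junction: "string A x (p @ q) y \<Longrightarrow> p \<noteq> [] \<Longrightarrow> q \<noteq> [] \<Longrightarrow> src (hd q) = tgt (last p)"
  by (auto simp: string_append dest: string_src_hd string_tgt_last)

lemma verts_butlast: "2 \<le> length as \<Longrightarrow> verts (butlast as) = butlast (verts as)"
  by (cases as) (auto simp: map_butlast hd_append)

lemma verts_tl: "string A x as y \<Longrightarrow> 2 \<le> length as \<Longrightarrow> verts (tl as) = tl (verts as)"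
  by (cases as; cases "tl as") auto

context endo_complex
begin

lemma F_op_simplex_if: "F_op (simplex n g) as = (if as \<noteq> [] \<and> (\<exists>i j. string (dgs (Suc n) :: (nat, 'k, 'k) ainf) i as j)
       then scl B (prodv as) (cval g (verts as)) else 0)" by (auto simp: F_op_def simplex_def)

lemma F_op_simplex: "string (dgs (Suc n)) i as j \<Longrightarrow> as \<noteq> [] \<Longrightarrow>
    F_op (simplex n g) as = scl B (prodv as) (cval g (verts as))" by (auto simp: F_op_simplex_if)

lemma F_op_simplex_0: "prodv as = 0 \<Longrightarrow> F_op (simplex n g) as = 0"
  by (simp add: F_op_simplex_if)

text \<open>Only \<open>m\<^sub>2\<close> is nonzero in the source, so the terms are merges of
  neighbours; merging the arrows at \<open>l\<close> and \<open>l + 1\<close> removes the vertex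
  between them.\<close>

lemma simplex_lhs:
  assumes s: "string (dgs (Suc n)) i as j" and ne: "as \<noteq> []"
  shows "(\<Sum>(p, q, t)\<in>splits as. sg (sdeg p) (F_op (simplex n g) (p @ b_arr (dgs (Suc n)) q # t))) =
    scl B (prodv as) (\<Sum>l<length as - 1. sg (int l + 1) (cval g (del (Suc l) (verts as))))"
proof (cases "prodv as = 0")
  case True
  then have "prodv (p @ b_arr (dgs (Suc n)) q # t) = 0" if "(p, q, t) \<in> splits as" for p q t
    using that unfolding prodv_merge by (auto simp: splits_def)
  then show ?thesis unfolding True by (auto intro!: sum.neutral simp: F_op_simplex_0)
next
  case False
  then have d0: "\<forall>a\<in>set as. deg a = 0" and so: "sorted (i # map tgt as)"
    using string_dgs_nz[OF s] by auto
  have z: "sg (sdeg p) (F_op (simplex n g) (p @ b_arr (dgs (Suc n)) q # t)) = 0" if "length q \<noteq> 2" for p q t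
    using that F_op_simplex_0[of "p @ b_arr (dgs (Suc n)) q # t" n g] unfolding prodv_merge by simp
  have "(\<Sum>(p, q, t)\<in>splits as. sg (sdeg p) (F_op (simplex n g) (p @ b_arr (dgs (Suc n)) q # t))) =
    (\<Sum>l<length as - 1. sg (sdeg (take l as)) (F_op (simplex n g)
      (take l as @ b_arr (dgs (Suc n)) [as ! l, as ! Suc l] # drop (Suc (Suc l)) as)))"
    by (rule sum_splits_adjacent) (rule z)
  also have "\<dots> = (\<Sum>l<length as - 1. scl B (prodv as) (sg (int l + 1) (cval g (del (Suc l) (verts as)))))"
  proof (rule sum.cong[OF refl])
    fix l assume "l \<in> {..<length as - 1}"
    then have l: "Suc l < length as" by auto
    let ?a = "as ! l" and ?b = "as ! Suc l"
    have as: "as = take l as @ ?a # ?b # drop (Suc (Suc l)) as"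
      using l by (simp add: Cons_nth_drop_Suc)
    have dab: "deg ?a = 0" "deg ?b = 0" using d0 l by auto
    \<comment> \<open>Desuspending two arrows of degree 0 costs one sign. With the factor (-1)^l for
      passing the first \<open>l\<close> arrows this gives the exponent
      \<open>int l + 1\<close>.\<close>
    have c: "b_arr (dgs (Suc n)) [?a, ?b] = Arr (src ?a) (tgt ?b) 0 (- (val ?a * val ?b))"
      using dab by (simp add: b_arr_def b_op_def dgs_ops sg_def)
    let ?m = "take l as @ Arr (src ?a) (tgt ?b) 0 (- (val ?a * val ?b)) # drop (Suc (Suc l)) as"
    have "string (dgs (Suc n)) i (take l as @ ?a # ?b # drop (Suc (Suc l)) as) j" using s as by simp
    moreover have "val ?a \<noteq> 0" "val ?b \<noteq> 0"
      using False l by (auto simp: prod_list_zero_iff image_iff)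
    ultimately have sm: "string (dgs (Suc n)) i ?m j"
      unfolding string_append by (auto split: if_splits)
    have "prodv ?m = - prodv as" by (subst as) (simp add: algebra_simps)
    moreover have "sdeg (take l as) = - int l"
      using sdeg_deg0[of "take l as"] d0 l by (auto dest: in_set_takeD)
    ultimately show "sg (sdeg (take l as)) (F_op (simplex n g)
        (take l as @ b_arr (dgs (Suc n)) [?a, ?b] # drop (Suc (Suc l)) as)) =
      scl B (prodv as) (sg (int l + 1) (cval g (del (Suc l) (verts as))))"
      unfolding c using F_op_simplex[OF sm, of g] verts_merge[OF l] by (simp add: sg_def)
  qed
  finally show ?thesis by (simp add: scale_sum_right)
qed

lemma F_arr_simplex_loop:
  assumes g: "graded_cochain n g" and q: "string (dgs (Suc n)) i q j" "q \<noteq> []"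
  shows "loops [F_arr (simplex n g) q]"
proof -
  have "i \<le> Suc n" "j \<le> Suc n" using string_obj q by fastforce+
  moreover have "src (hd q) = i" "tgt (last q) = j"
    using q string_src_hd string_tgt_last by fastforce+
  moreover have "F_op (simplex n g) q \<in> endo (sdeg q + 1)"
  proof (cases "prodv q = 0")
    case False
    then have "cval g (verts q) \<in> endo (2 - int (length (verts q)))"
      using string_dgs_nz[OF q(1)] \<open>src (hd q) = i\<close> q(2) g
      by (intro cval_in) (auto simp: Suc_le_eq)
    then show ?thesis
      using string_dgs_nz[OF q(1) False] by (auto simp: F_op_simplex[OF q] sdeg_deg0 endo_scale)
  qed (simp add: F_op_simplex_0)
  ultimately show ?thesis by (simp add: loops_def F_arr_def simplex_def)
qed

text \<open>A sorted chain with nonzero head lies in the constant face, and one with last vertex 0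
  stays at 0. In both cases \<open>g\<close> does not enter.\<close>

lemma cval_unitlike:
  assumes "sorted vs" "2 \<le> length vs" "hd vs \<noteq> 0 \<or> last vs = 0"
  shows "cval g vs = (if length vs = 2 then idm else 0)"
proof -
  have "\<not> sorted_wrt (<) vs" if "last vs = 0"
  proof
    assume *: "sorted_wrt (<) vs"
    have "vs ! 0 < vs ! (length vs - 1)" by (rule sorted_wrt_nth_less[OF *]) (use assms(2) in auto)
    moreover have "vs \<noteq> []" using assms(2) by auto
    ultimately show False using that by (simp add: last_conv_nth)
  qed
  moreover have "last vs = vs ! 1" if "length vs = 2" using that by (cases vs; cases "tl vs") auto
  ultimately show ?thesis using assms by (auto simp: cval_def)
qed

lemma F_arr_simplex_unitlike:
  assumes q: "string (dgs (Suc n)) i q j" "q \<noteq> []" and u: "i \<noteq> 0 \<or> j = 0" and nz: "prodv q \<noteq> 0"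
  shows "F_arr (simplex n g) q = (if length q = 1 then Arr x x 0 (scl B (prodv q) idm)
    else Arr x x (sdeg q + 1) 0)"
proof -
  have *: "i \<le> Suc n" "j \<le> Suc n" using string_obj q by fastforce+
  have ij: "src (hd q) = i" "tgt (last q) = j" using q string_src_hd string_tgt_last by fastforce+
  have "cval g (verts q) = (if length (verts q) = 2 then idm else 0)"
    using string_dgs_nz[OF q(1) nz] ij q(2) u
    by (intro cval_unitlike) (auto simp: Suc_le_eq last_map)
  moreover have "sdeg q + 1 = 0" if "length q = 1"
    using string_dgs_nz[OF q(1) nz] that by (simp add: sdeg_deg0)
  ultimately show ?thesis using F_op_simplex[OF q, of g] * ij by (auto simp: F_arr_def simplex_def)
qed

text \<open>Of all ways to cut the chain into blocks only three survive: the whole chain, the cut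
  before the last arrow, and the cut after the first arrow. The last two need the single arrow to
  carry a multiple of the unit.\<close>

lemma simplex_rhs:
  assumes g: "graded_cochain n g" and s: "string (dgs (Suc n)) i as j" and ne: "as \<noteq> []"
  defines "k \<equiv> length as" and "vs \<equiv> verts as"
  shows "(\<Sum>qs\<in>{qs. concat qs = as \<and> [] \<notin> set qs}. b_op B (map (F_arr (simplex n g)) qs)) =
    scl B (prodv as) (m1 (1 - int k) (cval g vs)
      + (if 2 \<le> k \<and> vs ! (k - 1) \<noteq> 0 then sg (int k - 1) (cval g (butlast vs)) else 0)
      - (if 2 \<le> k \<and> vs ! 1 = 0 then cval g (tl vs) else 0))"
proof -
  let ?P = "{qs. concat qs = as \<and> [] \<notin> set qs}"
  let ?F = "F_arr (simplex n g)"
  have blk: "string (dgs (Suc n)) (src (hd q)) q (tgt (last q)) \<and> q \<noteq> [] \<and> (prodv as \<noteq> 0 \<longrightarrow> prodv q \<noteq> 0)"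
    if "qs \<in> ?P" "q \<in> set qs" for qs q
  proof -
    from that(2) obtain ps ts where qs: "qs = ps @ q # ts" by (meson split_list)
    then have "as = concat ps @ q @ concat ts" using that by auto
    then show ?thesis using s that qs by (auto intro: string_decompose)
  qed
  have lp: "loops (map ?F qs)" if "qs \<in> ?P" for qs
    using blk[OF that] F_arr_simplex_loop[OF g] by (auto simp: loops_def)
  show ?thesis
  proof (cases "prodv as = 0")
    case True
    have "b_op B (map ?F qs) = 0" if qs: "qs \<in> ?P" for qs
    proof -
      have "prod_list (map prodv qs) = prodv (concat qs)" by (induction qs) auto
      with True qs obtain q where q: "q \<in> set qs" "prodv q = 0"
        by (auto simp: prod_list_zero_iff)
      then have "ops B (map ?F qs) = 0"
        by (intro ops_val_0[OF lp[OF qs], of "?F q"]) (auto simp: F_arr_def F_op_simplex_0)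
      then show ?thesis by (simp add: b_op_def)
    qed
    then show ?thesis using True by simp
  next
    case nz: False
    have vs: "sorted vs" "set vs \<subseteq> {..Suc n}" "length vs = Suc k"
      using string_dgs_nz[OF s nz] string_src_hd[OF s ne] by (auto simp: vs_def k_def)
    have d0: "\<forall>a\<in>set as. deg a = 0" using string_dgs_nz[OF s nz] by simp
    have k: "1 \<le> k" using ne by (simp add: k_def Suc_le_eq)
    let ?c = "prodv as"
    \<comment> \<open>One of the first two blocks carries either a multiple of the unit, which kills
      \<open>m\<^sub>k\<close> for \<open>k \<ge> 3\<close>, or the value 0.\<close>
    have big: "b_op B (map ?F qs) = 0" if qs: "qs \<in> ?P" "3 \<le> length qs" for qs
    proof -
      obtain a b c r where abc: "qs = a # b # c # r" using map_eq_ConsD2 qs(2) by blast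
      have ba: "string (dgs (Suc n)) (src (hd a)) a (tgt (last a))" "a \<noteq> []" "prodv a \<noteq> 0"
        and bb: "string (dgs (Suc n)) (src (hd b)) b (tgt (last b))" "b \<noteq> []" "prodv b \<noteq> 0"
        using blk[OF qs(1), of a] blk[OF qs(1), of b] nz abc by auto
      have "string (dgs (Suc n)) i (a @ b @ c @ concat r) j" using s qs(1) abc by auto
      then have "src (hd b) = tgt (last a)"
        using string_junction[of _ i a "b @ c @ concat r" j] ba bb by (simp add: hd_append)
      \<comment> \<open>The shared vertex is 0, so that the first block ends there, or it is not,
        and then the second block starts away from 0.\<close>
      then have "\<exists>q\<in>{a, b}. src (hd q) \<noteq> 0 \<or> tgt (last q) = 0" by auto
      then obtain q where q: "q \<in> set qs" "?F q = (if length q = 1 then Arr x x 0 (scl B (prodv q) idm)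
          else Arr x x (sdeg q + 1) 0)"
        using F_arr_simplex_unitlike[OF ba(1,2) _ ba(3)] F_arr_simplex_unitlike[OF bb(1,2) _ bb(3)] abc
        by auto
      have "ops B (map ?F qs) = 0"
      proof (cases "length q = 1")
        case True
        then show ?thesis
          using q qs(2) by (intro ops_scaled_unit[OF lp[OF qs(1)], of "prodv q"]) force+
      next
        case False
        then show ?thesis
          using ops_val_0[OF lp[OF qs(1)], of "?F q"] q imageI[OF q(1), of ?F] by simp
      qed
      then show ?thesis by (simp add: b_op_def)
    qed
    have val: "?F as = Arr x x (1 - int k) (scl B ?c (cval g vs))"
      using lp[of "[as]"] ne F_op_simplex[OF s ne, of g] d0
      by (auto simp: loops_def F_arr_def vs_def k_def sdeg_deg0)
    have hin: "cval g vs \<in> endo (1 - int k)" using cval_in[OF g vs(1,2)] vs(3) k by simp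
    have one: "b_op B (map ?F [as]) = scl B ?c (m1 (1 - int k) (cval g vs))"
      using hin by (simp add: b_op_def val m1_scale flip: m1_def)
    let ?h = "\<lambda>l. [take l as, drop l as]"
    \<comment> \<open>\<open>?R\<close> is the cut with a unit on the right, \<open>?L\<close> the
      one with a unit on the left. For \<open>k = 2\<close> both sit at the same cut, and whether
      the middle vertex is 0 separates them.\<close>
    let ?R = "\<lambda>l. if l = k - 1 \<and> vs ! (k - 1) \<noteq> 0 then sg (int k - 1) (cval g (butlast vs)) else 0"
    let ?L = "\<lambda>l. if l = 1 \<and> vs ! 1 = 0 then cval g (tl vs) else 0"
    have two: "b_op B (map ?F (?h l)) = scl B ?c (?R l - ?L l)" if l: "l \<in> {1..<k}" for l
    proof -
      let ?p = "take l as" and ?q = "drop l as"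
      have P: "?h l \<in> ?P" using l by (auto simp: k_def)
      have bp: "string (dgs (Suc n)) (src (hd ?p)) ?p (tgt (last ?p))" "?p \<noteq> []" "prodv ?p \<noteq> 0"
        and bq: "string (dgs (Suc n)) (src (hd ?q)) ?q (tgt (last ?q))" "?q \<noteq> []" "prodv ?q \<noteq> 0"
        using blk[OF P, of ?p] blk[OF P, of ?q] nz by auto
      have pq: "prodv ?p * prodv ?q = ?c" by (metis append_take_drop_id map_append prod_list.append)
      have lp2: "loops [?F ?p, ?F ?q]" using lp[OF P] by simp
      have k2: "2 \<le> k" using l by simp
      have mid: "vs ! l = tgt (last ?p)"
        using l k2 bp(2) by (cases l) (auto simp: vs_def last_conv_nth k_def)
      have mid': "src (hd ?q) = tgt (last ?p)" using string_junction[of _ i ?p ?q j] s bp bq by simp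
      have sp: "sdeg ?p = - int l"
        using sdeg_deg0[of ?p] d0 l by (auto simp: k_def dest: in_set_takeD)
      have sq: "sdeg ?q = int l - int k"
        using sdeg_deg0[of ?q] d0 l by (auto simp: k_def dest: in_set_dropD)
      have Fp: "?F ?p = Arr x x (1 - int l) (F_op (simplex n g) ?p)" "F_op (simplex n g) ?p \<in> endo (1 - int l)"
        using lp2 sp by (auto simp: loops_def F_arr_def)
      have Fq: "?F ?q = Arr x x (1 + int l - int k) (F_op (simplex n g) ?q)"
        "F_op (simplex n g) ?q \<in> endo (1 + int l - int k)"
        using lp2 sq by (auto simp: loops_def F_arr_def algebra_simps)
      \<comment> \<open>The first factor has shifted degree \<open>- l\<close>; moving the second
        desuspension past it gives this sign, which is -1 for the cut after the first arrow.\<close>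
      have b: "b_op B (map ?F (?h l)) = sg (int l) (ops B [?F ?p, ?F ?q])"
        by (simp add: b_op_def Fp(1) sg_def)
      show ?thesis
      proof (cases "vs ! l = 0")
        case True
        have Fpu: "?F ?p = (if length ?p = 1 then Arr x x 0 (scl B (prodv ?p) idm)
            else Arr x x (sdeg ?p + 1) 0)"
          using F_arr_simplex_unitlike[OF bp(1,2) _ bp(3)] mid True by simp
        have nR: "?R l = 0" using True by auto
        show ?thesis
        proof (cases "l = 1")
          case l1: True
          have "length ?p = 1" using l l1 by (simp add: k_def)
          then have "ops B [?F ?p, ?F ?q] = scl B (prodv ?p) (F_op (simplex n g) ?q)"
            using Fpu Fq by (simp add: ops_scaled_unit_left)
          also have "\<dots> = scl B ?c (cval g (tl vs))"
            using F_op_simplex[OF bq(1,2), of g] pq verts_tl[OF s] k2 l1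
            by (simp add: vs_def k_def drop_Suc)
          finally show ?thesis using b l1 nR True by (simp add: sg_def)
        next
          case False
          then have "length ?p \<noteq> 1" using l by (simp add: k_def)
          then have "ops B [?F ?p, ?F ?q] = 0" using ops_val_0[OF lp2, of "?F ?p"] Fpu by simp
          then show ?thesis using b False nR by simp
        qed
      next
        case False
        have Fqu: "?F ?q = (if length ?q = 1 then Arr x x 0 (scl B (prodv ?q) idm)
            else Arr x x (sdeg ?q + 1) 0)"
          using F_arr_simplex_unitlike[OF bq(1,2) _ bq(3)] mid mid' False by simp
        have nL: "?L l = 0" using False by auto
        show ?thesis
        proof (cases "l = k - 1")
          case l1: True
          have "length ?q = 1" using l l1 by (simp add: k_def)
          then have "ops B [?F ?p, ?F ?q] = scl B (prodv ?q) (F_op (simplex n g) ?p)"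
            using Fqu Fp by (simp add: ops_scaled_unit_right)
          also have "\<dots> = scl B ?c (cval g (butlast vs))"
            using F_op_simplex[OF bp(1,2), of g] pq verts_butlast[of as] k2 l1
            by (simp add: vs_def k_def mult.commute butlast_conv_take)
          finally show ?thesis using b l1 nL False k2 by (simp add: scale_sg of_nat_diff)
        next
          case False
          then have "length ?q \<noteq> 1" using l by (simp add: k_def)
          then have "ops B [?F ?p, ?F ?q] = 0" using ops_val_0[OF lp2, of "?F ?q"] Fqu by simp
          then show ?thesis using b False nL by simp
        qed
      qed
    qed
    have "(\<Sum>qs\<in>?P. b_op B (map ?F qs)) = (\<Sum>qs\<in>insert [as] (?h ` {1..<k}). b_op B (map ?F qs))"
    proof (rule sum.mono_neutral_right[OF finite_parts])
      show "insert [as] (?h ` {1..<k}) \<subseteq> ?P" using ne by (auto simp: k_def)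
      show "\<forall>qs\<in>?P - insert [as] (?h ` {1..<k}). b_op B (map ?F qs) = 0"
      proof
        fix qs assume qs: "qs \<in> ?P - insert [as] (?h ` {1..<k})"
        have "qs \<noteq> []" "\<nexists>a. qs = [a]" using qs ne by auto
        moreover have "\<nexists>a b. qs = [a, b]"
        proof clarify
          fix a b assume ab: "qs = [a, b]"
          then have "qs = ?h (length a)" "length a \<in> {1..<k}" using qs by (auto simp: k_def Suc_le_eq)
          with qs show False by blast
        qed
        ultimately have "3 \<le> length qs" by (cases qs; cases "tl qs"; cases "tl (tl qs)") auto
        then show "b_op B (map ?F qs) = 0" using big qs by blast
      qed
    qed
    also have "\<dots> = b_op B (map ?F [as]) + (\<Sum>qs\<in>?h ` {1..<k}. b_op B (map ?F qs))"
      by (rule sum.insert) auto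
    also have "(\<Sum>qs\<in>?h ` {1..<k}. b_op B (map ?F qs)) = (\<Sum>l\<in>{1..<k}. scl B ?c (?R l - ?L l))"
    proof (subst sum.reindex)
      show "inj_on ?h {1..<k}"
        by (rule inj_onI) (metis (lifting) atLeastLessThan_iff k_def length_take list.inject min.absorb4)
      show "(\<Sum>l\<in>{1..<k}. ((\<lambda>qs. b_op B (map ?F qs)) \<circ> ?h) l) = (\<Sum>l\<in>{1..<k}. scl B ?c (?R l - ?L l))"
        using two by (intro sum.cong) auto
    qed
    also have "\<dots> = scl B ?c ((\<Sum>l\<in>{1..<k}. ?R l) - (\<Sum>l\<in>{1..<k}. ?L l))"
      by (simp only: sum_subtractf flip: scale_sum_right)
    also have "(\<Sum>l\<in>{1..<k}. ?R l) =
        (\<Sum>l\<in>{1..<k}. if l = k - 1 then if vs ! (k - 1) \<noteq> 0 then sg (int k - 1) (cval g (butlast vs)) else 0 else 0)"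
      by (rule sum.cong) auto
    also have "\<dots> = (if 2 \<le> k \<and> vs ! (k - 1) \<noteq> 0 then sg (int k - 1) (cval g (butlast vs)) else 0)"
      by auto
    also have "(\<Sum>l\<in>{1..<k}. ?L l) = (\<Sum>l\<in>{1..<k}. if l = 1 then if vs ! 1 = 0 then cval g (tl vs) else 0 else 0)"
      by (rule sum.cong) auto
    also have "\<dots> = (if 2 \<le> k \<and> vs ! 1 = 0 then cval g (tl vs) else 0)" by auto
    finally show ?thesis unfolding one by (simp add: scale_right_distrib scale_right_diff_distrib)
  qed
qed

end

section \<open>Simplices as functors, their faces and the constant simplices\<close>

lemma prodv_replicate_path [simp]: "prodv (path i js :: (nat, 'k::field) arr list) = 1"
  by (simp add: prod_list_replicate)

lemma path_unit_arr:
  assumes "Suc m < length (i # js)" "(i # js) ! m = (i # js) ! Suc m"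
  shows "\<exists>z. unit_arr (dgs N) z \<in> set (path i js :: (nat, 'k::field) arr list)"
  using assms
proof (induction js arbitrary: i m)
  case (Cons j js)
  show ?case
  proof (cases m)
    case 0
    with Cons.prems show ?thesis by (auto simp: unit_arr_def)
  next
    case (Suc m')
    with Cons.prems have "\<exists>z. unit_arr (dgs N) z \<in> set (path j js :: (nat, 'k) arr list)"
      by (intro Cons.IH[of m']) auto
    then show ?thesis by auto
  qed
qed auto

lemma strictly_increasing_interval:
  assumes "sorted_wrt (<) js" "set js \<subseteq> {1..N}" "length js = N"
  shows "js = [1..<Suc N]"
proof -
  have "card (set js) = N" using assms by (simp add: strict_sorted_iff distinct_card)
  then have "set js = {1..N}" using assms by (intro card_subset_eq) auto
  moreover have "set [1..<Suc N] = {1..N}" by auto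
  ultimately show ?thesis using assms(1) by (intro strict_sorted_equal) (simp_all del: upt_Suc)
qed

context endo_complex
begin

abbreviation nrv :: "(nat, 'k, 'p, 'w) afun sset" where "nrv \<equiv> nerve B"
abbreviation vtx :: "(nat, 'k, 'p, 'w) afun" where "vtx \<equiv> nerve_vertex B x"
abbreviation mapsp :: "(nat, 'k, 'p, 'w) afun sset" where "mapsp \<equiv> left_mapping_space nrv vtx vtx"

lemma fob_simplex: "fob (simplex n g) = (\<lambda>i\<in>{..Suc n}. x)"
  by (simp add: simplex_def)

lemma fcomp_simplex: "string (dgs (Suc n)) i as j \<Longrightarrow> as \<noteq> [] \<Longrightarrow>
    fcomp (simplex n g) as = sg (susp as) (scl B (prodv as) (cval g (verts as)))"
  by (auto simp: simplex_def)

lemma fcomp_simplex_0: "prodv as = 0 \<Longrightarrow> fcomp (simplex n g) as = 0"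
  by (simp add: simplex_def)

text \<open>Sign and vertices do not depend on the value in the slot, so linearity in the slot
  reduces to linearity of a product of scalars. The value 0 on the right is a placeholder.\<close>

lemma fcomp_simplex_slot:
  assumes "string (dgs (Suc n)) i (as @ Arr z w d y # bs) j"
  shows "fcomp (simplex n g) (as @ Arr z w d y # bs) = sg (susp (as @ Arr z w d 0 # bs))
    (scl B (y * (prodv as * prodv bs)) (cval g (verts (as @ Arr z w d 0 # bs))))"
proof -
  have "susp (as @ Arr z w d y # bs) = susp (as @ Arr z w d 0 # bs)" by (rule susp_cong) simp
  moreover have "verts (as @ Arr z w d y # bs) = verts (as @ Arr z w d 0 # bs)" by (cases as) auto
  moreover have "prodv (as @ Arr z w d y # bs) = y * (prodv as * prodv bs)"
    by (simp add: mult.left_commute)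
  ultimately show ?thesis using fcomp_simplex[OF assms, of g] by (simp only:) simp
qed

lemma simplex_functor:
  assumes g: "chain_map n g"
  shows "ainf_functor (dgs (Suc n)) B (simplex n g)"
proof -
  have gg: "graded_cochain n g" using g by (simp add: chain_map_def)
  have gm: "graded_multilinear (dgs (Suc n)) B (fob (simplex n g)) (fob (simplex n g)) 1 1 (\<lambda>_. fcomp (simplex n g))"
    unfolding graded_multilinear_def
  proof (intro conjI allI impI; elim conjE)
    fix i as j assume s: "string (dgs (Suc n) :: (nat, 'k, 'k) ainf) i as j" and "1 \<le> length as"
    then have ne: "as \<noteq> []" by auto
    have "loops [F_arr (simplex n g) as]" using F_arr_simplex_loop[OF gg s ne] .
    then have "F_op (simplex n g) as \<in> endo (sdeg as + 1)" by (simp add: loops_def F_arr_def)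
    then have "fcomp (simplex n g) as \<in> endo (sdeg as + 1)"
      using endo_sg[of _ _ "susp as"] by (fastforce simp: F_op_def)
    moreover have "i \<le> Suc n" "j \<le> Suc n" using string_obj s by fastforce+
    ultimately show "fcomp (simplex n g) as \<in> Hom B (fob (simplex n g) i) (fob (simplex n g) j)
        ((\<Sum>a\<leftarrow>as. deg a) + 1 - int (length as))"
      by (simp add: fob_simplex sdeg_eq algebra_simps)
  next
    fix i as z w d and u v :: 'k and bs j
    assume s: "string (dgs (Suc n)) i (as @ Arr z w d u # bs) j" "string (dgs (Suc n)) i (as @ Arr z w d v # bs) j"
    then have s': "string (dgs (Suc n)) i (as @ Arr z w d (u + v) # bs) j"
      by (auto simp: string_append split: if_splits)
    show "fcomp (simplex n g) (as @ Arr z w d (u + v) # bs) =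
        fcomp (simplex n g) (as @ Arr z w d u # bs) + fcomp (simplex n g) (as @ Arr z w d v # bs)"
      using fcomp_simplex_slot[OF s(1), of g] fcomp_simplex_slot[OF s(2), of g] fcomp_simplex_slot[OF s', of g]
      by (simp add: ring_distribs scale_left_distrib sg_add)
  next
    fix i as z w d and u c :: 'k and bs j
    assume s: "string (dgs (Suc n)) i (as @ Arr z w d u # bs) j"
    then have s': "string (dgs (Suc n)) i (as @ Arr z w d (c * u) # bs) j"
      by (auto simp: string_append split: if_splits)
    show "fcomp (simplex n g) (as @ Arr z w d (scl (dgs (Suc n)) c u) # bs) =
        scl B c (fcomp (simplex n g) (as @ Arr z w d u # bs))"
      using fcomp_simplex_slot[OF s, of g] fcomp_simplex_slot[OF s', of g]
      by (simp add: scale_sg mult.assoc)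
  qed
  have eq: "(\<Sum>(p, q, t)\<in>splits as. sg (sdeg p) (F_op (simplex n g) (p @ b_arr (dgs (Suc n)) q # t)))
          = (\<Sum>qs\<in>{qs. concat qs = as \<and> [] \<notin> set qs}. b_op B (map (F_arr (simplex n g)) qs))"
    if s: "string (dgs (Suc n)) i as j" and ne: "as \<noteq> []" for i as j
  proof (cases "prodv as = 0")
    case False
    have "sorted (verts as)" "set (verts as) \<subseteq> {..Suc n}"
      using string_dgs_nz[OF s False] string_src_hd[OF s ne] by auto
    \<comment> \<open>Both sides have already been reduced to \<open>prodv as\<close> times an
      expression in \<open>cval g\<close>, and \<open>cval_identity\<close> compares these
      expressions.\<close>
    then show ?thesis unfolding simplex_lhs[OF s ne] simplex_rhs[OF gg s ne]
      by (subst cval_identity[OF g]) (use ne in \<open>auto simp: Suc_le_eq\<close>)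
  qed (simp add: simplex_lhs[OF s ne] simplex_rhs[OF gg s ne])
  have un: "fcomp (simplex n g) [unit_arr (dgs (Suc n)) i] = unt B (fob (simplex n g) i)"
    if "i \<in> Obj (dgs (Suc n) :: (nat, 'k, 'k) ainf)" for i
  proof -
    have "string (dgs (Suc n)) i [unit_arr (dgs (Suc n)) i :: (nat, 'k) arr] i"
      using that by (simp add: unit_arr_def)
    moreover have "cval g [i, i] = idm" by (auto simp: cval_def)
    ultimately show ?thesis using fcomp_simplex[of n i "[unit_arr (dgs (Suc n)) i]" i g] that
      by (simp add: unit_arr_def fob_simplex)
  qed
  have va: "fcomp (simplex n g) as = 0"
    if s: "string (dgs (Suc n)) i as j" and "2 \<le> length as" "unit_arr (dgs (Suc n)) z \<in> set as" for i as j z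
  proof -
    have ne: "as \<noteq> []" using that by auto
    have "\<not> sorted_wrt (<) (verts as)"
      using sort_wrt_verts_unit[OF s that(3)] string_src_hd[OF s ne] by simp
    then have "cval g (verts as) = 0" using that(2) unfolding cval_def by auto
    then show ?thesis using fcomp_simplex[OF s ne, of g] by simp
  qed
  have ob: "fob (simplex n g) \<in> Obj (dgs (Suc n) :: (nat, 'k, 'k) ainf) \<rightarrow>\<^sub>E Obj B"
    by (auto simp: fob_simplex obj)
  have no: "fcomp (simplex n g) as = 0"
    if "as = [] \<or> (\<nexists>i j. string (dgs (Suc n) :: (nat, 'k, 'k) ainf) i as j)" for as
    using that by (auto simp: simplex_def)
  show ?thesis unfolding ainf_functor_def by (intro conjI allI impI ballI; (elim conjE)?;
        (rule ob | (rule no; assumption) | rule gm | (rule eq; assumption) | (rule un; assumption)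
          | (rule va; assumption)))
qed

lemma act_nerve: "act nrv m n \<alpha> \<sigma> = AFun (\<lambda>i\<in>{..m}. fob \<sigma> (\<alpha> i))
       (\<lambda>as. if as \<noteq> [] \<and> (\<exists>i j. string (dgs m :: (nat, 'k, 'k) ainf) i as j)
              then fcomp \<sigma> (map (map_arr \<alpha> id) as) else 0)" by (simp add: nerve_def)

lemma fcomp_vtx: "fcomp vtx as = (case as of [a] \<Rightarrow>
    (if string (dgs 0 :: (nat, 'k, 'k) ainf) 0 [a] 0 then scl B (val a) idm else 0) | _ \<Rightarrow> 0)"
  by (simp add: nerve_vertex_def)

lemma fcomp_vtx_act:
  assumes "string (dgs m) i as j"
  shows "fcomp vtx (map (map_arr (\<lambda>_. 0) id) as) = (if length as = 1 then scl B (prodv as) idm else 0)"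
proof (cases as)
  case (Cons a bs)
  show ?thesis
  proof (cases bs)
    case Nil
    have "string (dgs 0 :: (nat, 'k, 'k) ainf) 0 [map_arr (\<lambda>_. 0) id a] 0"
      using assms by (auto simp: Cons Nil arr.map_sel split: if_splits)
    then show ?thesis by (simp add: Cons Nil fcomp_vtx arr.map_sel)
  qed (simp add: Cons fcomp_vtx)
qed (simp add: fcomp_vtx)

text \<open>\<open>cval\<close> asks only whether a chain is strict and where the vertex 0 occurs; a
  strictly increasing \<open>\<beta>\<close> with \<open>\<beta> 0 = 0\<close> preserves and
  reflects both.\<close>

lemma cval_map:
  assumes "strict_mono_on {..m} \<beta>" "\<beta> 0 = 0" "set vs \<subseteq> {..m}" "2 \<le> length vs"
  shows "cval g (map \<beta> vs) = cval (\<lambda>js. g (map \<beta> js)) vs"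
proof -
  have lt: "\<beta> i < \<beta> j \<longleftrightarrow> i < j" if "i \<le> m" "j \<le> m" for i j
    using assms(1) that by (meson atMost_iff strict_mono_on_less)
  then have z: "\<beta> i = 0 \<longleftrightarrow> i = 0" if "i \<le> m" for i
    using lt[of 0 i] that assms(2) by auto
  have s: "sorted_wrt (<) (map \<beta> vs) \<longleftrightarrow> sorted_wrt (<) vs"
    using assms(3) by (induction vs) (auto simp: lt subset_iff)
  obtain a b us where "vs = a # b # us" using assms(4) by (auto simp: Suc_le_length_iff numeral_2_eq_2)
  then show ?thesis using assms s z[of a] z[of b] by (auto simp: cval_def)
qed

text \<open>Faces of the mapping space act through strictly increasing maps fixing the source vertex
  0; under these the data \<open>g\<close> are simply pulled back.\<close>

lemma act_simplex:
  assumes \<beta>: "strict_mono_on {..Suc m} \<beta>" "\<beta> 0 = 0" "\<And>i. i \<le> Suc m \<Longrightarrow> \<beta> i \<le> Suc n"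
  shows "act nrv (Suc m) (Suc n) \<beta> (simplex n g) = simplex m (\<lambda>js. g (map \<beta> js))"
proof -
  have mono: "\<beta> i \<le> \<beta> j \<and> \<beta> j \<le> Suc n" if "i \<le> j" "j \<le> Suc m" for i j
    using that \<beta> by (auto simp: strict_mono_on_def le_less)
  have "fcomp (simplex n g) (map (map_arr \<beta> id) as) = sg (susp as) (scl B (prodv as) (cval (\<lambda>js. g (map \<beta> js)) (verts as)))"
    if s: "string (dgs (Suc m)) i as j" and ne: "as \<noteq> []" for i as j
  proof (cases "prodv as = 0")
    case True
    then show ?thesis using fcomp_simplex_0[of "map (map_arr \<beta> id) as"] by (simp only: map_val_map_arr) simp
  next
    case False
    have "set (verts as) \<subseteq> {..Suc m}"
      using string_dgs_nz[OF s False] string_src_hd[OF s ne] by auto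
    then have h: "cval g (map \<beta> (verts as)) = cval (\<lambda>js. g (map \<beta> js)) (verts as)"
      using ne by (intro cval_map[OF \<beta>(1,2)]) (auto simp: Suc_le_eq)
    have s': "string (dgs (Suc n)) (\<beta> i) (map (map_arr \<beta> id) as) (\<beta> j)"
      using mono by (intro string_map_arr[OF _ s]) auto
    show ?thesis using fcomp_simplex[OF s', of g] ne
      by (simp only: susp_map_arr map_val_map_arr verts_map_arr[OF ne] h) simp
  qed
  then have "(\<lambda>as. if as \<noteq> [] \<and> (\<exists>i j. string (dgs (Suc m) :: (nat, 'k, 'k) ainf) i as j)
       then fcomp (simplex n g) (map (map_arr \<beta> id) as) else 0) = fcomp (simplex m (\<lambda>js. g (map \<beta> js)))"
    unfolding simplex_def[of m] by (auto simp: fun_eq_iff)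
  moreover have "(\<lambda>i\<in>{..Suc m}. fob (simplex n g) (\<beta> i)) = fob (simplex m (\<lambda>js. g (map \<beta> js)))"
    using \<beta>(3) by (auto simp: fob_simplex fun_eq_iff)
  ultimately show ?thesis unfolding act_nerve by (intro afun.expand) simp
qed

lemma cval_cong:
  assumes "2 \<le> length vs" "hd vs = 0 \<Longrightarrow> sorted_wrt (<) vs \<Longrightarrow> g (tl vs) = g' (tl vs)"
  shows "cval g vs = cval g' vs"
proof -
  have "sorted_wrt (<) vs" if "length vs = 2" "hd vs = 0" "vs ! 1 \<noteq> 0"
    using that by (cases vs; cases "tl vs") auto
  then show ?thesis using assms(2) by (auto simp: cval_def)
qed

lemma simplex_cong:
  assumes "\<And>js. inner n js \<Longrightarrow> g js = g' js"
  shows "simplex n g = simplex n g'"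
proof -
  have "scl B (prodv as) (cval g (verts as)) = scl B (prodv as) (cval g' (verts as))"
    if s: "string (dgs (Suc n)) i as j" and ne: "as \<noteq> []" for i j as
  proof (cases "prodv as = 0")
    case False
    obtain b bs where as: "as = b # bs" using ne by (cases as) auto
    have *: "sorted (verts as)" "set (verts as) \<subseteq> {..Suc n}"
      using string_dgs_nz[OF s False] string_src_hd[OF s ne] by auto
    have "g (tl (verts as)) = g' (tl (verts as))" if "hd (verts as) = 0" "sorted_wrt (<) (verts as)"
      using that * as by (intro assms inner_tl) auto
    then have "cval g (verts as) = cval g' (verts as)"
      using ne by (intro cval_cong) (auto simp: Suc_le_eq)
    then show ?thesis by simp
  qed simp
  then show ?thesis by (auto simp: simplex_def fun_eq_iff)
qed

lemma inner_string_path: "inner n js \<Longrightarrow> string (dgs (Suc n)) 0 (path 0 js) (last js)"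
  by (auto simp: string_path inner_def strict_sorted_imp_sorted)

lemma cval_0_Cons: "inner n js \<Longrightarrow> cval g (0 # js) = g js"
  by (cases js; cases "tl js") (auto simp: cval_def inner_def)

lemma F_op_simplex_path: "inner n js \<Longrightarrow> F_op (simplex n g) (path 0 js) = g js"
  using F_op_simplex[OF inner_string_path, of n js g] cval_0_Cons[of n js g] by (simp add: inner_def)

lemma simplex_inject: "simplex n g = simplex n g' \<Longrightarrow> inner n js \<Longrightarrow> g js = g' js"
  using F_op_simplex_path by metis

text \<open>The data of the constant simplex at the identity: a vertex of the simplex stands for the
  edge from 0 to it, which carries the identity, and all higher faces carry 0. This is the origin of
  the translation in the Dold-Kan picture.\<close>

definition cfaces :: "nat list \<Rightarrow> 'w" where "cfaces js = (if length js = 1 then idm else 0)"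

lemma cval_cfaces: "2 \<le> length vs \<Longrightarrow> cval cfaces vs = (if length vs = 2 then idm else 0)"
  by (auto simp: cval_def cfaces_def)

lemma fcomp_simplex_cfaces:
  "string (dgs (Suc n)) i as j \<Longrightarrow> as \<noteq> [] \<Longrightarrow>
    fcomp (simplex n cfaces) as = (if length as = 1 then scl B (prodv as) idm else 0)"
  by (cases as) (auto simp: fcomp_simplex cval_cfaces Suc_le_eq)

lemma act_const:
  assumes "\<And>i. i \<le> m \<Longrightarrow> \<beta> i \<le> n"  "\<And>i j. i \<le> j \<Longrightarrow> j \<le> m \<Longrightarrow> \<beta> i \<le> \<beta> j"
  shows "act nrv m n \<beta> (act nrv n 0 (\<lambda>_. 0) vtx) = act nrv m 0 (\<lambda>_. 0) vtx"
proof -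
  have "fcomp (act nrv n 0 (\<lambda>_. 0) vtx) (map (map_arr \<beta> id) as) = fcomp vtx (map (map_arr (\<lambda>_. 0) id) as)"
    if "as \<noteq> [] \<and> (\<exists>i j. string (dgs m :: (nat, 'k, 'k) ainf) i as j)" for as
  proof -
    from that obtain i j where ne: "as \<noteq> []" and s: "string (dgs m :: (nat, 'k, 'k) ainf) i as j"
      by blast
    have "string (dgs n) (\<beta> i) (map (map_arr \<beta> id) as) (\<beta> j)"
      using assms by (intro string_map_arr[OF _ s]) auto
    then show ?thesis using ne unfolding act_nerve by (auto simp: arr.map_comp o_def id_def)
  qed
  note F = this
  have "fob (act nrv n 0 (\<lambda>_. 0) vtx) (\<beta> i) = fob vtx 0" if "i \<le> m" for i
    using assms that by (simp add: act_nerve)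
  then have "(\<lambda>i\<in>{..m}. fob (act nrv n 0 (\<lambda>_. 0) vtx) (\<beta> i)) = (\<lambda>i\<in>{..m}. fob vtx 0)"
    by (auto simp: restrict_def)
  then show ?thesis unfolding act_nerve[of m n] act_nerve[of m 0]
    by (simp only:) (intro arg_cong2[where f = AFun] refl ext if_cong F)
qed

text \<open>The only nonzero components of this degenerate simplex are those of length 1, where
  every basis arrow goes to the unit.\<close>

lemma const_nrv: "act nrv (Suc n) 0 (\<lambda>_. 0) vtx = simplex n cfaces"
proof -
  have "(\<lambda>as. if as \<noteq> [] \<and> (\<exists>i j. string (dgs (Suc n) :: (nat, 'k, 'k) ainf) i as j)
       then fcomp vtx (map (map_arr (\<lambda>_. 0) id) as) else 0) = fcomp (simplex n cfaces)"
    by (rule ext) (auto simp: fcomp_vtx_act fcomp_simplex_cfaces, auto simp: simplex_def)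
  moreover have "(\<lambda>i\<in>{..Suc n}. fob vtx 0) = fob (simplex n cfaces)"
    by (simp add: nerve_vertex_def fob_simplex)
  ultimately show ?thesis unfolding act_nerve by (intro afun.expand) simp
qed

end

section \<open>Every simplex of the mapping space comes from chain data\<close>

lemma sum_deg_path: "(\<Sum>a\<leftarrow>path i js. deg a) = 0"
  by (induction js arbitrary: i) auto

text \<open>Scalars are extracted from left to right, the prefix \<open>ps\<close> collecting the
  arrows already normalised. A nonzero product forces degree 0 and matching sources, so the
  normalised remainder is a \<open>path\<close>.\<close>

lemma scale_path:
  assumes "graded_multilinear (dgs N) B p q e M \<phi>" "string (dgs N) i (ps @ as) j" "prodv as \<noteq> 0"
    "M \<le> length (ps @ as)" "module (scl B)"
  shows "\<phi> i (ps @ as) = scl B (prodv as) (\<phi> i (ps @ path (fin i ps) (map tgt as)))"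
  using assms(2-4)
proof (induction as arbitrary: ps)
  case Nil
  interpret module "scl B" by (rule assms(5))
  show ?case by simp
next
  case (Cons a as)
  interpret module "scl B" by (rule assms(5))
  let ?a = "Arr (src a) (tgt a) (deg a) 1"
  have nz: "val a \<noteq> 0" "prodv as \<noteq> 0" using Cons.prems by auto
  have sa: "src a = fin i ps" "deg a = 0"
    using Cons.prems(1) nz by (auto simp: string_append dest: string_fin split: if_splits)
  have s: "string (dgs N) i (ps @ ?a # as) j"
    using Cons.prems(1) nz by (auto simp: string_append split: if_splits)
  have "\<phi> i (ps @ a # as) = \<phi> i (ps @ Arr (src a) (tgt a) (deg a) (scl (dgs N) (val a) 1) # as)"
    by (cases a) simp
  also have "\<dots> = scl B (val a) (\<phi> i (ps @ ?a # as))"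
    using Cons.prems(3) by (intro graded_multilinear_scale[OF assms(1) s]) auto
  also have "\<phi> i (ps @ ?a # as) = scl B (prodv as) (\<phi> i ((ps @ [?a]) @ path (fin i (ps @ [?a])) (map tgt as)))"
    using Cons.IH[of "ps @ [?a]"] s nz Cons.prems(3) by simp
  finally show ?case using sa by simp
qed

lemma prodv_zero_value:
  assumes "graded_multilinear (dgs N) B p q e M \<phi>" "string (dgs N) i as j" "prodv as = 0"
    "M \<le> length as" "module (scl B)"
  shows "\<phi> i as = 0"
proof -
  interpret module "scl B" by (rule assms(5))
  from assms(3) obtain a where "a \<in> set as" "val a = 0" by (auto simp: prod_list_zero_iff)
  then obtain ps ts where as: "as = ps @ a # ts" by (meson split_list)
  have a: "a = Arr (src a) (tgt a) (deg a) 0" using \<open>val a = 0\<close> by (cases a) simp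
  have s: "string (dgs N) i (ps @ Arr (src a) (tgt a) (deg a) 0 # ts) j" using assms(2) a as by simp
  show ?thesis using graded_multilinear_scale[OF assms(1) s, of 0] assms(4) as a by simp
qed

context endo_complex
begin

lemma spx_mapsp: "\<sigma> \<in> spx mapsp n \<longleftrightarrow> ainf_functor (dgs (Suc n)) B \<sigma> \<and>
    act nrv 0 (Suc n) (\<lambda>_. 0) \<sigma> = vtx \<and> act nrv n (Suc n) (coface 0) \<sigma> = act nrv n 0 (\<lambda>_. 0) vtx"
  by (simp add: left_mapping_space_def face_def const_spx_def) (simp add: nerve_def)

lemma act_mapsp: "act mapsp m n \<alpha> = act nrv (Suc m) (Suc n) (case_nat 0 (\<lambda>i. Suc (\<alpha> i)))"
  by (simp add: left_mapping_space_def)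

lemma coface_0: "coface 0 = Suc"
  by (auto simp: coface_def)

lemma fob_vtx: "fob vtx = (\<lambda>i\<in>{..0}. x)"
  by (simp add: nerve_vertex_def)

lemma cval_unit:
  assumes "2 \<le> length vs" "hd vs \<noteq> 0 \<or> set vs \<subseteq> {0}"
  shows "cval g vs = (if length vs = 2 then idm else 0)"
proof (cases "hd vs = 0")
  case True
  with assms have "set vs \<subseteq> {0}" by auto
  then have z: "vs ! i = 0" if "i < length vs" for i using that nth_mem by blast
  have l: "0 < length vs" "1 < length vs" using assms(1) by auto
  show ?thesis
  proof (cases "length vs = 2")
    case True
    then show ?thesis using z[of 1] by (simp add: cval_def)
  next
    case False
    then show ?thesis using cval_degenerate[of 0 vs g] z[OF l(1)] z[OF l(2)] assms(1) by simp
  qed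
qed (simp add: cval_def)

lemma simplex_in_mapsp:
  assumes g: "chain_map n g"
  shows "simplex n g \<in> spx mapsp n"
proof -
  \<comment> \<open>Both boundary conditions at once: \<open>\<beta>\<close> avoids 0 for the face
    opposite to vertex 0, and is constantly 0 for the source vertex.\<close>
  have *: "fcomp (simplex n g) (map (map_arr \<beta> id) as) = (if length as = 1 then scl B (prodv as) idm else 0)"
    if s: "string (dgs m) i as j" and ne: "as \<noteq> []" and "\<And>i j. i \<le> j \<Longrightarrow> j \<le> m \<Longrightarrow> \<beta> i \<le> \<beta> j \<and> \<beta> j \<le> Suc n"
      and b: "(\<forall>i. \<beta> i \<noteq> 0) \<or> \<beta> = (\<lambda>_. 0)" for m i j as \<beta>
  proof -
    have s': "string (dgs (Suc n)) (\<beta> i) (map (map_arr \<beta> id) as) (\<beta> j)"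
      using that by (intro string_map_arr[OF _ s]) auto
    have "cval g (map \<beta> (verts as)) = (if length (map \<beta> (verts as)) = 2 then idm else 0)"
    proof (rule cval_unit)
      show "hd (map \<beta> (verts as)) \<noteq> 0 \<or> set (map \<beta> (verts as)) \<subseteq> {0}"
        using b by (elim disjE) (simp, simp add: image_subset_iff)
    qed (use ne in \<open>auto simp: Suc_le_eq\<close>)
    then show ?thesis using fcomp_simplex[OF s', of g] ne
      by (simp only: susp_map_arr map_val_map_arr verts_map_arr[OF ne])
        (cases as; auto)
  qed
  have "act nrv n (Suc n) (coface 0) (simplex n g) = act nrv n 0 (\<lambda>_. 0) vtx"
    unfolding act_nerve coface_0 by (intro arg_cong2[where f = AFun] ext if_cong refl)
      (auto simp: fob_simplex fob_vtx restrict_def * fcomp_vtx_act)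
  moreover have "act nrv 0 (Suc n) (\<lambda>_. 0) (simplex n g) = vtx"
  proof -
    have q1: "fcomp (simplex n g) (map (map_arr (\<lambda>_. 0) id) as) = fcomp vtx as"
    if s: "string (dgs 0) i as j" and ne: "as \<noteq> []" for i j as
  proof -
    have "map (map_arr (\<lambda>_. 0) id) as = as" using s
    proof (induction as arbitrary: i)
      case (Cons a as)
      then have "tgt a = 0" using string_obj by fastforce
      with Cons show ?case by (cases a) auto
    qed simp
    then show ?thesis using *[OF s ne, of "\<lambda>_. 0"] fcomp_vtx_act[OF s] by simp
  qed
  have q2: "fcomp vtx as = 0" if "\<not> (as \<noteq> [] \<and> (\<exists>i j. string (dgs 0 :: (nat, 'k, 'k) ainf) i as j))" for as
    using that unfolding fcomp_vtx by (cases as; cases "tl as") auto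
  have "(\<lambda>as. if as \<noteq> [] \<and> (\<exists>i j. string (dgs 0 :: (nat, 'k, 'k) ainf) i as j)
      then fcomp (simplex n g) (map (map_arr (\<lambda>_. 0) id) as) else 0) = fcomp vtx"
    (is "(\<lambda>as. if ?c as then _ as else 0) = _")
  proof
    fix as
    show "(if ?c as then fcomp (simplex n g) (map (map_arr (\<lambda>_. 0) id) as) else 0) = fcomp vtx as"
    proof (cases "?c as")
      case True
      then show ?thesis unfolding if_P[OF True] using q1 by blast
    next
      case False
      then show ?thesis unfolding if_not_P[OF False] using q2[OF False] by simp
    qed
  qed
  then show ?thesis unfolding act_nerve by (intro afun.expand) (auto simp: fob_simplex fob_vtx)
  qed
  ultimately show ?thesis using simplex_functor[OF g] by (simp add: spx_mapsp)
qed

lemma inner_del: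
  assumes "inner n js" "2 \<le> length js"
  shows "inner n (del l js)"
proof -
  have "length (del l js) \<noteq> 0" using assms(2) by (cases "l < length js") (auto simp: del_def)
  then have "del l js \<noteq> []" by blast
  then show ?thesis
    using assms(1) set_del[of l js] sorted_wrt_del[of "(<)" js l] unfolding inner_def by blast
qed

text \<open>The functor equation is evaluated on the chain of basis arrows through 0 and
  \<open>js\<close>, where it involves the values of \<open>g\<close> without any scalar.\<close>

lemma simplex_closed:
  assumes f: "ainf_functor (dgs (Suc n)) B (simplex n g)" and gg: "graded_cochain n g" and js: "inner n js"
  shows "closed_at g js"
proof -
  let ?k = "length js"
  have ne: "path 0 js \<noteq> []" and k: "1 \<le> ?k" "js \<noteq> []" using js by (auto simp: inner_def Suc_le_eq)
  note s = inner_string_path[OF js]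
  have "(\<Sum>(p, q, t)\<in>splits (path 0 js). sg (sdeg p) (F_op (simplex n g) (p @ b_arr (dgs (Suc n)) q # t)))
          = (\<Sum>qs\<in>{qs. concat qs = path 0 js \<and> [] \<notin> set qs}. b_op B (map (F_arr (simplex n g)) qs))"
    using f s ne unfolding ainf_functor_def by blast
  then have e: "(\<Sum>l<?k - 1. sg (int l + 1) (cval g (del (Suc l) (0 # js)))) =
    m1 (1 - int ?k) (cval g (0 # js))
    + (if 2 \<le> ?k \<and> (0 # js) ! (?k - 1) \<noteq> 0 then sg (int ?k - 1) (cval g (butlast (0 # js))) else 0)
    - (if 2 \<le> ?k \<and> (0 # js) ! 1 = 0 then cval g (tl (0 # js)) else 0)"
    unfolding simplex_lhs[OF s ne] simplex_rhs[OF gg s ne] prodv_replicate_path scale_one length_path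
      src_hd_path[OF k(2)] map_tgt_path .
  show ?thesis
  proof (cases "?k = 1")
    case True
    then show ?thesis using e cval_0_Cons[OF js, of g] by (simp add: closed_at_def)
  next
    case False
    then have k2: "2 \<le> ?k" using k by simp
    have nz: "j \<noteq> 0" if "j \<in> set js" for j using js that by (auto simp: inner_def)
    have h: "cval g (del (Suc l) (0 # js)) = g (del l js)" for l
      using cval_0_Cons[OF inner_del[OF js k2]] by (simp add: del_Cons)
    have b: "cval g (butlast (0 # js)) = g (del (?k - 1) js)"
      using h[of "?k - 1"] k del_last[of "0 # js"] by simp
    have n1: "(0 # js) ! 1 \<noteq> 0" using nz[of "js ! 0"] k by simp
    have n2: "(0 # js) ! (?k - 1) \<noteq> 0"
      using nz[of "js ! (?k - 2)"] k2 by (simp add: nth_Cons' numeral_2_eq_2)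
    have "(\<Sum>l<?k - 1. sg (int l + 1) (g (del l js))) =
      m1 (1 - int ?k) (g js) + sg (int ?k - 1) (g (del (?k - 1) js))"
      using e n1 n2 k2 unfolding h b cval_0_Cons[OF js] by simp
    \<comment> \<open>The index \<open>?k - 1\<close>, absent from the merges, is supplied by the
      product with the unit on the last arrow.\<close>
    moreover have "{..<?k} = insert (?k - 1) {..<?k - 1}" using k by auto
    ultimately have "m1 (1 - int ?k) (g js) = (\<Sum>l<?k. sg (int l + 1) (g (del l js)))"
      using k by (simp add: of_nat_diff sg_def)
    then show ?thesis using False by (simp add: closed_at_def)
  qed
qed

text \<open>The data are read off on strict chains of basis arrows from 0. Strict chains avoiding 0
  lie in the constant face, chains with a repetition contain an identity arrow, and multilinearity
  determines everything else.\<close>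

lemma mapsp_is_simplex:
  assumes "\<sigma> \<in> spx mapsp n"
  shows "\<exists>g. chain_map n g \<and> \<sigma> = simplex n g"
proof -
  from assms have f: "ainf_functor (dgs (Suc n)) B \<sigma>" and v0: "act nrv 0 (Suc n) (\<lambda>_. 0) \<sigma> = vtx"
    and d0: "act nrv n (Suc n) Suc \<sigma> = act nrv n 0 (\<lambda>_. 0) vtx"
    by (auto simp: spx_mapsp coface_0)
  note D = f[unfolded ainf_functor_def]
  have fe: "fob \<sigma> \<in> {..Suc n} \<rightarrow>\<^sub>E Obj B"
    using D[THEN conjunct1] by simp
  have fz: "fcomp \<sigma> as = 0"
    if "as = [] \<or> (\<nexists>i j. string (dgs (Suc n) :: (nat, 'k, 'k) ainf) i as j)" for as
    using D[THEN conjunct2, THEN conjunct1] that by blast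
  have gm: "graded_multilinear (dgs (Suc n)) B (fob \<sigma>) (fob \<sigma>) 1 1 (\<lambda>_. fcomp \<sigma>)"
    using D[THEN conjunct2, THEN conjunct2, THEN conjunct1] .
  have fu: "fcomp \<sigma> [unit_arr (dgs (Suc n)) i] = unt B (fob \<sigma> i)" if "i \<le> Suc n" for i
    using D[THEN conjunct2, THEN conjunct2, THEN conjunct2, THEN conjunct2, THEN conjunct1] that by simp
  have fv: "fcomp \<sigma> as = 0" if "string (dgs (Suc n)) i as j" "2 \<le> length as"
      "unit_arr (dgs (Suc n)) z \<in> set as" for i as j z
    using D[THEN conjunct2, THEN conjunct2, THEN conjunct2, THEN conjunct2, THEN conjunct2] that by blast
  have "fob (act nrv 0 (Suc n) (\<lambda>_. 0) \<sigma>) 0 = x"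
    unfolding v0 by (simp add: nerve_vertex_def)
  then have x0: "fob \<sigma> 0 = x" by (simp add: act_nerve)
  have xS: "fob \<sigma> (Suc i) = x" if "i \<le> n" for i
  proof -
    have "fob (act nrv n (Suc n) Suc \<sigma>) i = x"
      unfolding d0 using that by (simp add: act_nerve nerve_vertex_def)
    then show ?thesis using that by (simp add: act_nerve)
  qed
  have fx: "fob \<sigma> i = x" if "i \<le> Suc n" for i using x0 xS that by (cases i) auto
  then have fob: "fob \<sigma> = (\<lambda>i\<in>{..Suc n}. x)"
    using fe by (auto simp: fun_eq_iff PiE_def extensional_def)
  have face: "fcomp \<sigma> (map (map_arr Suc id) as) = (if length as = 1 then scl B (prodv as) idm else 0)"
    if s: "string (dgs n) i as j" "as \<noteq> []" for i as j
  proof -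
    have "fcomp (act nrv n (Suc n) Suc \<sigma>) as = fcomp vtx (map (map_arr (\<lambda>_. 0) id) as)"
      unfolding d0 using s by (auto simp: act_nerve)
    then show ?thesis using s fcomp_vtx_act[OF s(1)] by (auto simp: act_nerve split: if_splits)
  qed
  define g where "g = (\<lambda>js. F_op \<sigma> (path 0 js))"
  have path: "F_op \<sigma> (path i js) = cval g (i # js)"
    if s: "string (dgs (Suc n)) i (path i js :: (nat, 'k) arr list) j" and ne: "js \<noteq> []" for i js j
  proof (cases "sorted_wrt (<) (i # js)")
    case True
    show ?thesis
    proof (cases i)
      case 0
      with True ne show ?thesis by (cases "tl js") (auto simp: cval_def g_def neq_Nil_conv)
    next
      case (Suc m)
      \<comment> \<open>The chain avoids 0, so it is the image under \<open>Suc\<close> of a chain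
        \<open>m # ks\<close> in the face opposite to vertex 0, where \<open>face\<close>
        applies.\<close>
      define ks where "ks = map (\<lambda>j. j - 1) js"
      have js: "js = map Suc ks"
        unfolding ks_def map_map by (rule map_idI[symmetric]) (use True Suc in auto)
      have "string (dgs n) m (path m ks) (last (m # ks))"
        using s Suc js by (auto simp: string_path sorted_map)
      from face[OF this] have "fcomp \<sigma> (path i js) = (if length js = 1 then idm else 0)"
        using ne unfolding path_map js Suc by simp
      moreover have "susp (path i js :: (nat, 'k) arr list) = 0" if "length js = 1" using that by (cases js) auto
      ultimately show ?thesis using Suc ne by (auto simp: F_op_def cval_def)
    qed
  next
    case False
    have "sorted (i # js)" using s unfolding string_path by simp
    then obtain m where m: "Suc m < length (i # js)" "(i # js) ! m = (i # js) ! Suc m"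
      using False not_strict_repeat by blast
    show ?thesis
    proof (cases "length js = 1")
      case True
      then obtain k where k: "js = [k]" by (auto simp: length_Suc_conv)
      then have "k = i" "i \<le> Suc n" using m s by auto
      then show ?thesis using fu[of i] fx[of i] k by (auto simp: F_op_def cval_def unit_arr_def)
    next
      case False
      then have l2: "2 \<le> length js" using ne by (cases js; cases "tl js") auto
      obtain z where "unit_arr (dgs (Suc n)) z \<in> set (path i js :: (nat, 'k) arr list)"
        using path_unit_arr[OF m] by blast
      then have "fcomp \<sigma> (path i js) = 0" using fv[OF s] l2 by simp
      then show ?thesis using cval_degenerate[OF m, of g] l2 by (simp add: F_op_def)
    qed
  qed
  have mod: "module (scl B)" by unfold_locales
  have val: "fcomp \<sigma> as = sg (susp as) (scl B (prodv as) (cval g (verts as)))"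
    if s: "string (dgs (Suc n)) i as j" and ne: "as \<noteq> []" for i as j
  proof (cases "prodv as = 0")
    case True
    then show ?thesis using prodv_zero_value[OF gm s True _ mod] ne by (simp add: Suc_le_eq)
  next
    case False
    have "map deg as = map deg (path i (map tgt as) :: (nat, 'k) arr list)"
      using string_dgs_nz[OF s False] by (intro nth_equalityI) (auto simp: path_deg[OF nth_mem])
    then have su: "susp as = susp (path i (map tgt as) :: (nat, 'k) arr list)" by (rule susp_cong)
    have sp: "string (dgs (Suc n)) i (path i (map tgt as) :: (nat, 'k) arr list) (last (i # map tgt as))"
      using string_dgs_nz[OF s False] by (simp add: string_path)
    have "fcomp \<sigma> as = scl B (prodv as) (fcomp \<sigma> (path i (map tgt as)))"
      using scale_path[OF gm, of i "[]" as j] s False ne mod by (simp add: Suc_le_eq)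
    also have "fcomp \<sigma> (path i (map tgt as)) = sg (susp as) (cval g (i # map tgt as))"
      using path[OF sp] ne by (simp add: su F_op_def flip: F_op_scale_eq)
    finally show ?thesis using string_src_hd[OF s ne] by (simp add: scale_sg)
  qed
  have "fcomp \<sigma> = fcomp (simplex n g)"
  proof
    fix as
    show "fcomp \<sigma> as = fcomp (simplex n g) as"
      using fz[of as] val[of _ as] by (auto simp: simplex_def)
  qed
  then have \<sigma>: "\<sigma> = simplex n g" by (intro afun.expand) (simp add: fob fob_simplex)
  have "graded_cochain n g" unfolding graded_cochain_def
  proof (intro allI impI)
    fix js assume js: "inner n js"
    let ?p = "path 0 js :: (nat, 'k) arr list"
    have "fcomp \<sigma> ?p \<in> Hom B (fob \<sigma> 0) (fob \<sigma> (last js))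
        ((\<Sum>a\<leftarrow>?p. deg a) + 1 - int (length ?p))"
      by (rule graded_multilinear_mem[OF gm inner_string_path[OF js]])
        (use js in \<open>simp add: inner_def Suc_le_eq\<close>)
    moreover have "last js \<le> Suc n" using js last_in_set by (fastforce simp: inner_def)
    moreover have "(\<Sum>a\<leftarrow>?p. deg a) = 0" by (rule sum_deg_path)
    ultimately show "g js \<in> endo (1 - int (length js))" by (simp add: fx g_def F_op_def endo_sg)
  qed
  then show ?thesis using simplex_closed f \<sigma> by (auto simp: chain_map_def)
qed

end

section \<open>Spheres and fillers\<close>

text \<open>Vertex 0 is the source object, so face \<open>i\<close> of the mapping space omits
  vertex \<open>i + 1\<close>; in the list of all vertices from 1 on, this is position
  \<open>i\<close>.\<close>

lemma map_coface_top:
  assumes "i \<le> Suc n"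
  shows "map (coface (Suc i)) [1..<Suc (Suc n)] = del i [1..<Suc (Suc (Suc n))]"
  by (rule nth_equalityI)
    (use assms in \<open>auto simp: length_del nth_del coface_def simp del: upt_Suc\<close>)

lemma coface_image:
  assumes "i \<le> Suc n"
  shows "coface (Suc i) ` {1..<Suc (Suc n)} = {1..<Suc (Suc (Suc n))} - {Suc i}"
proof (intro equalityI subsetI)
  fix k assume k: "k \<in> {1..<Suc (Suc (Suc n))} - {Suc i}"
  show "k \<in> coface (Suc i) ` {1..<Suc (Suc n)}"
  proof (cases "k \<le> i")
    case True
    then have "k = coface (Suc i) k" "k \<in> {1..<Suc (Suc n)}" using k assms by (auto simp: coface_def)
    then show ?thesis by blast
  next
    case False
    with k have "Suc i < k" by auto
    then have "k = coface (Suc i) (k - 1)" "k - 1 \<in> {1..<Suc (Suc n)}"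
      using k by (auto simp: coface_def)
    then show ?thesis by blast
  qed
qed (auto simp: coface_def split: if_splits)

lemma strict_mono_coface: "strict_mono_on S (coface i)"
  by (auto simp: strict_mono_on_def coface_def)

context endo_complex
begin

text \<open>A vertex of the mapping space is an edge of the nerve; the base vertex is the degenerate
  edge, that is, the identity.\<close>

abbreviation pt :: "(nat, 'k, 'p, 'w) afun" where "pt \<equiv> const_spx nrv (Suc 0) vtx"

definition sfaces :: "nat \<Rightarrow> 'w \<Rightarrow> nat list \<Rightarrow> 'w" where
  "sfaces n z js = (if length js = Suc n then z else cfaces js)"

definition sphere :: "nat \<Rightarrow> 'w \<Rightarrow> (nat, 'k, 'p, 'w) afun" where
  "sphere n z = simplex n (sfaces n z)"

definition cocycles :: "nat \<Rightarrow> 'w set" where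
  "cocycles n = {z \<in> endo (- int n). m1 (- int n) z = 0}"

definition coboundaries :: "nat \<Rightarrow> 'w set" where
  "coboundaries n = m1 (- int n - 1) ` endo (- int n - 1)"

text \<open>The cocycle on the top face of the constant simplex. In dimension 0 the base point is
  the identity, not 0.\<close>

definition base :: "nat \<Rightarrow> 'w" where "base n = (if n = 0 then idm else 0)"

text \<open>For two vertices the sum is the identity minus itself; for more vertices every deletion
  still has at least two vertices, where \<open>cfaces\<close> is 0.\<close>

lemma cfaces_alternating:
  assumes "2 \<le> length js" "\<And>ks. length ks = length js - 1 \<Longrightarrow> g ks = cfaces ks"
  shows "(\<Sum>l<length js. sg (int l + 1) (g (del l js))) = 0"
proof -
  have "(\<Sum>l<length js. sg (int l + 1) (g (del l js))) =
    (\<Sum>l<length js. sg (int l + 1) (if length js = 2 then idm else 0))"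
    using assms by (intro sum.cong) (auto simp: length_del cfaces_def)
  also have "\<dots> = 0" by (cases "length js = 2") (simp add: numeral_2_eq_2 sg_def, simp)
  finally show ?thesis .
qed

lemma inner_top: "inner n [1..<Suc (Suc n)]"
  by (auto simp: inner_def simp del: upt_Suc)

lemma inner_full: "inner n js \<Longrightarrow> length js = Suc n \<Longrightarrow> js = [1..<Suc (Suc n)]"
  unfolding inner_def by (rule strictly_increasing_interval) auto

lemma cocycles_0: "0 \<in> cocycles n"
  by (simp add: cocycles_def)

lemma cocycles_base: "base n \<in> cocycles n"
  by (simp add: cocycles_def base_def unt_in)

lemma chain_map_sfaces:
  assumes z: "z \<in> cocycles n"
  shows "chain_map n (sfaces n z)" unfolding chain_map_def graded_cochain_def
proof (intro conjI allI impI)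
  fix js assume js: "inner n js"
  then have len: "length js \<le> Suc n" "length js \<noteq> 0" using innerD by (auto simp: inner_def)
  show "sfaces n z js \<in> endo (1 - int (length js))"
    using z by (auto simp: sfaces_def cfaces_def cocycles_def unt_in)
  show "closed_at (sfaces n z) js"
  proof (cases "length js = 1")
    case True
    then show ?thesis using z by (auto simp: closed_at_def sfaces_def cfaces_def cocycles_def)
  next
    case False
    then have len2: "2 \<le> length js" using len by linarith
    have "m1 (1 - int (length js)) (sfaces n z js) = 0"
      using z False by (auto simp: sfaces_def cfaces_def cocycles_def)
    moreover have "(\<Sum>l<length js. sg (int l + 1) (sfaces n z (del l js))) = 0"
      by (rule cfaces_alternating) (use len len2 in \<open>auto simp: sfaces_def\<close>)
    ultimately show ?thesis using False by (simp add: closed_at_def)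
  qed
qed

lemma sphere_in_mapsp: "z \<in> cocycles n \<Longrightarrow> sphere n z \<in> spx mapsp n"
  by (simp add: sphere_def simplex_in_mapsp chain_map_sfaces)

lemma sphere_inject: "sphere n z = sphere n z' \<Longrightarrow> z = z'"
  using simplex_inject[OF _ inner_top, of n "sfaces n z" "sfaces n z'"]
  by (simp add: sphere_def sfaces_def del: upt_Suc)

lemma sphere_base: "sphere n (base n) = simplex n cfaces"
  unfolding sphere_def by (rule simplex_cong) (auto simp: sfaces_def base_def cfaces_def)

lemma const_mapsp: "const_spx mapsp n pt = sphere n (base n)"
proof -
  have "const_spx mapsp n pt = act nrv (Suc n) (Suc 0) (case_nat 0 (\<lambda>i. Suc 0)) (act nrv (Suc 0) 0 (\<lambda>_. 0) vtx)"
    by (simp add: const_spx_def act_mapsp)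
  also have "\<dots> = act nrv (Suc n) 0 (\<lambda>_. 0) vtx"
    by (rule act_const) (auto split: nat.splits)
  also have "\<dots> = sphere n (base n)" by (simp only: const_nrv sphere_base)
  finally show ?thesis .
qed

lemma face_simplex:
  assumes "i \<le> Suc n"
  shows "face mapsp (Suc n) i (simplex (Suc n) g) = simplex n (\<lambda>js. g (map (coface (Suc i)) js))"
proof -
  have "case_nat 0 (\<lambda>j. Suc (coface i j)) = coface (Suc i)"
    by (auto simp: fun_eq_iff coface_def split: nat.splits)
  then have "face mapsp (Suc n) i (simplex (Suc n) g) = act nrv (Suc n) (Suc (Suc n)) (coface (Suc i)) (simplex (Suc n) g)"
    by (simp add: face_def act_mapsp)
  also have "\<dots> = simplex n (\<lambda>js. g (map (coface (Suc i)) js))"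
    by (rule act_simplex) (auto simp: strict_mono_coface, auto simp: coface_def)
  finally show ?thesis .
qed

lemma face_sphere:
  assumes "i \<le> Suc n"
  shows "face mapsp (Suc n) i (sphere (Suc n) z) = const_spx mapsp n pt"
  unfolding sphere_def face_simplex[OF assms] const_mapsp
  by (rule simplex_cong) (auto simp: sfaces_def base_def cfaces_def dest: innerD)

text \<open>A constant boundary fixes \<open>g\<close> on all proper faces, so only the top value is
  free. Its equation says that it is a cocycle, because the alternating sum of the constant data
  vanishes.\<close>

lemma spheres_eq: "spheres mapsp pt n = sphere n ` cocycles n"
proof (intro equalityI subsetI)
  fix \<sigma> assume "\<sigma> \<in> sphere n ` cocycles n"
  then show "\<sigma> \<in> spheres mapsp pt n"
    by (cases n) (auto simp: spheres_def sphere_in_mapsp face_sphere)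
next
  fix \<sigma> assume s: "\<sigma> \<in> spheres mapsp pt n"
  then have "\<sigma> \<in> spx mapsp n" by (simp add: spheres_def)
  then obtain g where g: "chain_map n g" "\<sigma> = simplex n g" using mapsp_is_simplex by blast
  have low: "g js = cfaces js" if js: "inner n js" and len: "length js \<le> n" for js
  proof -
    obtain m where m: "n = Suc m" using js len by (cases n) (auto simp: inner_def)
    have "card (set js) < card {1..Suc n}" using len card_length[of js] by simp
    then obtain j where j: "j \<in> {1..Suc n}" "j \<notin> set js"
      by (metis List.finite_set card_mono leD subsetI)
    then obtain i where i: "j = Suc i" "i \<le> Suc m" using m by (cases j) auto
    \<comment> \<open>The face misses vertex \<open>i + 1\<close>, and \<open>ks\<close> is the same
      face with the vertices of the facet renumbered; on that facet the data are those of the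
      constant simplex.\<close>
    define ks where "ks = map (\<lambda>j. if j \<le> i then j else j - 1) js"
    have js': "js = map (coface (Suc i)) ks" unfolding ks_def map_map
      by (rule map_idI[symmetric]) (use j i in \<open>auto simp: coface_def\<close>, (metis Suc_lessI Suc_pred not_less_eq gr0I not_le)+)
    have "inner m ks"
    proof -
      have "sorted_wrt (<) (map (coface (Suc i)) ks)" using js js' by (simp add: inner_def)
      then have "sorted_wrt (\<lambda>a b. coface (Suc i) a < coface (Suc i) b) ks"
        by (simp add: sorted_wrt_map)
      then have "sorted_wrt (<) ks"
        by (rule sorted_wrt_mono_rel[rotated]) (auto simp: coface_def split: if_splits)
      moreover have "set ks \<subseteq> {1..Suc m}"
      proof
        fix k assume "k \<in> set ks"
        then have "coface (Suc i) k \<in> set js" by (simp add: js')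
        then show "k \<in> {1..Suc m}"
          using js i j m by (auto simp: inner_def coface_def subset_iff split: if_splits)
      qed
      ultimately show ?thesis using js by (auto simp: inner_def js')
    qed
    moreover have "simplex m (\<lambda>js. g (map (coface (Suc i)) js)) = simplex m cfaces"
    proof -
      have "face mapsp (Suc m) i \<sigma> = const_spx mapsp m pt"
        using s i m by (auto simp: spheres_def)
      then show ?thesis
        using face_simplex[OF i(2), of g] g(2) m const_mapsp[of m] sphere_base[of m] by simp
    qed
    ultimately have "g js = cfaces ks" unfolding js' by (rule simplex_inject[rotated])
    then show ?thesis by (simp add: js' cfaces_def)
  qed
  let ?z = "g [1..<Suc (Suc n)]"
  have "?z \<in> endo (- int n)"
  proof -
    have "?z \<in> endo (1 - int (length [1..<Suc (Suc n)]))"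
      using g(1) inner_top[of n] unfolding chain_map_def graded_cochain_def by blast
    moreover have "1 - int (length [1..<Suc (Suc n)]) = - int n" by (simp del: upt_Suc)
    ultimately show ?thesis by (simp only:)
  qed
  moreover have "m1 (- int n) ?z = 0"
  proof -
    have c: "closed_at g [1..<Suc (Suc n)]" using g(1) inner_top by (simp add: chain_map_def)
    have "(\<Sum>l<Suc n. sg (int l + 1) (g (del l [1..<Suc (Suc n)]))) = 0" if "n \<noteq> 0"
    proof -
      have "(\<Sum>l<length [1..<Suc (Suc n)]. sg (int l + 1) (cfaces (del l [1..<Suc (Suc n)]))) = 0"
        by (rule cfaces_alternating) (use that in \<open>auto simp del: upt_Suc\<close>)
      moreover have "g (del l [1..<Suc (Suc n)]) = cfaces (del l [1..<Suc (Suc n)])" if "l < Suc n" for l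
        using \<open>n \<noteq> 0\<close> that by (intro low inner_del inner_top) (auto simp: length_del simp del: upt_Suc)
      ultimately show ?thesis by (simp del: upt_Suc)
    qed
    moreover have "1 - int (length [1..<Suc (Suc n)]) = - int n" by (simp del: upt_Suc)
    ultimately show ?thesis
      using c unfolding closed_at_def by (cases "n = 0") (simp_all del: upt_Suc sum.lessThan_Suc)
  qed
  moreover have "\<sigma> = sphere n ?z" unfolding g(2) sphere_def
  proof (rule simplex_cong)
    fix js assume js: "inner n js"
    show "g js = sfaces n ?z js"
      using inner_full[OF js] low[OF js] innerD[OF js] by (auto simp: sfaces_def simp del: upt_Suc)
  qed
  ultimately show "\<sigma> \<in> sphere n ` cocycles n" by (auto simp: cocycles_def)
qed

text \<open>This is \<open>closed_at\<close> on the top face: the deletions are the facets, where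
  \<open>g\<close> takes the sphere values \<open>z i\<close>, and the value on the top face is the
  cochain that they bound.\<close>

lemma filler_boundary:
  assumes w: "w \<in> spx mapsp (Suc n)" and f: "\<And>i. i \<le> Suc n \<Longrightarrow> face mapsp (Suc n) i w = sphere n (z i)"
  shows "(\<Sum>i<Suc (Suc n). sg (int i + 1) (z i)) \<in> coboundaries n"
proof -
  obtain g where g: "chain_map (Suc n) g" "w = simplex (Suc n) g" using mapsp_is_simplex w by blast
  let ?t = "[1..<Suc (Suc (Suc n))]"
  have "g (del i ?t) = z i" if "i \<le> Suc n" for i
  proof -
    have "simplex n (\<lambda>js. g (map (coface (Suc i)) js)) = simplex n (sfaces n (z i))"
      using f[OF that] face_simplex[OF that, of g] g(2) by (simp add: sphere_def)
    from simplex_inject[OF this inner_top] show ?thesis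
      unfolding map_coface_top[OF that] by (simp add: sfaces_def del: upt_Suc)
  qed
  then have "(\<Sum>i<Suc (Suc n). sg (int i + 1) (z i)) = (\<Sum>i<Suc (Suc n). sg (int i + 1) (g (del i ?t)))"
    by (intro sum.cong) auto
  also have "\<dots> = m1 (- int n - 1) (g ?t)"
  proof -
    have "closed_at g ?t" using g(1) inner_top[of "Suc n"] unfolding chain_map_def by blast
    moreover have "length ?t = Suc (Suc n)" "- 1 - int n = - int n - 1" by simp_all
    ultimately show ?thesis unfolding closed_at_def by (simp del: upt_Suc sum.lessThan_Suc)
  qed
  finally have "(\<Sum>i<Suc (Suc n). sg (int i + 1) (z i)) = m1 (- int n - 1) (g ?t)" .
  moreover have "g ?t \<in> endo (- int n - 1)"
  proof -
    have "g ?t \<in> endo (1 - int (length ?t))"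
      using g(1) inner_top[of "Suc n"] unfolding chain_map_def graded_cochain_def by blast
    moreover have "1 - int (length ?t) = - int n - 1" by (simp del: upt_Suc)
    ultimately show ?thesis by (simp only:)
  qed
  ultimately show ?thesis by (auto simp: coboundaries_def)
qed

text \<open>The filler takes \<open>u\<close> on the top face, \<open>z i\<close> on the facets and
  the constant data below. The top equation is the hypothesis on \<open>u\<close>; for the facets it
  uses that each \<open>z i\<close> is a cocycle, and lower down
  \<open>cfaces_alternating\<close>.\<close>

lemma filler_exists:
  assumes z: "\<And>i. z i \<in> cocycles n" and b: "(\<Sum>i<Suc (Suc n). sg (int i + 1) (z i)) \<in> coboundaries n"
  shows "\<exists>w\<in>spx mapsp (Suc n). \<forall>i\<le>Suc n. face mapsp (Suc n) i w = sphere n (z i)"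
proof -
  obtain u where u: "u \<in> endo (- int n - 1)" "m1 (- int n - 1) u = (\<Sum>i<Suc (Suc n). sg (int i + 1) (z i))"
    using b by (auto simp: coboundaries_def)
  let ?t = "[1..<Suc (Suc (Suc n))]"
  \<comment> \<open>The facets must be told apart as lists: \<open>mis\<close> recovers the index of
    a facet from the first vertex that it omits, with the shift by one caused by the source vertex
    0.\<close>
  define mis where "mis js = (LEAST i. Suc i \<notin> set js)" for js :: "nat list"
  define g where "g js = (if length js = Suc (Suc n) then u else if length js = Suc n then z (mis js) else cfaces js)"
    for js
  have gt: "g (del i ?t) = z i" if "i \<le> Suc n" for i
  proof -
    have "set (del i ?t) = {1..<Suc (Suc (Suc n))} - {Suc i}"
    proof -
      have "set (del i ?t) = coface (Suc i) ` {1..<Suc (Suc n)}"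
        unfolding map_coface_top[OF that, symmetric] by (simp del: upt_Suc)
      also have "\<dots> = {1..<Suc (Suc (Suc n))} - {Suc i}" using that by (rule coface_image)
      finally show ?thesis .
    qed
    then have m: "Suc k \<notin> set (del i ?t) \<longleftrightarrow> \<not> (k < Suc (Suc n)) \<or> k = i" for k
      by (simp only:) auto
    have "mis (del i ?t) = i" unfolding mis_def m using that by (intro Least_equality) auto
    then show ?thesis using that by (simp add: g_def length_del del: upt_Suc)
  qed
  have zV: "z i \<in> endo (- int n)" "m1 (- int n) (z i) = 0" for i using z[of i] by (auto simp: cocycles_def)
  have "chain_map (Suc n) g" unfolding chain_map_def graded_cochain_def
  proof (intro conjI allI impI)
    fix js assume js: "inner (Suc n) js"
    then have len: "length js \<le> Suc (Suc n)" "length js \<noteq> 0" using innerD by (auto simp: inner_def)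
    show "g js \<in> endo (1 - int (length js))"
    proof -
      have e: "- 1 - int n = - int n - 1" by simp
      have "u \<in> endo (- 1 - int n)" unfolding e by (rule u(1))
      then show ?thesis using zV(1) by (auto simp: g_def cfaces_def unt_in)
    qed
    show "closed_at g js"
    proof (cases "length js = Suc (Suc n)")
      case True
      then have "js = ?t" using inner_full js by blast
      then have "(\<Sum>l<length js. sg (int l + 1) (g (del l js))) = (\<Sum>i<Suc (Suc n). sg (int i + 1) (z i))"
        using gt True by (intro sum.cong) (simp_all del: upt_Suc)
      moreover have "1 - int (length js) = - int n - 1" "g js = u" using True by (auto simp: g_def)
      ultimately have "m1 (1 - int (length js)) (g js) = (\<Sum>l<length js. sg (int l + 1) (g (del l js)))"
        by (simp only: u(2))
      then show ?thesis using True unfolding closed_at_def by simp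
    next
      case False
      have d0: "m1 (1 - int (length js)) (g js) = 0" using zV False by (auto simp: g_def cfaces_def)
      show ?thesis
      proof (cases "length js = 1")
        case True
        then show ?thesis using d0 by (simp add: closed_at_def)
      next
        case l1: False
        then have "(\<Sum>l<length js. sg (int l + 1) (g (del l js))) = 0"
          using False len l1 by (intro cfaces_alternating) (linarith, auto simp: g_def)
        then show ?thesis using d0 l1 by (simp add: closed_at_def)
      qed
    qed
  qed
  then have "simplex (Suc n) g \<in> spx mapsp (Suc n)" by (rule simplex_in_mapsp)
  moreover have "face mapsp (Suc n) i (simplex (Suc n) g) = sphere n (z i)" if i: "i \<le> Suc n" for i
    unfolding face_simplex[OF i] sphere_def
  proof (rule simplex_cong)
    fix js assume js: "inner n js"
    show "g (map (coface (Suc i)) js) = sfaces n (z i) js"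
    proof (cases "length js = Suc n")
      case True
      then have "js = [1..<Suc (Suc n)]" using inner_full js by blast
      then show ?thesis using gt[OF i] map_coface_top[OF i] by (simp add: sfaces_def del: upt_Suc)
    next
      case False
      then show ?thesis using innerD[OF js] by (simp add: g_def sfaces_def cfaces_def)
    qed
  qed
  ultimately show ?thesis by blast
qed

section \<open>Homotopy groups as cocycles modulo coboundaries\<close>

definition cocycle_group :: "nat \<Rightarrow> 'w monoid" where
  "cocycle_group n = \<lparr>carrier = cocycles n, mult = (+), one = 0\<rparr>"

lemma cocycle_group_simps [simp]: "carrier (cocycle_group n) = cocycles n" "mult (cocycle_group n) = (+)" "one (cocycle_group n) = 0"
  by (simp_all add: cocycle_group_def)

lemma cocycles_add: "u \<in> cocycles n \<Longrightarrow> v \<in> cocycles n \<Longrightarrow> u + v \<in> cocycles n"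
  by (simp add: cocycles_def endo_add m1_add)

lemma cocycles_uminus: "v \<in> cocycles n \<Longrightarrow> - v \<in> cocycles n"
  by (simp add: cocycles_def endo_uminus m1_uminus)

lemma cocycles_diff: "u \<in> cocycles n \<Longrightarrow> v \<in> cocycles n \<Longrightarrow> u - v \<in> cocycles n"
  using cocycles_add[of u n "- v"] cocycles_uminus by simp

lemma coboundaries_cocycles: "v \<in> coboundaries n \<Longrightarrow> v \<in> cocycles n"
  unfolding coboundaries_def cocycles_def
  using m1_closed[of _ "- int n - 1"] m1_m1[of _ "- int n - 1"] by auto

lemma coboundaries_0: "0 \<in> coboundaries n"
  unfolding coboundaries_def by (rule image_eqI[of _ _ 0]) simp_all

lemma coboundaries_add: "u \<in> coboundaries n \<Longrightarrow> v \<in> coboundaries n \<Longrightarrow> u + v \<in> coboundaries n"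
  unfolding coboundaries_def by (auto simp flip: m1_add intro!: imageI endo_add)

lemma coboundaries_uminus: "v \<in> coboundaries n \<Longrightarrow> - v \<in> coboundaries n"
  unfolding coboundaries_def by (auto simp flip: m1_uminus intro!: imageI endo_uminus)

lemma coboundaries_sg [simp]: "sg k v \<in> coboundaries n \<longleftrightarrow> v \<in> coboundaries n"
  using coboundaries_uminus[of v n] coboundaries_uminus[of "- v" n] by (auto simp: sg_def)

lemma coboundaries_minus_commute: "u - v \<in> coboundaries n \<longleftrightarrow> v - u \<in> coboundaries n"
  using coboundaries_uminus[of "u - v" n] coboundaries_uminus[of "v - u" n] by auto

lemma comm_group_cocycle_group: "comm_group (cocycle_group n)"
proof (rule comm_groupI)
  fix v assume "v \<in> carrier (cocycle_group n)"
  then show "\<exists>u\<in>carrier (cocycle_group n). u \<otimes>\<^bsub>cocycle_group n\<^esub> v = \<one>\<^bsub>cocycle_group n\<^esub>"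
    by (intro bexI[of _ "- v"]) (auto simp: cocycles_uminus)
qed (auto simp: cocycles_add cocycles_0 algebra_simps)

lemma normal_coboundaries: "coboundaries n \<lhd> cocycle_group n"
proof -
  interpret comm_group "cocycle_group n" by (rule comm_group_cocycle_group)
  have "subgroup (coboundaries n) (cocycle_group n)"
  proof (rule subgroupI)
    fix v assume v: "v \<in> coboundaries n"
    have "inv\<^bsub>cocycle_group n\<^esub> v = - v"
      by (rule inv_equality) (auto simp: coboundaries_cocycles v cocycles_uminus)
    then show "inv\<^bsub>cocycle_group n\<^esub> v \<in> coboundaries n" using v by (simp add: coboundaries_uminus)
  qed (use coboundaries_0 coboundaries_cocycles in \<open>auto simp: coboundaries_add\<close>)
  then show ?thesis by (rule subgroup_imp_normal)
qed

abbreviation coset :: "nat \<Rightarrow> 'w \<Rightarrow> 'w set" where "coset n z \<equiv> coboundaries n #>\<^bsub>cocycle_group n\<^esub> z"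

lemma mem_coset: "y \<in> coset n z \<longleftrightarrow> z - y \<in> coboundaries n"
proof -
  have "y \<in> coset n z \<longleftrightarrow> (\<exists>b\<in>coboundaries n. y = b + z)" by (auto simp: r_coset_def)
  also have "\<dots> \<longleftrightarrow> y - z \<in> coboundaries n" by (metis add_diff_cancel_right' diff_add_cancel)
  finally show ?thesis using coboundaries_minus_commute by blast
qed

lemma coset_cocycles: "z \<in> cocycles n \<Longrightarrow> coset n z \<subseteq> cocycles n"
proof
  fix y assume z: "z \<in> cocycles n" and "y \<in> coset n z"
  then have "z - y \<in> cocycles n" by (intro coboundaries_cocycles) (simp add: mem_coset)
  then have "z - (z - y) \<in> cocycles n" by (rule cocycles_diff[OF z])
  then show "y \<in> cocycles n" by simp
qed

lemma coset_eq: "z - z' \<in> coboundaries n \<Longrightarrow> coset n z = coset n z'"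
proof -
  assume a: "z - z' \<in> coboundaries n"
  have "z - y \<in> coboundaries n \<longleftrightarrow> z' - y \<in> coboundaries n" for y
    using coboundaries_add[OF a, of "z' - y"] coboundaries_add[OF coboundaries_uminus[OF a], of "z - y"] by auto
  then show ?thesis by (auto simp: mem_coset)
qed

lemma filler_iff:
  assumes "\<And>i. z i \<in> cocycles n"
  shows "(\<exists>w\<in>spx mapsp (Suc n). \<forall>i\<le>Suc n. face mapsp (Suc n) i w = sphere n (z i)) \<longleftrightarrow>
    (\<Sum>i<Suc (Suc n). sg (int i + 1) (z i)) \<in> coboundaries n"
  using filler_boundary[of _ n z] filler_exists[of z, OF assms] by blast

text \<open>For \<open>n \<ge> 1\<close> the base cocycle is 0, so only the last three faces count.
  Their signs alternate, the common sign is irrelevant for being a coboundary, and the middle face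
  of a filler is cohomologous to \<open>a + c\<close>. This is why the simplicial product is
  addition.\<close>

lemma filler_three:
  assumes z: "a \<in> cocycles n" "b \<in> cocycles n" "c \<in> cocycles n" and n: "1 \<le> n"
  shows "(\<exists>w\<in>spx mapsp (Suc n). (\<forall>i<n - 1. face mapsp (Suc n) i w = const_spx mapsp n pt) \<and>
      face mapsp (Suc n) (n - 1) w = sphere n a \<and> face mapsp (Suc n) n w = sphere n b \<and>
      face mapsp (Suc n) (Suc n) w = sphere n c) \<longleftrightarrow> a - b + c \<in> coboundaries n"
proof -
  define z where "z i = (if i < n - 1 then 0 else if i = n - 1 then a else if i = n then b else c)" for i
  have zi: "z i \<in> cocycles n" for i using z cocycles_0 by (simp add: z_def)
  have b0: "base n = 0" using n by (simp add: base_def)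
  obtain m where m: "n = Suc m" using n by (cases n) auto
  have "(\<Sum>i<Suc (Suc n). sg (int i + 1) (z i)) =
      (\<Sum>i<m. sg (int i + 1) (z i)) + sg (int m + 1) a + sg (int m + 2) b + sg (int m + 3) c"
    by (simp add: m z_def add.commute)
  also have "(\<Sum>i<m. sg (int i + 1) (z i)) = 0" by (rule sum.neutral) (simp add: z_def m)
  also have "0 + sg (int m + 1) a + sg (int m + 2) b + sg (int m + 3) c = sg (int m + 1) (a - b + c)"
    by (auto simp: sg_def)
  finally have e: "(\<Sum>i<Suc (Suc n). sg (int i + 1) (z i)) \<in> coboundaries n \<longleftrightarrow> a - b + c \<in> coboundaries n" by simp
  have all: "(\<forall>i\<le>Suc n. face mapsp (Suc n) i w = sphere n (z i)) \<longleftrightarrow>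
      (\<forall>i<n - 1. face mapsp (Suc n) i w = const_spx mapsp n pt) \<and>
      face mapsp (Suc n) (n - 1) w = sphere n a \<and> face mapsp (Suc n) n w = sphere n b \<and>
      face mapsp (Suc n) (Suc n) w = sphere n c" for w
    unfolding const_mapsp b0 less_Suc_eq_le[symmetric] m All_less_Suc
    by (simp add: z_def m base_def conj_ac)
  show ?thesis using filler_iff[of z, OF zi] unfolding e all .
qed

lemma filler_two:
  assumes z: "a \<in> cocycles n" "b \<in> cocycles n"
  shows "(\<exists>w\<in>spx mapsp (Suc n). (\<forall>i<n. face mapsp (Suc n) i w = const_spx mapsp n pt) \<and>
      face mapsp (Suc n) n w = sphere n a \<and> face mapsp (Suc n) (Suc n) w = sphere n b) \<longleftrightarrow> a - b \<in> coboundaries n"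
proof -
  define z where "z i = (if i < n then base n else if i = n then a else b)" for i
  have zi: "z i \<in> cocycles n" for i using z cocycles_base by (simp add: z_def)
  have "(\<Sum>i<Suc (Suc n). sg (int i + 1) (z i)) =
      (\<Sum>i<n. sg (int i + 1) (z i)) + sg (int n + 1) a + sg (int n + 2) b"
    by (simp add: z_def add.commute)
  \<comment> \<open>For \<open>n = 0\<close> the index set is empty, and for
    \<open>n \<ge> 1\<close> the base cocycle is 0; dimension 0 thus needs no separate
    treatment.\<close>
  also have "(\<Sum>i<n. sg (int i + 1) (z i)) = 0" by (rule sum.neutral) (simp add: z_def base_def)
  also have "0 + sg (int n + 1) a + sg (int n + 2) b = sg (int n + 1) (a - b)"
    by (auto simp: sg_def)
  finally have e: "(\<Sum>i<Suc (Suc n). sg (int i + 1) (z i)) \<in> coboundaries n \<longleftrightarrow> a - b \<in> coboundaries n" by simp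
  have all: "(\<forall>i\<le>Suc n. face mapsp (Suc n) i w = sphere n (z i)) \<longleftrightarrow>
      (\<forall>i<n. face mapsp (Suc n) i w = const_spx mapsp n pt) \<and>
      face mapsp (Suc n) n w = sphere n a \<and> face mapsp (Suc n) (Suc n) w = sphere n b" for w
    unfolding const_mapsp less_Suc_eq_le[symmetric] All_less_Suc by (simp add: z_def conj_ac)
  show ?thesis using filler_iff[of z, OF zi] unfolding e all .
qed

lemma htpy_sphere:
  assumes "a \<in> cocycles n"
  shows "htpy mapsp pt n `` {sphere n a} = sphere n ` coset n a"
proof -
  have "(sphere n a, \<tau>) \<in> htpy mapsp pt n \<longleftrightarrow> (\<exists>b\<in>cocycles n. \<tau> = sphere n b \<and> a - b \<in> coboundaries n)" for \<tau>
    using filler_two[OF assms] assms unfolding htpy_def spheres_eq by auto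
  then have "htpy mapsp pt n `` {sphere n a} = {sphere n b |b. b \<in> cocycles n \<and> a - b \<in> coboundaries n}"
    by auto
  also have "\<dots> = sphere n ` coset n a"
    using coset_cocycles[OF assms] by (auto simp: mem_coset subset_iff)
  finally show ?thesis .
qed

lemma homotopy_set_eq: "homotopy_set mapsp pt n = (`) (sphere n) ` (rcosets\<^bsub>cocycle_group n\<^esub> coboundaries n)"
  unfolding homotopy_set_def quotient_def spheres_eq RCOSETS_def by (auto simp: htpy_sphere)

lemma inj_on_image_sphere: "inj_on ((`) (sphere n)) S"
  by (rule inj_onI) (metis inj_image_eq_iff injI sphere_inject)

lemma hom_cohomology_eq: "hom_cohomology B x x (- int n) = cocycle_group n Mod coboundaries n"
  by (simp add: hom_cohomology_def cocycle_group_def cocycles_def coboundaries_def hom_cocycles_def hom_coboundaries_def m1_def)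

lemma pi0_bij: "\<exists>\<phi>. bij_betw \<phi> (homotopy_set mapsp pt 0) (carrier (hom_cohomology B x x 0))"
proof -
  have "carrier (hom_cohomology B x x 0) = rcosets\<^bsub>cocycle_group 0\<^esub> coboundaries 0"
    using hom_cohomology_eq[of 0] by (simp add: FactGroup_def)
  then have "bij_betw ((`) (sphere 0)) (carrier (hom_cohomology B x x 0)) (homotopy_set mapsp pt 0)"
    by (simp add: bij_betw_def homotopy_set_eq inj_on_image_sphere)
  then show ?thesis using bij_betw_inv by blast
qed

text \<open>The product is a union over all admissible fillers. Each contributes at most the class
  of \<open>a + c\<close> by \<open>filler_three\<close>, and a filler with middle face
  \<open>a + c\<close> exists.\<close>

lemma homotopy_mult:
  assumes z: "a \<in> cocycles n" "c \<in> cocycles n" and n: "1 \<le> n"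
  shows "mult (homotopy_group mapsp pt n) (sphere n ` coset n a) (sphere n ` coset n c) = sphere n ` coset n (a + c)"
proof -
  define W where "W = {w \<in> spx mapsp (Suc n). (\<forall>i<n - 1. face mapsp (Suc n) i w = const_spx mapsp n pt) \<and>
               face mapsp (Suc n) (n - 1) w \<in> sphere n ` coset n a \<and> face mapsp (Suc n) (Suc n) w \<in> sphere n ` coset n c}"
  have m: "mult (homotopy_group mapsp pt n) (sphere n ` coset n a) (sphere n ` coset n c) =
      (\<Union>w\<in>W. htpy mapsp pt n `` {face mapsp (Suc n) n w})"
    by (simp add: homotopy_group_def W_def)
  have sub: "htpy mapsp pt n `` {face mapsp (Suc n) n w} \<subseteq> sphere n ` coset n (a + c)" if w: "w \<in> W" for w
  proof (cases "face mapsp (Suc n) n w \<in> sphere n ` cocycles n")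
    case True
    then obtain b where b: "b \<in> cocycles n" "face mapsp (Suc n) n w = sphere n b" by blast
    obtain a' c' where ac: "a' \<in> coset n a" "face mapsp (Suc n) (n - 1) w = sphere n a'"
      "c' \<in> coset n c" "face mapsp (Suc n) (Suc n) w = sphere n c'"
      using w by (auto simp: W_def)
    then have "a' \<in> cocycles n" "c' \<in> cocycles n" using z coset_cocycles by blast+
    then have abc: "a' - b + c' \<in> coboundaries n"
      using filler_three[of a' n b c'] b ac n w by (auto simp: W_def)
    have "a - a' \<in> coboundaries n" "c - c' \<in> coboundaries n" using ac by (auto simp: mem_coset)
    then have "(a - a') + (c - c') \<in> coboundaries n" by (rule coboundaries_add)
    from coboundaries_add[OF this abc] have "(a - a') + (c - c') + (a' - b + c') \<in> coboundaries n" .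
    then have "(a + c) - b \<in> coboundaries n" by (simp add: algebra_simps)
    then show ?thesis using htpy_sphere[OF b(1)] b(2) coset_eq by simp
  next
    \<comment> \<open>A middle face that is not a sphere is related to nothing by
      \<open>htpy\<close>, so it would add the empty set to the union.\<close>
    case False
    then have "htpy mapsp pt n `` {face mapsp (Suc n) n w} = {}"
      unfolding htpy_def spheres_eq by blast
    then show ?thesis by simp
  qed
  have ac: "a + c \<in> cocycles n" using z by (rule cocycles_add)
  have "a - (a + c) + c \<in> coboundaries n" by (simp add: coboundaries_0)
  then obtain w where w: "w \<in> spx mapsp (Suc n)" "\<forall>i<n - 1. face mapsp (Suc n) i w = const_spx mapsp n pt"
      "face mapsp (Suc n) (n - 1) w = sphere n a" "face mapsp (Suc n) n w = sphere n (a + c)"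
      "face mapsp (Suc n) (Suc n) w = sphere n c" using filler_three[OF z(1) ac z(2) n] by blast
  have "w \<in> W" using w by (auto simp: W_def mem_coset coboundaries_0)
  moreover have "htpy mapsp pt n `` {face mapsp (Suc n) n w} = sphere n ` coset n (a + c)"
    unfolding w(4) by (rule htpy_sphere[OF ac])
  ultimately show ?thesis unfolding m using sub by blast
qed

lemma pi_iso:
  assumes n: "1 \<le> n"
  shows "group (homotopy_group mapsp pt n) \<and> homotopy_group mapsp pt n \<cong> hom_cohomology B x x (- int n)"
proof -
  interpret normal "coboundaries n" "cocycle_group n" by (rule normal_coboundaries)
  let ?Q = "cocycle_group n Mod coboundaries n" and ?H = "homotopy_group mapsp pt n"
  have Q: "group ?Q" by (rule factorgroup_is_group)
  have car: "carrier ?H = (`) (sphere n) ` carrier ?Q"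
    by (simp add: homotopy_group_def FactGroup_def homotopy_set_eq)
  have hom: "(`) (sphere n) \<in> hom ?Q ?H"
  proof (rule homI)
    fix C D assume "C \<in> carrier ?Q" "D \<in> carrier ?Q"
    then obtain a c where ac: "a \<in> cocycles n" "c \<in> cocycles n" "C = coset n a" "D = coset n c"
      by (auto simp: FactGroup_def RCOSETS_def)
    then have "C \<otimes>\<^bsub>?Q\<^esub> D = coset n (a + c)"
      using rcos_sum[of a c] by (simp add: FactGroup_def)
    then show "sphere n ` (C \<otimes>\<^bsub>?Q\<^esub> D) = (sphere n ` C) \<otimes>\<^bsub>?H\<^esub> (sphere n ` D)"
      using homotopy_mult[OF ac(1,2) n] ac by simp
  qed (simp add: car)
  have "one ?H = sphere n ` one ?Q"
  proof -
    have "one ?H = sphere n ` coset n 0"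
      using htpy_sphere[of "base n" n] cocycles_0 n by (simp add: homotopy_group_def const_mapsp base_def)
    also have "coset n 0 = coboundaries n" by (auto simp: r_coset_def)
    finally show ?thesis by (simp add: FactGroup_def)
  qed
  \<comment> \<open>\<open>hom_imp_img_group\<close> makes the record with the image carrier and the
    image unit into a group; this equation identifies that record with \<open>?H\<close>.\<close>
  then have "?H = ?H\<lparr>carrier := (`) (sphere n) ` carrier ?Q, one := sphere n ` one ?Q\<rparr>"
    by (simp add: car[symmetric])
  then have "group ?H" using group.hom_imp_img_group[OF Q hom] by simp
  moreover have "(`) (sphere n) \<in> iso ?Q ?H"
    using hom by (simp add: iso_def bij_betw_def car inj_on_image_sphere)
  then have "?Q \<cong> ?H" by (auto simp: is_iso_def)
  then have "?H \<cong> ?Q" by (rule group.iso_sym[OF Q])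
  ultimately show ?thesis by (simp add: hom_cohomology_eq)
qed

end

section \<open>Families of multilinear maps and their composition\<close>

text \<open>Unlike in \<open>splits\<close>, the middle part may be empty, since transformations
  have a component on the empty string.\<close>

definition cuts3 :: "'a list \<Rightarrow> ('a list \<times> 'a list \<times> 'a list) set" where
  "cuts3 as = {(p, q, t). p @ q @ t = as}"

definition cuts2 :: "'a list \<Rightarrow> ('a list \<times> 'a list) set" where
  "cuts2 as = {(p, q). p @ q = as}"

definition cuts5 :: "'a list \<Rightarrow> ('a list \<times> 'a list \<times> 'a list \<times> 'a list \<times> 'a list) set" where
  "cuts5 as = {(a, b, c, d, e). a @ b @ c @ d @ e = as}"

lemma finite_cuts2: "finite (cuts2 as)"
proof (rule finite_subset)
  let ?S = "{q. set q \<subseteq> set as \<and> length q \<le> length as}"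
  show "cuts2 as \<subseteq> ?S \<times> ?S" by (auto simp: cuts2_def)
  show "finite (?S \<times> ?S)" by (intro finite_cartesian_product finite_lists_length_le) auto
qed

lemma finite_cuts3: "finite (cuts3 as)"
proof (rule finite_subset)
  let ?S = "{q. set q \<subseteq> set as \<and> length q \<le> length as}"
  show "cuts3 as \<subseteq> ?S \<times> ?S \<times> ?S" by (auto simp: cuts3_def)
  show "finite (?S \<times> ?S \<times> ?S)"
    by (intro finite_cartesian_product finite_lists_length_le) auto
qed

lemma append3_eq_iff: "p @ q @ t = P @ B # T \<longleftrightarrow>
    (\<exists>u. p = P @ B # u \<and> u @ q @ t = T) \<or>
    (\<exists>v y. P = p @ v \<and> q = v @ B # y \<and> T = y @ t) \<or>
    (\<exists>w. t = w @ B # T \<and> p @ q @ w = P)"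
  by (auto simp: append_eq_append_conv2 append_eq_Cons_conv Cons_eq_append_conv)

text \<open>A marked entry \<open>B\<close> lies in exactly one of the three parts.\<close>

lemma sum_cuts3_insert:
  fixes f :: "'a list \<Rightarrow> 'a list \<Rightarrow> 'a list \<Rightarrow> 'v::ab_group_add"
  shows "(\<Sum>(p, q, t)\<in>cuts3 (P @ B # T). f p q t) =
    (\<Sum>(u, v, w)\<in>cuts3 T. f (P @ B # u) v w)
    + (\<Sum>(u, v)\<in>cuts2 P. \<Sum>(y, z)\<in>cuts2 T. f u (v @ B # y) z)
    + (\<Sum>(u, v, w)\<in>cuts3 P. f u v (w @ B # T))"
proof -
  let ?i1 = "\<lambda>(u, v, w). (P @ B # u, v, w)"
  let ?i2 = "\<lambda>((u, v), (y, z)). (u, v @ B # y, z)"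
  let ?i3 = "\<lambda>(u, v, w). (u, v, w @ B # T)"
  let ?A1 = "?i1 ` cuts3 T" and ?A2 = "?i2 ` (cuts2 P \<times> cuts2 T)" and ?A3 = "?i3 ` cuts3 P"
  have eq: "cuts3 (P @ B # T) = ?A1 \<union> ?A2 \<union> ?A3"
  proof (intro equalityI subsetI)
    fix z assume "z \<in> cuts3 (P @ B # T)"
    then obtain p q t where z: "z = (p, q, t)" "p @ q @ t = P @ B # T" by (auto simp: cuts3_def)
    from z(2)[unfolded append3_eq_iff] show "z \<in> ?A1 \<union> ?A2 \<union> ?A3"
    proof (elim disjE exE conjE)
      fix u assume "p = P @ B # u" "u @ q @ t = T"
      then have "(p, q, t) = ?i1 (u, q, t)" "(u, q, t) \<in> cuts3 T" by (auto simp: cuts3_def)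
      then show ?thesis unfolding z(1) by blast
    next
      fix v y assume "P = p @ v" "q = v @ B # y" "T = y @ t"
      then have "(p, q, t) = ?i2 ((p, v), (y, t))" "((p, v), (y, t)) \<in> cuts2 P \<times> cuts2 T"
        by (auto simp: cuts2_def)
      then show ?thesis unfolding z(1) by blast
    next
      fix w assume "t = w @ B # T" "p @ q @ w = P"
      then have "(p, q, t) = ?i3 (p, q, w)" "(p, q, w) \<in> cuts3 P" by (auto simp: cuts3_def)
      then show ?thesis unfolding z(1) by blast
    qed
  next
    fix z assume "z \<in> ?A1 \<union> ?A2 \<union> ?A3"
    then show "z \<in> cuts3 (P @ B # T)" by (elim UnE imageE) (auto simp: cuts3_def cuts2_def)
  qed
  let ?f = "\<lambda>(p, q, t). f p q t"
  \<comment> \<open>The position \<open>length P\<close> of the marked entry decides which part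
    contains it, even if the element \<open>B\<close> occurs elsewhere. Comparing lengths therefore
    shows that the three pieces are disjoint.\<close>
  let ?l = "\<lambda>z. length (fst z)" and ?m = "\<lambda>z. length (fst z) + length (fst (snd z))"
  have A1: "?l z > length P" if "z \<in> ?A1" for z using that by auto
  have A2: "?l z \<le> length P \<and> ?m z > length P" if "z \<in> ?A2" for z using that by (auto simp: cuts2_def)
  have A3: "?m z \<le> length P" if "z \<in> ?A3" for z using that by (auto simp: cuts3_def)
  have d12: "?A1 \<inter> ?A2 = {}" using A1 A2 by (meson disjoint_iff leD)
  have d3: "(?A1 \<union> ?A2) \<inter> ?A3 = {}"
  proof (rule equals0I)
    fix z assume "z \<in> (?A1 \<union> ?A2) \<inter> ?A3"
    then consider "z \<in> ?A1" "z \<in> ?A3" | "z \<in> ?A2" "z \<in> ?A3" by blast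
    then show False
    proof cases
      case 1
      show False using A1[OF 1(1)] A3[OF 1(2)] by linarith
    next
      case 2
      show False using A2[OF 2(1)] A3[OF 2(2)] by linarith
    qed
  qed
  have fin: "finite ?A1" "finite ?A2" "finite ?A3"
    by (intro finite_imageI finite_cuts3 finite_cuts2 finite_cartesian_product)+
  have "sum ?f (cuts3 (P @ B # T)) = sum ?f ?A1 + sum ?f ?A2 + sum ?f ?A3"
    unfolding eq sum.union_disjoint[OF finite_UnI[OF fin(1,2)] fin(3) d3]
      sum.union_disjoint[OF fin(1,2) d12] ..
  also have "sum ?f ?A1 = (\<Sum>(u, v, w)\<in>cuts3 T. f (P @ B # u) v w)"
    by (subst sum.reindex) (auto simp: inj_on_def case_prod_beta)
  also have "sum ?f ?A2 = (\<Sum>z\<in>cuts2 P \<times> cuts2 T. case z of ((u, v), y, z) \<Rightarrow> f u (v @ B # y) z)"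
  proof (subst sum.reindex)
    show "inj_on ?i2 (cuts2 P \<times> cuts2 T)" by (auto simp: inj_on_def cuts2_def)
  qed (auto simp: case_prod_beta)
  also have "\<dots> = (\<Sum>(u, v)\<in>cuts2 P. \<Sum>(y, z)\<in>cuts2 T. f u (v @ B # y) z)"
    by (simp add: sum.cartesian_product case_prod_beta)
  also have "sum ?f ?A3 = (\<Sum>(u, v, w)\<in>cuts3 P. f u v (w @ B # T))"
    by (subst sum.reindex) (auto simp: inj_on_def case_prod_beta)
  finally show ?thesis .
qed

text \<open>This and the next three statements turn iterated cuts into cuts in five, according to
  whether the second cut is made in the left, right or middle part or in both outer parts. The last
  two produce the same index set, which identifies an insertion made first with one made inside
  another.\<close>

lemma sum_cuts5_left:
  fixes G :: "'a list \<Rightarrow> 'a list \<Rightarrow> 'a list \<Rightarrow> 'a list \<Rightarrow> 'a list \<Rightarrow> 'v::ab_group_add"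
  shows "(\<Sum>(P, Q, T)\<in>cuts3 as. \<Sum>(a, b, c)\<in>cuts3 P. G a b c Q T) = (\<Sum>(a, b, c, d, e)\<in>cuts5 as. G a b c d e)"
proof -
  have "(\<Sum>(P, Q, T)\<in>cuts3 as. \<Sum>(a, b, c)\<in>cuts3 P. G a b c Q T) =
    (\<Sum>z\<in>(SIGMA z:cuts3 as. cuts3 (fst z)). case z of ((P, Q, T), a, b, c) \<Rightarrow> G a b c Q T)"
    by (subst sum.Sigma[symmetric]) (auto simp: finite_cuts3 case_prod_beta)
  also have "\<dots> = (\<Sum>(a, b, c, d, e)\<in>cuts5 as. G a b c d e)"
    by (rule sum.reindex_bij_witness[of _ "\<lambda>(a, b, c, d, e). ((a @ b @ c, d, e), a, b, c)"
          "\<lambda>((P, Q, T), a, b, c). (a, b, c, Q, T)"]) (auto simp: cuts3_def cuts5_def)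
  finally show ?thesis .
qed

lemma sum_cuts5_right:
  fixes G :: "'a list \<Rightarrow> 'a list \<Rightarrow> 'a list \<Rightarrow> 'a list \<Rightarrow> 'a list \<Rightarrow> 'v::ab_group_add"
  shows "(\<Sum>(P, Q, T)\<in>cuts3 as. \<Sum>(c, d, e)\<in>cuts3 T. G P Q c d e) = (\<Sum>(a, b, c, d, e)\<in>cuts5 as. G a b c d e)"
proof -
  have "(\<Sum>(P, Q, T)\<in>cuts3 as. \<Sum>(c, d, e)\<in>cuts3 T. G P Q c d e) =
    (\<Sum>z\<in>(SIGMA z:cuts3 as. cuts3 (snd (snd z))). case z of ((P, Q, T), c, d, e) \<Rightarrow> G P Q c d e)"
    by (subst sum.Sigma[symmetric]) (auto simp: finite_cuts3 case_prod_beta)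
  also have "\<dots> = (\<Sum>(a, b, c, d, e)\<in>cuts5 as. G a b c d e)"
    by (rule sum.reindex_bij_witness[of _ "\<lambda>(a, b, c, d, e). ((a, b, c @ d @ e), c, d, e)"
          "\<lambda>((P, Q, T), c, d, e). (P, Q, c, d, e)"]) (auto simp: cuts3_def cuts5_def)
  finally show ?thesis .
qed

lemma sum_cuts5_middle:
  fixes G :: "'a list \<Rightarrow> 'a list \<Rightarrow> 'a list \<Rightarrow> 'a list \<Rightarrow> 'a list \<Rightarrow> 'v::ab_group_add"
  shows "(\<Sum>(P, Q, T)\<in>cuts3 as. \<Sum>(b, c, d)\<in>cuts3 Q. G P b c d T) = (\<Sum>(a, b, c, d, e)\<in>cuts5 as. G a b c d e)"
proof -
  have "(\<Sum>(P, Q, T)\<in>cuts3 as. \<Sum>(b, c, d)\<in>cuts3 Q. G P b c d T) =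
    (\<Sum>z\<in>(SIGMA z:cuts3 as. cuts3 (fst (snd z))). case z of ((P, Q, T), b, c, d) \<Rightarrow> G P b c d T)"
    by (subst sum.Sigma[symmetric]) (auto simp: finite_cuts3 case_prod_beta)
  also have "\<dots> = (\<Sum>(a, b, c, d, e)\<in>cuts5 as. G a b c d e)"
    by (rule sum.reindex_bij_witness[of _ "\<lambda>(a, b, c, d, e). ((a, b @ c @ d, e), b, c, d)"
          "\<lambda>((P, Q, T), b, c, d). (P, b, c, d, T)"]) (auto simp: cuts3_def cuts5_def)
  finally show ?thesis .
qed

lemma sum_cuts5_outer:
  fixes G :: "'a list \<Rightarrow> 'a list \<Rightarrow> 'a list \<Rightarrow> 'a list \<Rightarrow> 'a list \<Rightarrow> 'v::ab_group_add"
  shows "(\<Sum>(P, Q, T)\<in>cuts3 as. \<Sum>(a, b)\<in>cuts2 P. \<Sum>(d, e)\<in>cuts2 T. G a b Q d e) =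
    (\<Sum>(a, b, c, d, e)\<in>cuts5 as. G a b c d e)"
proof -
  have "(\<Sum>(P, Q, T)\<in>cuts3 as. \<Sum>(a, b)\<in>cuts2 P. \<Sum>(d, e)\<in>cuts2 T. G a b Q d e) =
    (\<Sum>(P, Q, T)\<in>cuts3 as. \<Sum>z\<in>cuts2 P \<times> cuts2 T. case z of ((a, b), d, e) \<Rightarrow> G a b Q d e)"
    by (simp add: sum.cartesian_product case_prod_beta)
  also have "\<dots> = (\<Sum>z\<in>(SIGMA z:cuts3 as. cuts2 (fst z) \<times> cuts2 (snd (snd z))).
      case z of ((P, Q, T), (a, b), d, e) \<Rightarrow> G a b Q d e)"
    by (subst sum.Sigma[symmetric]) (auto simp: finite_cuts3 finite_cuts2 case_prod_beta)
  also have "\<dots> = (\<Sum>(a, b, c, d, e)\<in>cuts5 as. G a b c d e)"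
    by (rule sum.reindex_bij_witness[of _ "\<lambda>(a, b, c, d, e). ((a @ b, c, d @ e), (a, b), d, e)"
          "\<lambda>((P, Q, T), (a, b), d, e). (a, b, Q, d, e)"]) (auto simp: cuts3_def cuts2_def cuts5_def)
  finally show ?thesis .
qed

section \<open>Multilinear families over an A-infinity category\<close>

lemma cuts3_splits: "splits as = {z \<in> cuts3 as. fst (snd z) \<noteq> []}"
  by (auto simp: splits_def cuts3_def)

lemma string_slot: "string A x (as @ Arr z w d u # bs) y \<longleftrightarrow>
    string A x as z \<and> u \<in> Hom A z w d \<and> string A w bs y"
  by (auto simp: string_append dest: string_obj)

lemma susp_slot: "susp (as @ Arr z w d u # bs) = susp (as @ Arr z w d 0 # bs)"
  by (induction as) auto

locale ainf_cat = vector_space "scl A" for A :: "('o, 'v::ab_group_add, 'k::field) ainf" +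
  assumes cat: "ainf_category A"
begin

lemma Hom_subspace: "x \<in> Obj A \<Longrightarrow> y \<in> Obj A \<Longrightarrow> subspace (Hom A x y d)"
  using cat by (simp add: ainf_category_def)

lemma ops_gm: "graded_multilinear A A (\<lambda>x. x) (\<lambda>x. x) 2 1 (\<lambda>_. ops A)"
  using cat by (simp add: ainf_category_def)

lemma ainf_rel: "string A x as y \<Longrightarrow> as \<noteq> [] \<Longrightarrow>
    (\<Sum>(p, q, t)\<in>splits as. sg (sdeg p) (b_op A (p @ b_arr A q # t))) = 0"
  using cat unfolding ainf_category_def by blast

lemma unt_Hom: "x \<in> Obj A \<Longrightarrow> unt A x \<in> Hom A x x 0"
  using cat by (simp add: ainf_category_def)

lemma ops1_unit: "x \<in> Obj A \<Longrightarrow> ops A [unit_arr A x] = 0"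
  using cat by (simp add: ainf_category_def)

lemma ops2_unit_left: "x \<in> Obj A \<Longrightarrow> y \<in> Obj A \<Longrightarrow> v \<in> Hom A x y d \<Longrightarrow> ops A [unit_arr A x, Arr x y d v] = v"
  using cat unfolding ainf_category_def by blast

lemma ops2_unit_right: "x \<in> Obj A \<Longrightarrow> y \<in> Obj A \<Longrightarrow> v \<in> Hom A x y d \<Longrightarrow> ops A [Arr x y d v, unit_arr A y] = v"
  using cat unfolding ainf_category_def by blast

lemma ops3_unit: "string A x as y \<Longrightarrow> 3 \<le> length as \<Longrightarrow> unit_arr A z \<in> set as \<Longrightarrow> ops A as = 0"
  using cat unfolding ainf_category_def by blast

lemma scale_sgA: "scl A c (sg n v) = sg n (scl A c v)"
  by (simp add: sg_def)

lemma Hom_0: "string A x as y \<Longrightarrow> 0 \<in> Hom A x y d"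
  using Hom_subspace subspace_0 string_obj by metis

lemma Hom_lin: "x \<in> Obj A \<Longrightarrow> y \<in> Obj A \<Longrightarrow> u \<in> Hom A x y d \<Longrightarrow> v \<in> Hom A x y d \<Longrightarrow>
    scl A c u + v \<in> Hom A x y d" using Hom_subspace by (simp add: subspace_def)

lemma Hom_sg: "x \<in> Obj A \<Longrightarrow> y \<in> Obj A \<Longrightarrow> v \<in> Hom A x y d \<Longrightarrow> sg n v \<in> Hom A x y d"
  using subspace_neg[OF Hom_subspace] by (simp add: sg_def)

lemma Hom_sum: "x \<in> Obj A \<Longrightarrow> y \<in> Obj A \<Longrightarrow> (\<And>i. i \<in> S \<Longrightarrow> f i \<in> Hom A x y d) \<Longrightarrow> sum f S \<in> Hom A x y d"
  by (rule subspace_sum[OF Hom_subspace])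

text \<open>Additivity and homogeneity are packed into one equation, so each construction is checked
  only once per slot.\<close>

definition slot_linear :: "('o \<Rightarrow> ('o, 'v) arr list \<Rightarrow> 'v) \<Rightarrow> bool" where
  "slot_linear \<phi> \<longleftrightarrow> (\<forall>x as z w d u v c bs y. string A x (as @ Arr z w d u # bs) y \<and> v \<in> Hom A z w d \<longrightarrow>
     \<phi> x (as @ Arr z w d (scl A c u + v) # bs)
       = scl A c (\<phi> x (as @ Arr z w d u # bs)) + \<phi> x (as @ Arr z w d v # bs))"

lemma slot_linearD:
  assumes "slot_linear \<phi>" "string A x (as @ Arr z w d u # bs) y" "v \<in> Hom A z w d"
  shows "\<phi> x (as @ Arr z w d (scl A c u + v) # bs)
          = scl A c (\<phi> x (as @ Arr z w d u # bs)) + \<phi> x (as @ Arr z w d v # bs)"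
  using assms(1)[unfolded slot_linear_def, rule_format, OF conjI[OF assms(2,3)]] .

text \<open>
  Families of multilinear maps \<open>\<phi>\<^sub>n\<close>, \<open>n \<ge> 0\<close>, of degree \<open>e - n\<close>, with the suspensions absorbed,
  so that \<open>\<phi>\<close> has degree \<open>e - 1\<close> for the Koszul signs.
\<close>

definition fam :: "int \<Rightarrow> ('o \<Rightarrow> ('o, 'v) arr list \<Rightarrow> 'v) \<Rightarrow> bool" where
  "fam e \<phi> \<longleftrightarrow> (\<forall>x as y. string A x as y \<longrightarrow> \<phi> x as \<in> Hom A x y (sdeg as + e)) \<and> slot_linear \<phi>"

lemma famI:
  assumes "\<And>x as y. string A x as y \<Longrightarrow> \<phi> x as \<in> Hom A x y (sdeg as + e)"
    and "\<And>x as z w d u v c bs y. string A x (as @ Arr z w d u # bs) y \<Longrightarrow> v \<in> Hom A z w d \<Longrightarrow>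
       \<phi> x (as @ Arr z w d (scl A c u + v) # bs)
         = scl A c (\<phi> x (as @ Arr z w d u # bs)) + \<phi> x (as @ Arr z w d v # bs)"
  shows "fam e \<phi>" using assms unfolding fam_def slot_linear_def by blast

lemma fam_Hom: "fam e \<phi> \<Longrightarrow> string A x as y \<Longrightarrow> \<phi> x as \<in> Hom A x y (sdeg as + e)"
  unfolding fam_def by blast

lemmas fam_lin = slot_linearD[OF fam_def[THEN iffD1, THEN conjunct2]]

lemma fam_add:
  assumes "fam e \<phi>" "string A x (as @ Arr z w d u # bs) y" "v \<in> Hom A z w d"
  shows "\<phi> x (as @ Arr z w d (u + v) # bs) = \<phi> x (as @ Arr z w d u # bs) + \<phi> x (as @ Arr z w d v # bs)"
  using fam_lin[OF assms, of 1] by simp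

lemma fam_0:
  assumes "fam e \<phi>" "string A x (as @ Arr z w d 0 # bs) y"
  shows "\<phi> x (as @ Arr z w d 0 # bs) = 0"
proof -
  have "0 \<in> Hom A z w d" using assms(2) by (simp add: string_slot)
  from fam_add[OF assms this] show ?thesis by simp
qed

lemma fam_val_0:
  assumes "fam e \<phi>" "string A x as y" "a \<in> set as" "val a = 0"
  shows "\<phi> x as = 0"
proof -
  obtain p t where as: "as = p @ a # t" using assms(3) by (meson split_list)
  have a: "a = Arr (src a) (tgt a) (deg a) 0" using assms(4) by (cases a) simp
  have "string A x (p @ Arr (src a) (tgt a) (deg a) 0 # t) y" using assms(2) a as by simp
  from fam_0[OF assms(1) this] show ?thesis using a as by simp
qed

lemma fam_scale:
  assumes "fam e \<phi>" "string A x (as @ Arr z w d u # bs) y"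
  shows "\<phi> x (as @ Arr z w d (scl A c u) # bs) = scl A c (\<phi> x (as @ Arr z w d u # bs))"
proof -
  have 0: "0 \<in> Hom A z w d" using assms(2) Hom_0 string_obj Hom_subspace subspace_0
    by (metis string_slot)
  then have "string A x (as @ Arr z w d 0 # bs) y" using assms(2) by (simp add: string_slot)
  from fam_lin[OF assms 0, of c] fam_0[OF assms(1) this] show ?thesis by simp
qed

lemma fam_sg:
  assumes "fam e \<phi>" "string A x (as @ Arr z w d u # bs) y"
  shows "\<phi> x (as @ Arr z w d (sg n u) # bs) = sg n (\<phi> x (as @ Arr z w d u # bs))"
  using fam_scale[OF assms, of "-1"] by (simp add: sg_def)

lemma fam_sum:
  assumes "fam e \<phi>" "string A x as z" "string A w bs y" "finite S" "\<And>i. i \<in> S \<Longrightarrow> f i \<in> Hom A z w d"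
  shows "\<phi> x (as @ Arr z w d (\<Sum>i\<in>S. f i) # bs) = (\<Sum>i\<in>S. \<phi> x (as @ Arr z w d (f i) # bs))"
  using assms(4,5)
proof (induction S rule: finite_induct)
  case empty
  have "0 \<in> Hom A z w d"
    using string_obj[OF assms(2)] string_obj[OF assms(3)] Hom_subspace subspace_0 by blast
  then show ?case using assms by (auto simp: string_slot intro!: fam_0)
next
  case (insert i S)
  have zw: "z \<in> Obj A" "w \<in> Obj A" using string_obj[OF assms(2)] string_obj[OF assms(3)] by auto
  have "\<phi> x (as @ Arr z w d (f i + sum f S) # bs) =
      \<phi> x (as @ Arr z w d (f i) # bs) + \<phi> x (as @ Arr z w d (sum f S) # bs)"
    using insert assms(1-3) zw by (intro fam_add[of e]) (auto simp: string_slot intro!: Hom_sum)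
  then show ?case using insert by simp
qed

lemma fam_lincomb:
  assumes "fam e \<phi>" "fam e \<psi>"
  shows "fam e (\<lambda>x as. scl A c (\<phi> x as) + \<psi> x as)"
proof (rule famI)
  fix x as y assume s: "string A x as y"
  show "scl A c (\<phi> x as) + \<psi> x as \<in> Hom A x y (sdeg as + e)"
    using string_obj[OF s] fam_Hom[OF assms(1) s] fam_Hom[OF assms(2) s] by (intro Hom_lin) auto
next
  fix x as z w d u v c' bs y
  assume s: "string A x (as @ Arr z w d u # bs) y" "v \<in> Hom A z w d"
  show "scl A c (\<phi> x (as @ Arr z w d (scl A c' u + v) # bs)) + \<psi> x (as @ Arr z w d (scl A c' u + v) # bs) =
      scl A c' (scl A c (\<phi> x (as @ Arr z w d u # bs)) + \<psi> x (as @ Arr z w d u # bs))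
      + (scl A c (\<phi> x (as @ Arr z w d v # bs)) + \<psi> x (as @ Arr z w d v # bs))"
    unfolding fam_lin[OF assms(1) s] fam_lin[OF assms(2) s]
    by (simp add: scale_right_distrib mult.commute add_ac)
qed

lemma fam_diff: "fam e \<phi> \<Longrightarrow> fam e \<psi> \<Longrightarrow> fam e (\<lambda>x as. \<phi> x as - sg n (\<psi> x as))"
  using fam_lincomb[of e \<psi> \<phi> "- 1"] fam_lincomb[of e \<psi> \<phi> 1]
  by (cases "even n") (simp_all add: sg_def add.commute)

text \<open>The output of \<open>\<psi>\<close> on \<open>q\<close> as a single arrow. Its shifted
  degree is \<open>sdeg q + (e - 1)\<close>, in accordance with \<open>\<psi>\<close> having shifted
  degree \<open>e - 1\<close>.\<close>

definition farr :: "int \<Rightarrow> ('o \<Rightarrow> ('o, 'v) arr list \<Rightarrow> 'v) \<Rightarrow> 'o \<Rightarrow> ('o, 'v) arr list \<Rightarrow> ('o, 'v) arr" where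
  "farr e \<psi> x q = Arr x (fin x q) (sdeg q + e) (\<psi> x q)"

text \<open>The Gerstenhaber composition \<open>\<phi> \<circ> \<psi>\<close>, where \<open>\<psi>\<close> has degree \<open>e - n\<close> on strings of length \<open>n\<close>.\<close>

definition gcomp :: "int \<Rightarrow> ('o \<Rightarrow> ('o, 'v) arr list \<Rightarrow> 'v) \<Rightarrow> ('o \<Rightarrow> ('o, 'v) arr list \<Rightarrow> 'v)
    \<Rightarrow> 'o \<Rightarrow> ('o, 'v) arr list \<Rightarrow> 'v" where
  "gcomp e \<phi> \<psi> x as =
     (\<Sum>(p, q, t)\<in>cuts3 as. sg ((e - 1) * sdeg p) (\<phi> x (p @ farr e \<psi> (fin x p) q # t)))"

text \<open>The brace \<open>\<phi>{\<psi>, \<chi>}\<close>.\<close>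

definition brace :: "int \<Rightarrow> int \<Rightarrow> ('o \<Rightarrow> ('o, 'v) arr list \<Rightarrow> 'v) \<Rightarrow> ('o \<Rightarrow> ('o, 'v) arr list \<Rightarrow> 'v)
    \<Rightarrow> ('o \<Rightarrow> ('o, 'v) arr list \<Rightarrow> 'v) \<Rightarrow> 'o \<Rightarrow> ('o, 'v) arr list \<Rightarrow> 'v" where
  "brace e e' \<phi> \<psi> \<chi> x as = (\<Sum>(a, b, c, d, t)\<in>cuts5 as.
     sg ((e - 1) * sdeg a + (e' - 1) * (sdeg a + sdeg b + sdeg c))
       (\<phi> x (a @ farr e \<psi> (fin x a) b # c @ farr e' \<chi> (fin x (a @ b @ c)) d # t)))"

lemma string_append3: "string A x (p @ q @ t) y \<longleftrightarrow>
    string A x p (fin x p) \<and> string A (fin x p) q (fin (fin x p) q) \<and> string A (fin (fin x p) q) t y"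
  by (auto simp: string_append dest: string_fin)

lemma string_farr: "fam e \<psi> \<Longrightarrow> string A x (p @ q @ t) y \<Longrightarrow> string A x (p @ farr e \<psi> (fin x p) q # t) y"
  unfolding farr_def string_append3 string_slot using fam_Hom by blast

lemma fin_farr [simp]: "tgt (farr e \<psi> x q) = fin x q" "deg (farr e \<psi> x q) = sdeg q + e" "src (farr e \<psi> x q) = x"
  by (simp_all add: farr_def)

text \<open>Families are constrained only on composable strings; \<open>string_farr\<close> keeps
  the outer string composable after an insertion, so agreement there is enough.\<close>

lemma gcomp_cong:
  assumes "string A x as y"
    and "\<And>x as y. string A x as y \<Longrightarrow> \<psi> x as = \<psi>' x as"
    and "\<And>x as y. string A x as y \<Longrightarrow> \<phi> x as = \<phi>' x as" and "fam e \<psi>"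
  shows "gcomp e \<phi> \<psi> x as = gcomp e \<phi>' \<psi>' x as" unfolding gcomp_def
proof (rule sum.cong[OF refl], clarify)
  fix p q t assume "(p, q, t) \<in> cuts3 as"
  then have s: "string A x (p @ q @ t) y" using assms(1) by (simp add: cuts3_def)
  then have "farr e \<psi> (fin x p) q = farr e \<psi>' (fin x p) q"
    using assms(2) unfolding string_append3 farr_def by auto
  then show "sg ((e - 1) * sdeg p) (\<phi> x (p @ farr e \<psi> (fin x p) q # t)) =
      sg ((e - 1) * sdeg p) (\<phi>' x (p @ farr e \<psi>' (fin x p) q # t))"
    using assms(3)[OF string_farr[OF assms(4) s]] by simp
qed

end

context ainf_cat
begin

text \<open>The slot lies to the left of the inserted block, to its right, or inside it. In the last
  case linearity of \<open>\<psi>\<close> is used first and then that of \<open>\<phi>\<close> in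
  the slot of the inserted arrow.\<close>

lemma fam_gcomp_slot:
  assumes \<phi>: "fam e \<phi>" and \<psi>: "fam e' \<psi>" and s: "string A x (as @ Arr z w d u # bs) y" and v: "v \<in> Hom A z w d"
  shows "gcomp e' \<phi> \<psi> x (as @ Arr z w d (scl A c u + v) # bs) =
    scl A c (gcomp e' \<phi> \<psi> x (as @ Arr z w d u # bs)) + gcomp e' \<phi> \<psi> x (as @ Arr z w d v # bs)"
proof -
  let ?B = "\<lambda>X. Arr z w d X"
  let ?f = "\<lambda>p q t. sg ((e' - 1) * sdeg p) (\<phi> x (p @ farr e' \<psi> (fin x p) q # t))"
  have sz: "string A x as z" "u \<in> Hom A z w d" "string A w bs y" using s by (auto simp: string_slot)
  have zw: "z \<in> Obj A" "w \<in> Obj A" using sz string_obj by metis+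
  have su: "string A x (as @ ?B X # bs) y" if "X \<in> {u, v}" for X
    using sz v that by (auto simp: string_slot)
  define S1 where "S1 X = (\<Sum>(p, q, t)\<in>cuts3 bs. ?f (as @ ?B X # p) q t)" for X
  define S2 where "S2 X = (\<Sum>(p, q)\<in>cuts2 as. \<Sum>(r, t)\<in>cuts2 bs. ?f p (q @ ?B X # r) t)" for X
  define S3 where "S3 X = (\<Sum>(p, q, t)\<in>cuts3 as. ?f p q (t @ ?B X # bs))" for X
  have e: "gcomp e' \<phi> \<psi> x (as @ ?B X # bs) = S1 X + S2 X + S3 X" for X
    unfolding gcomp_def S1_def S2_def S3_def by (rule sum_cuts3_insert)
  have "S1 (scl A c u + v) = scl A c (S1 u) + S1 v"
  proof -
    have "?f (as @ ?B (scl A c u + v) # p) q t = scl A c (?f (as @ ?B u # p) q t) + ?f (as @ ?B v # p) q t"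
      if "(p, q, t) \<in> cuts3 bs" for p q t
    proof -
      have b: "p @ q @ t = bs" using that by (simp add: cuts3_def)
      have "string A x ((as @ ?B u # p) @ q @ t) y" using su[of u] b by simp
      from string_farr[OF \<psi> this]
      have "string A x (as @ ?B u # (p @ farr e' \<psi> (fin w p) q # t)) y" by simp
      from fam_lin[OF \<phi> this v, of c] show ?thesis by (simp add: sg_add scale_sgA)
    qed
    then show ?thesis
      unfolding S1_def scale_sum_right sum.distrib[symmetric] by (intro sum.cong) auto
  qed
  moreover have "S3 (scl A c u + v) = scl A c (S3 u) + S3 v"
  proof -
    have "?f p q (t @ ?B (scl A c u + v) # bs) = scl A c (?f p q (t @ ?B u # bs)) + ?f p q (t @ ?B v # bs)"
      if "(p, q, t) \<in> cuts3 as" for p q t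
    proof -
      have b: "p @ q @ t = as" using that by (simp add: cuts3_def)
      have "string A x (p @ q @ (t @ ?B u # bs)) y" using su[of u] b by auto
      from string_farr[OF \<psi> this]
      have "string A x ((p @ farr e' \<psi> (fin x p) q # t) @ ?B u # bs) y" by simp
      from fam_lin[OF \<phi> this v, of c] show ?thesis by (simp add: sg_add scale_sgA)
    qed
    then show ?thesis
      unfolding S3_def scale_sum_right sum.distrib[symmetric] by (intro sum.cong) auto
  qed
  moreover have "S2 (scl A c u + v) = scl A c (S2 u) + S2 v"
  proof -
    have "?f p (q @ ?B (scl A c u + v) # r) t = scl A c (?f p (q @ ?B u # r) t) + ?f p (q @ ?B v # r) t"
      if "(p, q) \<in> cuts2 as" "(r, t) \<in> cuts2 bs" for p q r t
    proof -
      have b: "p @ q = as" "r @ t = bs" using that by (auto simp: cuts2_def)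
      have st: "string A x (p @ (q @ ?B X # r) @ t) y" if "X \<in> {u, v}" for X
        using su[OF that] b by auto
      have "string A (fin x p) (q @ ?B u # r) (fin w r)"
        using st[of u] unfolding string_append3[of x p "q @ ?B u # r" t y] by simp
      from fam_lin[OF \<psi> this v, of c]
      have l: "\<psi> (fin x p) (q @ ?B (scl A c u + v) # r) =
          scl A c (\<psi> (fin x p) (q @ ?B u # r)) + \<psi> (fin x p) (q @ ?B v # r)" .
      let ?d = "sdeg (q @ ?B u # r) + e'"
      have 1: "string A x (p @ Arr (fin x p) (fin w r) ?d (\<psi> (fin x p) (q @ ?B u # r)) # t) y"
        using string_farr[OF \<psi> st[of u]] by (simp add: farr_def)
      have "string A x (p @ Arr (fin x p) (fin w r) ?d (\<psi> (fin x p) (q @ ?B v # r)) # t) y"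
        using string_farr[OF \<psi> st[of v]] by (simp add: farr_def)
      then have 2: "\<psi> (fin x p) (q @ ?B v # r) \<in> Hom A (fin x p) (fin w r) ?d"
        by (simp only: string_slot)
      from fam_lin[OF \<phi> 1 2, of c] show ?thesis by (simp add: sg_add scale_sgA farr_def l)
    qed
    then show ?thesis unfolding S2_def scale_sum_right sum.distrib[symmetric]
      by (intro sum.cong) (auto simp: scale_sum_right sum.distrib[symmetric] intro!: sum.cong)
  qed
  ultimately show ?thesis unfolding e by (simp add: scale_right_distrib)
qed

text \<open>Shifted degrees add under insertion: \<open>(e - 1) + (e' - 1)\<close> is
  \<open>(e + e' - 1) - 1\<close>.\<close>

lemma fam_gcomp:
  assumes \<phi>: "fam e \<phi>" and \<psi>: "fam e' \<psi>"
  shows "fam (e + e' - 1) (gcomp e' \<phi> \<psi>)"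
proof (rule famI)
  fix x as y assume s: "string A x as y"
  show "gcomp e' \<phi> \<psi> x as \<in> Hom A x y (sdeg as + (e + e' - 1))" unfolding gcomp_def
  proof (rule Hom_sum, use string_obj[OF s] in simp, use string_obj[OF s] in simp, clarify)
    fix p q t assume "(p, q, t) \<in> cuts3 as"
    then have as: "as = p @ q @ t" by (simp add: cuts3_def)
    have "\<phi> x (p @ farr e' \<psi> (fin x p) q # t) \<in> Hom A x y (sdeg (p @ farr e' \<psi> (fin x p) q # t) + e)"
      using string_farr[OF \<psi>, of x p q t y] s as by (intro fam_Hom[OF \<phi>]) auto
    then have "\<phi> x (p @ farr e' \<psi> (fin x p) q # t) \<in> Hom A x y (sdeg as + (e + e' - 1))"
      by (simp add: as algebra_simps)
    then show "sg ((e' - 1) * sdeg p) (\<phi> x (p @ farr e' \<psi> (fin x p) q # t)) \<in> Hom A x y (sdeg as + (e + e' - 1))"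
      using string_obj[OF s] by (auto intro: Hom_sg)
  qed
qed (rule fam_gcomp_slot[OF \<phi> \<psi>])

text \<open>The right pre-Lie identity, the source of \<open>m\<^sub>1\<^sup>2 = 0\<close> on the Hochschild complex.\<close>

lemma gcomp_assoc:
  assumes \<phi>: "fam e \<phi>" and \<psi>: "fam e1 \<psi>" and \<chi>: "fam e2 \<chi>" and s: "string A x as y"
  shows "gcomp e2 (gcomp e1 \<phi> \<psi>) \<chi> x as =
    gcomp (e1 + e2 - 1) \<phi> (gcomp e2 \<psi> \<chi>) x as + brace e1 e2 \<phi> \<psi> \<chi> x as
    + sg ((e1 - 1) * (e2 - 1)) (brace e2 e1 \<phi> \<chi> \<psi> x as)"
proof -
  let ?C = "\<lambda>P Q. farr e2 \<chi> (fin x P) Q"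
  let ?f = "\<lambda>p q t. sg ((e1 - 1) * sdeg p) (\<phi> x (p @ farr e1 \<psi> (fin x p) q # t))"
  let ?s = "\<lambda>P. sg ((e2 - 1) * sdeg P)"
  have "gcomp e2 (gcomp e1 \<phi> \<psi>) \<chi> x as =
    (\<Sum>(P, Q, T)\<in>cuts3 as. ?s P (\<Sum>(p, q, t)\<in>cuts3 (P @ ?C P Q # T). ?f p q t))"
    by (simp add: gcomp_def)
  also have "\<dots> = (\<Sum>(P, Q, T)\<in>cuts3 as. (\<Sum>(u, v, w)\<in>cuts3 T. ?s P (?f (P @ ?C P Q # u) v w))
      + (\<Sum>(u, v)\<in>cuts2 P. \<Sum>(b, t)\<in>cuts2 T. ?s P (?f u (v @ ?C P Q # b) t))
      + (\<Sum>(u, v, w)\<in>cuts3 P. ?s P (?f u v (w @ ?C P Q # T))))"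
    unfolding sum_cuts3_insert by (simp add: sg_add sg_sum case_prod_beta)
  also have "\<dots> = (\<Sum>(P, Q, T)\<in>cuts3 as. \<Sum>(u, v, w)\<in>cuts3 T. ?s P (?f (P @ ?C P Q # u) v w))
      + (\<Sum>(P, Q, T)\<in>cuts3 as. \<Sum>(u, v)\<in>cuts2 P. \<Sum>(b, t)\<in>cuts2 T. ?s P (?f u (v @ ?C P Q # b) t))
      + (\<Sum>(P, Q, T)\<in>cuts3 as. \<Sum>(u, v, w)\<in>cuts3 P. ?s P (?f u v (w @ ?C P Q # T)))"
    by (simp add: sum.distrib case_prod_beta)
  \<comment> \<open>Here \<open>\<chi>\<close> acts to the left of \<open>\<psi>\<close>;
    interchanging the two operators gives the sign with exponent
    \<open>(e1 - 1) * (e2 - 1)\<close>.\<close>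
  also have "(\<Sum>(P, Q, T)\<in>cuts3 as. \<Sum>(u, v, w)\<in>cuts3 T. ?s P (?f (P @ ?C P Q # u) v w)) =
      sg ((e1 - 1) * (e2 - 1)) (brace e2 e1 \<phi> \<chi> \<psi> x as)"
    unfolding sum_cuts5_right brace_def sg_sum
    by (intro sum.cong refl) (auto simp: sg_sg algebra_simps)
  \<comment> \<open>Here \<open>\<psi>\<close> acts to the left of \<open>\<chi>\<close>, and the
    prefix of \<open>\<chi>\<close> splits into three parts, as in the sign of the brace.\<close>
  also have "(\<Sum>(P, Q, T)\<in>cuts3 as. \<Sum>(u, v, w)\<in>cuts3 P. ?s P (?f u v (w @ ?C P Q # T))) =
      (\<Sum>(P, Q, T)\<in>cuts3 as. \<Sum>(u, v, w)\<in>cuts3 P. ?s (u @ v @ w) (?f u v (w @ ?C (u @ v @ w) Q # T)))"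
    by (intro sum.cong refl) (auto intro!: sum.cong simp: cuts3_def)
  also have "\<dots> = brace e1 e2 \<phi> \<psi> \<chi> x as" unfolding sum_cuts5_left brace_def
    by (intro sum.cong refl) (auto simp: sg_sg algebra_simps)
  \<comment> \<open>In the remaining terms the output of \<open>\<chi>\<close> is an argument of
    \<open>\<psi>\<close>. Passing through the five-part cut regroups them so that
    \<open>\<chi>\<close> is first inserted into \<open>\<psi>\<close>.\<close>
  also have "(\<Sum>(P, Q, T)\<in>cuts3 as. \<Sum>(u, v)\<in>cuts2 P. \<Sum>(b, t)\<in>cuts2 T. ?s P (?f u (v @ ?C P Q # b) t)) =
      (\<Sum>(P, Q, T)\<in>cuts3 as. \<Sum>(u, v)\<in>cuts2 P. \<Sum>(b, t)\<in>cuts2 T. ?s (u @ v) (?f u (v @ ?C (u @ v) Q # b) t))"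
    by (intro sum.cong refl) (auto intro!: sum.cong simp: cuts2_def)
  also have "\<dots> = (\<Sum>(P, Q, T)\<in>cuts3 as. \<Sum>(v, q, b)\<in>cuts3 Q. ?s (P @ v) (?f P (v @ ?C (P @ v) q # b) T))"
    unfolding sum_cuts5_outer sum_cuts5_middle ..
  also have "\<dots> = gcomp (e1 + e2 - 1) \<phi> (gcomp e2 \<psi> \<chi>) x as"
    unfolding gcomp_def[of "e1 + e2 - 1"]
  proof (intro sum.cong refl, clarify)
    fix P Q T assume "(P, Q, T) \<in> cuts3 as"
    then have as: "string A x (P @ Q @ T) y" using s by (simp add: cuts3_def)
    then have sq: "string A x P (fin x P)" "string A (fin x P) Q (fin (fin x P) Q)"
        "string A (fin (fin x P) Q) T y" unfolding string_append3 by auto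
    let ?x = "fin x P" and ?y = "fin (fin x P) Q" and ?d = "sdeg Q + (e1 + e2 - 1)"
    let ?g = "\<lambda>z. case z of (v, q, b) \<Rightarrow> \<psi> ?x (v @ farr e2 \<chi> (fin ?x v) q # b)"
    have st: "string A x (P @ Arr ?x ?y ?d (?g z) # T) y" if z: "z \<in> cuts3 Q" for z
    proof -
      obtain v q b where vqb: "z = (v, q, b)" "Q = v @ q @ b" using z by (auto simp: cuts3_def)
      have "string A ?x (v @ farr e2 \<chi> (fin ?x v) q # b) ?y"
        using string_farr[OF \<chi>, of ?x v q b ?y] sq(2) by (simp add: vqb)
      from fam_Hom[OF \<psi> this] have "?g z \<in> Hom A ?x ?y ?d" by (simp add: vqb algebra_simps)
      then show ?thesis using sq by (simp add: string_slot)
    qed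
    have xy: "?x \<in> Obj A" "?y \<in> Obj A" using string_obj sq by metis+
    have "\<phi> x (P @ farr (e1 + e2 - 1) (gcomp e2 \<psi> \<chi>) ?x Q # T) =
      \<phi> x (P @ Arr ?x ?y ?d (\<Sum>z\<in>cuts3 Q. sg ((e2 - 1) * sdeg (fst z)) (?g z)) # T)"
      by (simp add: farr_def gcomp_def case_prod_beta)
    also have "\<dots> = (\<Sum>z\<in>cuts3 Q. \<phi> x (P @ Arr ?x ?y ?d (sg ((e2 - 1) * sdeg (fst z)) (?g z)) # T))"
      using sq st xy by (intro fam_sum[OF \<phi>]) (auto simp: finite_cuts3 string_slot intro: Hom_sg)
    also have "\<dots> = (\<Sum>z\<in>cuts3 Q. sg ((e2 - 1) * sdeg (fst z)) (\<phi> x (P @ Arr ?x ?y ?d (?g z) # T)))"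
      using st by (intro sum.cong refl fam_sg[OF \<phi>])
    finally have e: "\<phi> x (P @ farr (e1 + e2 - 1) (gcomp e2 \<psi> \<chi>) ?x Q # T) =
      (\<Sum>z\<in>cuts3 Q. sg ((e2 - 1) * sdeg (fst z)) (\<phi> x (P @ Arr ?x ?y ?d (?g z) # T)))" .
    show "(\<Sum>(v, q, b)\<in>cuts3 Q. ?s (P @ v) (?f P (v @ ?C (P @ v) q # b) T)) =
      sg ((e1 + e2 - 1 - 1) * sdeg P) (\<phi> x (P @ farr (e1 + e2 - 1) (gcomp e2 \<psi> \<chi>) ?x Q # T))"
      unfolding e sg_sum
    proof (rule sum.cong[OF refl])
      fix z assume "z \<in> cuts3 Q"
      then obtain v q b where z: "z = (v, q, b)" and Q: "Q = v @ q @ b" by (auto simp: cuts3_def)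
      have "farr e1 \<psi> ?x (v @ ?C (P @ v) q # b) = Arr ?x ?y ?d (?g (v, q, b))"
        by (simp add: farr_def Q algebra_simps)
      then show "(case z of (v, q, b) \<Rightarrow> ?s (P @ v) (?f P (v @ ?C (P @ v) q # b) T)) =
         sg ((e1 + e2 - 1 - 1) * sdeg P)
           (sg ((e2 - 1) * sdeg (fst z)) (\<phi> x (P @ Arr ?x ?y ?d (?g z) # T)))"
        by (simp add: z sg_sg algebra_simps)
    qed
  qed
  finally show ?thesis by (simp add: add_ac)
qed

text \<open>\<open>ops A []\<close> is arbitrary, so the empty string is given the value 0; this
  expresses that there is no curvature \<open>m\<^sub>0\<close>.\<close>

definition b_fam :: "'o \<Rightarrow> ('o, 'v) arr list \<Rightarrow> 'v" where
  "b_fam x as = (if as = [] then 0 else b_op A as)"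

lemma graded_multilinear_linear:
  assumes gm: "graded_multilinear A A p q e N \<phi>" and s: "string A x (as @ Arr z w d u # bs) y"
    and v: "v \<in> Hom A z w d" and N: "N \<le> Suc (length as + length bs)"
  shows "\<phi> x (as @ Arr z w d (scl A c u + v) # bs) =
    scl A c (\<phi> x (as @ Arr z w d u # bs)) + \<phi> x (as @ Arr z w d v # bs)"
proof -
  have zw: "z \<in> Obj A" "w \<in> Obj A" and u: "u \<in> Hom A z w d"
    using s string_obj unfolding string_slot by metis+
  have s1: "string A x (as @ Arr z w d (scl A c u) # bs) y" and s2: "string A x (as @ Arr z w d v # bs) y"
    using s v subspace_scale[OF Hom_subspace[OF zw] u] by (simp_all add: string_slot)
  have "\<forall>x as z w d u v bs y.
        string A x (as @ Arr z w d u # bs) y \<and> string A x (as @ Arr z w d v # bs) y \<and>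
        N \<le> Suc (length as + length bs) \<longrightarrow>
        \<phi> x (as @ Arr z w d (u + v) # bs) = \<phi> x (as @ Arr z w d u # bs) + \<phi> x (as @ Arr z w d v # bs)"
    using gm unfolding graded_multilinear_def by (elim conjE)
  from this[rule_format, OF conjI[OF s1 conjI[OF s2 N]]] show ?thesis
    unfolding graded_multilinear_scale[OF gm s N] .
qed

lemma graded_multilinearI:
  assumes h: "\<And>x as y. string A x as y \<Longrightarrow> N \<le> length as \<Longrightarrow>
      \<phi> x as \<in> Hom A (p x) (q y) ((\<Sum>a\<leftarrow>as. deg a) + e - int (length as))"
    and l: "\<And>x as z w d u v c bs y. string A x (as @ Arr z w d u # bs) y \<Longrightarrow> v \<in> Hom A z w d \<Longrightarrow>
      \<phi> x (as @ Arr z w d (scl A c u + v) # bs)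
        = scl A c (\<phi> x (as @ Arr z w d u # bs)) + \<phi> x (as @ Arr z w d v # bs)"
  shows "graded_multilinear A A p q e N \<phi>" unfolding graded_multilinear_def
proof (intro conjI allI impI; elim conjE)
  fix x as z w d u v bs y
  assume "string A x (as @ Arr z w d u # bs) y" "string A x (as @ Arr z w d v # bs) y"
  from l[OF this(1), of v 1] this(2)
  show "\<phi> x (as @ Arr z w d (u + v) # bs) = \<phi> x (as @ Arr z w d u # bs) + \<phi> x (as @ Arr z w d v # bs)"
    by (simp add: string_slot)
next
  fix x as z w d u c bs y
  assume s: "string A x (as @ Arr z w d u # bs) y"
  then have 0: "0 \<in> Hom A z w d"
    using string_obj Hom_subspace subspace_0 unfolding string_slot by metis
  then have "string A x (as @ Arr z w d 0 # bs) y" using s by (simp add: string_slot)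
  from l[OF this 0, of 1] l[OF s 0, of c]
  show "\<phi> x (as @ Arr z w d (scl A c u) # bs) = scl A c (\<phi> x (as @ Arr z w d u # bs))"
    by simp
qed (rule h)

lemma fam_b_fam: "fam 2 b_fam"
proof (rule famI)
  fix x as y assume s: "string A x as y"
  show "b_fam x as \<in> Hom A x y (sdeg as + 2)"
  proof (cases "as = []")
    case True
    then show ?thesis using Hom_0[OF s] by (simp add: b_fam_def)
  next
    case False
    then have "ops A as \<in> Hom A x y (sdeg as + 2)"
      using graded_multilinear_mem[OF ops_gm s] by (simp add: sdeg_eq Suc_le_eq algebra_simps)
    then show ?thesis using False string_obj[OF s] by (simp add: b_fam_def b_op_def Hom_sg)
  qed
next
  fix x as z w d u v c bs y
  assume s: "string A x (as @ Arr z w d u # bs) y" and v: "v \<in> Hom A z w d"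
  show "b_fam x (as @ Arr z w d (scl A c u + v) # bs) =
      scl A c (b_fam x (as @ Arr z w d u # bs)) + b_fam x (as @ Arr z w d v # bs)"
    using graded_multilinear_linear[OF ops_gm s v, of c]
    unfolding b_fam_def b_op_def susp_slot[of as z w d u] susp_slot[of as z w d v]
      susp_slot[of as z w d "scl A c u + v"] by (simp add: sg_add scale_sgA)
qed

lemma farr_b_fam:
  assumes "string A x q y" "q \<noteq> []"
  shows "farr 2 b_fam x q = b_arr A q"
  using assms string_src_hd[OF assms] string_tgt_last[OF assms] string_fin[OF assms(1)]
  by (simp add: farr_def b_arr_def b_fam_def)

text \<open>Inserting the empty string puts an arrow of value 0 into \<open>\<phi>\<close>, so the
  cuts with empty middle drop out and the sum over \<open>splits\<close> remains.\<close>

lemma gcomp_b_fam_right: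
  assumes \<phi>: "fam e \<phi>" and s: "string A x as y"
  shows "gcomp 2 \<phi> b_fam x as = (\<Sum>(p, q, t)\<in>splits as. sg (sdeg p) (\<phi> x (p @ b_arr A q # t)))"
proof -
  have "gcomp 2 \<phi> b_fam x as = (\<Sum>(p, q, t)\<in>splits as. sg (sdeg p) (\<phi> x (p @ farr 2 b_fam (fin x p) q # t)))"
    unfolding gcomp_def
  proof (rule sum.mono_neutral_cong_right)
    show "splits as \<subseteq> cuts3 as" by (auto simp: cuts3_splits)
    show "\<forall>i\<in>cuts3 as - splits as. (case i of (p, q, t) \<Rightarrow>
        sg ((2 - 1) * sdeg p) (\<phi> x (p @ farr 2 b_fam (fin x p) q # t))) = 0"
    proof (clarify)
      fix p q t assume "(p, q, t) \<in> cuts3 as" "(p, q, t) \<notin> splits as"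
      then have q: "q = []" and as: "as = p @ q @ t" by (auto simp: cuts3_def splits_def)
      have "string A x (p @ farr 2 b_fam (fin x p) q # t) y"
        using string_farr[OF fam_b_fam, of x p q t y] s as by simp
      then have "\<phi> x (p @ farr 2 b_fam (fin x p) q # t) = 0"
        by (rule fam_val_0[OF \<phi>, of _ _ _ "farr 2 b_fam (fin x p) q"]) (simp_all add: farr_def q b_fam_def)
      then show "sg ((2 - 1) * sdeg p) (\<phi> x (p @ farr 2 b_fam (fin x p) q # t)) = 0" by simp
    qed
  qed (auto simp: finite_cuts3)
  also have "\<dots> = (\<Sum>(p, q, t)\<in>splits as. sg (sdeg p) (\<phi> x (p @ b_arr A q # t)))"
  proof (intro sum.cong refl, clarify)
    fix p q t assume "(p, q, t) \<in> splits as"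
    then have "string A x (p @ q @ t) y" and q: "q \<noteq> []" using s by (auto simp: splits_def)
    then have "string A (fin x p) q (fin (fin x p) q)" unfolding string_append3 by blast
    from farr_b_fam[OF this q] show "sg (sdeg p) (\<phi> x (p @ farr 2 b_fam (fin x p) q # t)) =
        sg (sdeg p) (\<phi> x (p @ b_arr A q # t))" by simp
  qed
  finally show ?thesis .
qed

text \<open>These are the A-infinity relations of \<open>A\<close>; on the empty string the sum is
  empty.\<close>

lemma gcomp_b_fam_b_fam:
  assumes s: "string A x as y"
  shows "gcomp 2 b_fam b_fam x as = 0"
proof (cases "as = []")
  case True
  then have "splits as = {}" by (auto simp: splits_def)
  then show ?thesis unfolding gcomp_b_fam_right[OF fam_b_fam s] by simp
next
  case False
  then show ?thesis
    using ainf_rel[OF s False] unfolding gcomp_b_fam_right[OF fam_b_fam s] b_fam_def by simp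
qed

lemma gcomp_zero_left: "(\<And>y as. string A x as y \<Longrightarrow> \<phi> x as = 0) \<Longrightarrow> fam e \<psi> \<Longrightarrow> string A x as y \<Longrightarrow>
    gcomp e \<phi> \<psi> x as = 0" unfolding gcomp_def
proof (rule sum.neutral, clarify)
  fix p q t
  assume z: "\<And>y as. string A x as y \<Longrightarrow> \<phi> x as = 0" and \<psi>: "fam e \<psi>"
    and s: "string A x as y" and "(p, q, t) \<in> cuts3 as"
  then have "string A x (p @ q @ t) y" by (simp add: cuts3_def)
  from z[OF string_farr[OF \<psi> this]] show "sg ((e - 1) * sdeg p) (\<phi> x (p @ farr e \<psi> (fin x p) q # t)) = 0"
    by simp
qed

lemma gcomp_zero_right:
  assumes \<phi>: "fam e \<phi>" and \<psi>: "fam e' \<psi>" and z: "\<And>x as y. string A x as y \<Longrightarrow> \<psi> x as = 0"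
    and s: "string A x as y"
  shows "gcomp e' \<phi> \<psi> x as = 0" unfolding gcomp_def
proof (rule sum.neutral, clarify)
  fix p q t assume "(p, q, t) \<in> cuts3 as"
  then have st: "string A x (p @ q @ t) y" using s by (simp add: cuts3_def)
  then have "val (farr e' \<psi> (fin x p) q) = 0" using z unfolding string_append3 farr_def by auto
  then have "\<phi> x (p @ farr e' \<psi> (fin x p) q # t) = 0"
    by (intro fam_val_0[OF \<phi> string_farr[OF \<psi> st], of "farr e' \<psi> (fin x p) q"]) simp_all
  then show "sg ((e' - 1) * sdeg p) (\<phi> x (p @ farr e' \<psi> (fin x p) q # t)) = 0" by simp
qed

lemma gcomp_diff_left: "gcomp e (\<lambda>x as. \<phi> x as - sg n (\<phi>' x as)) \<psi> x as = gcomp e \<phi> \<psi> x as - sg n (gcomp e \<phi>' \<psi> x as)"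
proof -
  have "sg ((e - 1) * sdeg p) (X - sg n Y) = sg ((e - 1) * sdeg p) X - sg n (sg ((e - 1) * sdeg p) Y)"
    for p :: "('o, 'v) arr list" and X Y :: 'v by (simp add: sg_diff sg_sg add.commute)
  then show ?thesis by (simp add: gcomp_def case_prod_beta sg_sum sum_subtractf)
qed

lemma gcomp_diff_right:
  assumes \<phi>: "fam e \<phi>" and \<psi>: "fam e' \<psi>" and \<psi>': "fam e' \<psi>'" and s: "string A x as y"
  shows "gcomp e' \<phi> (\<lambda>x as. \<psi> x as - sg n (\<psi>' x as)) x as = gcomp e' \<phi> \<psi> x as - sg n (gcomp e' \<phi> \<psi>' x as)"
proof -
  have "\<phi> x (p @ farr e' (\<lambda>x as. \<psi> x as - sg n (\<psi>' x as)) (fin x p) q # t) =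
      \<phi> x (p @ farr e' \<psi> (fin x p) q # t) - sg n (\<phi> x (p @ farr e' \<psi>' (fin x p) q # t))"
    if "(p, q, t) \<in> cuts3 as" for p q t
  proof -
    have st: "string A x (p @ q @ t) y" using s that by (simp add: cuts3_def)
    let ?a = "Arr (fin x p) (fin (fin x p) q) (sdeg q + e')"
    have 1: "string A x (p @ ?a (\<psi> (fin x p) q) # t) y" and 2: "string A x (p @ ?a (\<psi>' (fin x p) q) # t) y"
      using string_farr[OF \<psi> st] string_farr[OF \<psi>' st] by (simp_all add: farr_def)
    have m: "scl A (if even n then - 1 else 1) X = - sg n X" for X by (simp add: sg_def)
    have "\<phi> x (p @ ?a (scl A (if even n then - 1 else 1) (\<psi>' (fin x p) q) + \<psi> (fin x p) q) # t) =
        scl A (if even n then - 1 else 1) (\<phi> x (p @ ?a (\<psi>' (fin x p) q) # t)) + \<phi> x (p @ ?a (\<psi> (fin x p) q) # t)"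
      using 1 by (intro fam_lin[OF \<phi> 2]) (simp add: string_slot)
    then show ?thesis unfolding m farr_def by simp
  qed
  then have "gcomp e' \<phi> (\<lambda>x as. \<psi> x as - sg n (\<psi>' x as)) x as =
     (\<Sum>(p, q, t)\<in>cuts3 as. sg ((e' - 1) * sdeg p) (\<phi> x (p @ farr e' \<psi> (fin x p) q # t))
        - sg n (sg ((e' - 1) * sdeg p) (\<phi> x (p @ farr e' \<psi>' (fin x p) q # t))))"
    unfolding gcomp_def by (intro sum.cong) (auto simp: sg_diff sg_sg add.commute)
  then show ?thesis by (simp add: gcomp_def case_prod_beta sg_sum sum_subtractf)
qed

text \<open>The graded commutator of \<open>b_fam\<close> with \<open>R\<close>; the sign comes from
  the shifted degrees 1 and \<open>d - 1\<close>.\<close>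

definition delta :: "int \<Rightarrow> ('o \<Rightarrow> ('o, 'v) arr list \<Rightarrow> 'v) \<Rightarrow> 'o \<Rightarrow> ('o, 'v) arr list \<Rightarrow> 'v" where
  "delta d R x as = gcomp d b_fam R x as - sg (d - 1) (gcomp 2 R b_fam x as)"

lemma fam_delta: "fam d R \<Longrightarrow> fam (d + 1) (delta d R)"
  using fam_diff[of "d + 1" "gcomp d b_fam R" "gcomp 2 R b_fam" "d - 1"] fam_gcomp[OF fam_b_fam, of d R] fam_gcomp[OF _ fam_b_fam, of d R]
  unfolding delta_def by (simp add: add.commute)

text \<open>The pre-Lie identity is applied to the triples (b, b, R), (b, R, b) and (R, b, b). The
  compositions of b with itself vanish, and the brace terms of the first two triples cancel in the
  commutator.\<close>

lemma delta_delta: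
  assumes R: "fam d R" and s: "string A x as y"
  shows "delta (d + 1) (delta d R) x as = 0"
proof -
  let ?b1 = "brace 2 d b_fam b_fam R x as" and ?b2 = "brace d 2 b_fam R b_fam x as"
  have bR: "fam (d + 1) (gcomp d b_fam R)" and Rb: "fam (d + 1) (gcomp 2 R b_fam)"
    using fam_gcomp[OF fam_b_fam R] fam_gcomp[OF R fam_b_fam] by (simp_all add: add.commute)
  have "gcomp d (gcomp 2 b_fam b_fam) R x as = 0"
    by (rule gcomp_zero_left[OF gcomp_b_fam_b_fam R s])
  then have 1: "gcomp (d + 1) b_fam (gcomp d b_fam R) x as = - ?b1 - sg (d - 1) ?b2"
    using gcomp_assoc[OF fam_b_fam fam_b_fam R s] by (simp add: add.commute eq_neg_iff_add_eq_0 algebra_simps)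
  have 2: "gcomp 2 (gcomp d b_fam R) b_fam x as = gcomp (d + 1) b_fam (gcomp 2 R b_fam) x as + ?b2 + sg (d - 1) ?b1"
    using gcomp_assoc[OF fam_b_fam R fam_b_fam s] by (simp add: add.commute)
  have "fam 3 (gcomp 2 b_fam b_fam)" using fam_gcomp[OF fam_b_fam fam_b_fam] by simp
  then have "gcomp 3 R (gcomp 2 b_fam b_fam) x as = 0"
    by (rule gcomp_zero_right[OF R _ gcomp_b_fam_b_fam s])
  \<comment> \<open>Both braces here are the same, with two copies of the odd operator b, so they
    cancel each other.\<close>
  then have 3: "gcomp 2 (gcomp 2 R b_fam) b_fam x as = 0"
    using gcomp_assoc[OF R fam_b_fam fam_b_fam s] by (simp add: sg_def)
  have D: "delta d R = (\<lambda>x as. gcomp d b_fam R x as - sg (d - 1) (gcomp 2 R b_fam x as))"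
    by (simp add: delta_def fun_eq_iff)
  have E: "delta (d + 1) (delta d R) x as = gcomp (d + 1) b_fam (delta d R) x as - sg d (gcomp 2 (delta d R) b_fam x as)"
    by (simp add: delta_def[of "d + 1"])
  show ?thesis unfolding E unfolding D gcomp_diff_right[OF fam_b_fam bR Rb s] gcomp_diff_left 1 2 3
    by (cases "even d") (simp_all add: sg_def)
qed

end

section \<open>The endomorphism complex of the identity functor\<close>

text \<open>A functor block uses up at least one letter; blocks for transformations may be empty,
  but their number is prescribed. This bound makes the set of decompositions finite.\<close>

lemma length_decomposition:
  "FBlock [] \<notin> set Ds \<Longrightarrow> length Ds \<le> length (concat (map body Ds)) + length (filter is_R Ds)"
proof (induction Ds)
  case (Cons D Ds)
  then show ?case
  proof (cases D)
    case (FBlock p)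
    then have "1 \<le> length p" using Cons.prems by (cases p) auto
    then show ?thesis using Cons FBlock by (auto simp: is_R_def)
  next
    case (RBlock p)
    then show ?thesis using Cons by (auto simp: is_R_def)
  qed
qed simp

lemma finite_decompositions: "finite (decompositions k as)"
proof (rule finite_subset)
  let ?S = "{q. set q \<subseteq> set as \<and> length q \<le> length as}"
  let ?T = "{Ds. set Ds \<subseteq> FBlock ` ?S \<union> RBlock ` ?S \<and> length Ds \<le> length as + k}"
  show "decompositions k as \<subseteq> ?T"
  proof
    fix Ds assume Ds: "Ds \<in> decompositions k as"
    have "set Ds \<subseteq> FBlock ` ?S \<union> RBlock ` ?S"
    proof
      fix D assume "D \<in> set Ds"
      then obtain D1 D2 where "Ds = D1 @ D # D2" by (meson split_list)
      then have "body D \<in> ?S" using Ds by (auto simp: decompositions_def)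
      then show "D \<in> FBlock ` ?S \<union> RBlock ` ?S" by (cases D) auto
    qed
    moreover have "length Ds \<le> length as + k"
      using Ds length_decomposition[of Ds] by (auto simp: decompositions_def)
    ultimately show "Ds \<in> ?T" by simp
  qed
  have "finite ?S" by (intro finite_lists_length_le) auto
  then show "finite ?T" by (intro finite_lists_length_le) auto
qed

lemma length_fill: "length (filter is_R Ds) = length \<rho>s \<Longrightarrow> length (fill f \<rho>s x Ds) = length Ds"
  by (induction f \<rho>s x Ds rule: fill.induct) (auto simp: is_R_def)

text \<open>The witnesses are chosen before \<open>r\<close>: the value in the slot occurs at
  exactly one place of the filled string and influences nothing else. Linearity in that slot rests
  on this.\<close>

lemma fill_slot:
  "length (filter is_R Ds) = length (\<rho>1 @ Arr i j d undefined # \<rho>2) \<Longrightarrow>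
    \<exists>L z p R. \<forall>r. fill f (\<rho>1 @ Arr i j d r # \<rho>2) x Ds = L @ R_arr (Arr i j d r) z p # R"
proof (induction Ds arbitrary: f \<rho>1 x)
  case (Cons D Ds)
  show ?case
  proof (cases D)
    case (FBlock p)
    then obtain L z q R where "\<forall>r. fill f (\<rho>1 @ Arr i j d r # \<rho>2) (fin x p) Ds = L @ R_arr (Arr i j d r) z q # R"
      using Cons.IH[of \<rho>1 f "fin x p"] Cons.prems by (auto simp: is_R_def)
    then have "\<forall>r. fill f (\<rho>1 @ Arr i j d r # \<rho>2) x (D # Ds) = (F_arr f p # L) @ R_arr (Arr i j d r) z q # R"
      by (simp add: FBlock)
    then show ?thesis by blast
  next
    case (RBlock p)
    show ?thesis
    proof (cases \<rho>1)
      case Nil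
      have "\<forall>r. fill f (\<rho>1 @ Arr i j d r # \<rho>2) x (D # Ds) = [] @ R_arr (Arr i j d r) x p # fill j \<rho>2 (fin x p) Ds"
        by (simp add: Nil RBlock)
      then show ?thesis by blast
    next
      case (Cons \<rho> \<rho>s)
      then obtain L z q R where
        "\<forall>r. fill (tgt \<rho>) (\<rho>s @ Arr i j d r # \<rho>2) (fin x p) Ds = L @ R_arr (Arr i j d r) z q # R"
        using Cons.IH[of \<rho>s "tgt \<rho>" "fin x p"] Cons.prems RBlock by (auto simp: is_R_def)
      then have "\<forall>r. fill f (\<rho>1 @ Arr i j d r # \<rho>2) x (D # Ds) =
          (R_arr \<rho> x p # L) @ R_arr (Arr i j d r) z q # R" by (simp add: Cons RBlock)
      then show ?thesis by blast
    qed
  qed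
qed simp

lemma fill_sign_slot: "fill_sign (\<rho>1 @ Arr i j d r # \<rho>2) e Ds = fill_sign (\<rho>1 @ Arr i j d r' # \<rho>2) e Ds"
proof (induction Ds arbitrary: \<rho>1 e)
  case (Cons D Ds)
  then show ?case
    using Cons.IH[of \<rho>1 "e + sdeg (body D)"] Cons.IH[of "tl \<rho>1" "e + sdeg (body D)"]
    by (cases D; cases \<rho>1) auto
qed simp

section \<open>The identity functor as an object of the functor category\<close>

context ainf_cat
begin

abbreviation IA :: "('o, 'v, 'o, 'v) afun" where "IA \<equiv> id_functor A"
abbreviation CA :: "(('o, 'v, 'o, 'v) afun, 'o \<Rightarrow> ('o, 'v) arr list \<Rightarrow> 'v, 'k) ainf" where
  "CA \<equiv> functor_category A A"

lemma fob_IA: "fob IA = (\<lambda>x\<in>Obj A. x)"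
  by (simp add: id_functor_def)

lemma fob_IA_Obj [simp]: "x \<in> Obj A \<Longrightarrow> fob IA x = x"
  by (simp add: fob_IA)

lemma fcomp_IA: "string A x as y \<Longrightarrow> fcomp IA as = (if length as = 1 then val (hd as) else 0)"
  by (cases as; cases "tl as") (auto simp: id_functor_def)

lemma F_arr_IA:
  assumes "string A x p y" "p \<noteq> []"
  shows "F_arr IA p = (if length p = 1 then hd p else Arr x y (sdeg p + 1) 0)"
proof -
  have o: "x \<in> Obj A" "y \<in> Obj A" using string_obj[OF assms(1)] by auto
  have st: "src (hd p) = x" "tgt (last p) = y"
    using string_src_hd[OF assms] string_tgt_last[OF assms] by auto
  show ?thesis
  proof (cases "length p = 1")
    case True
    then obtain a where "p = [a]" by (auto simp: length_Suc_conv)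
    then show ?thesis using o st fcomp_IA[OF assms(1)] by (cases a) (simp add: F_arr_def F_op_def)
  next
    case False
    then show ?thesis using o st fcomp_IA[OF assms(1)] by (simp add: F_arr_def F_op_def)
  qed
qed

lemma string_F_arr_IA: "string A x p y \<Longrightarrow> p \<noteq> [] \<Longrightarrow> string A x [F_arr IA p] y"
  using Hom_0[of x p y] string_obj[of A x p y] by (cases p; cases "tl p") (auto simp: F_arr_IA)

lemma b_op_val_0: "string A x as y \<Longrightarrow> a \<in> set as \<Longrightarrow> val a = 0 \<Longrightarrow> b_op A as = 0"
  using fam_val_0[OF fam_b_fam, of x as y a] by (auto simp: b_fam_def split: if_splits)

text \<open>Both sides are \<open>b_op A as\<close>: on the left only the merge of the whole string
  has length 1, and on the right only the cut into single arrows avoids the vanishing higher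
  components.\<close>

lemma id_functor_equation:
  assumes s: "string A x as y" and ne: "as \<noteq> []"
  shows "(\<Sum>(p, q, t)\<in>splits as. sg (sdeg p) (F_op IA (p @ b_arr A q # t)))
          = (\<Sum>qs\<in>{qs. concat qs = as \<and> [] \<notin> set qs}. b_op A (map (F_arr IA) qs))"
proof -
  have sb: "string A x (p @ b_arr A q # t) y" if "(p, q, t) \<in> splits as" for p q t
  proof -
    have "string A x (p @ q @ t) y" and q: "q \<noteq> []" using that s by (auto simp: splits_def)
    moreover from this have "string A (fin x p) q (fin (fin x p) q)" unfolding string_append3 by blast
    ultimately show ?thesis using string_farr[OF fam_b_fam, of x p q t y] farr_b_fam[OF _ q] by simp
  qed
  have "(\<Sum>(p, q, t)\<in>splits as. sg (sdeg p) (F_op IA (p @ b_arr A q # t))) =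
    (\<Sum>(p, q, t)\<in>{([], as, [])}. sg (sdeg p) (F_op IA (p @ b_arr A q # t)))"
  proof (rule sum.mono_neutral_right[OF finite_splits])
    show "{([], as, [])} \<subseteq> splits as" using ne by (simp add: splits_def)
    show "\<forall>i\<in>splits as - {([], as, [])}. (case i of (p, q, t) \<Rightarrow> sg (sdeg p) (F_op IA (p @ b_arr A q # t))) = 0"
    proof
      fix z assume z: "z \<in> splits as - {([], as, [])}"
      obtain p q t where pqt: "z = (p, q, t)" by (cases z)
      then have i: "(p, q, t) \<in> splits as" using z by simp
      have "length p + length t \<noteq> 0" using z pqt by (auto simp: splits_def)
      then show "(case z of (p, q, t) \<Rightarrow> sg (sdeg p) (F_op IA (p @ b_arr A q # t))) = 0"
        using fcomp_IA[OF sb[OF i]] by (auto simp: pqt F_op_def)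
    qed
  qed
  also have "\<dots> = b_op A as"
    using fcomp_IA[OF sb[of "[]" as "[]"]] ne by (simp add: splits_def F_op_def b_arr_def)
  also have "\<dots> = (\<Sum>qs\<in>{map (\<lambda>a. [a]) as}. b_op A (map (F_arr IA) qs))"
  proof -
    have "map (F_arr IA) (map (\<lambda>a. [a]) as) = as" unfolding map_map
    proof (rule map_idI)
      fix a assume "a \<in> set as"
      then obtain p t where "as = p @ [a] @ t" by (auto simp: in_set_conv_decomp)
      then have "string A (fin x p) [a] (fin (fin x p) [a])" using s unfolding string_append3[symmetric]
        by (metis string_append3)
      from F_arr_IA[OF this] show "(F_arr IA \<circ> (\<lambda>a. [a])) a = a" by simp
    qed
    then show ?thesis by simp
  qed
  also have "\<dots> = (\<Sum>qs\<in>{qs. concat qs = as \<and> [] \<notin> set qs}. b_op A (map (F_arr IA) qs))"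
  proof (rule sum.mono_neutral_left[OF finite_parts])
    show "{map (\<lambda>a. [a]) as} \<subseteq> {qs. concat qs = as \<and> [] \<notin> set qs}"
      by (auto simp: concat_map_singleton)
    show "\<forall>qs\<in>{qs. concat qs = as \<and> [] \<notin> set qs} - {map (\<lambda>a. [a]) as}. b_op A (map (F_arr IA) qs) = 0"
    proof
      fix qs assume "qs \<in> {qs. concat qs = as \<and> [] \<notin> set qs} - {map (\<lambda>a. [a]) as}"
      then have qs: "as = concat qs" "[] \<notin> set qs" and n: "qs \<noteq> map (\<lambda>a. [a]) (concat qs)" by auto
      have "\<exists>q\<in>set qs. length q \<noteq> 1"
      proof (rule ccontr)
        assume "\<not> ?thesis"
        then have "\<forall>q\<in>set qs. \<exists>a. q = [a]" by (auto simp: length_Suc_conv)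
        then have "qs = map (\<lambda>a. [a]) (concat qs)" by (induction qs) auto
        with n show False by simp
      qed
      then obtain q where q: "q \<in> set qs" "length q \<noteq> 1" by blast
      have str: "string A x (map (F_arr IA) rs) y" if "string A x (concat rs) y" "[] \<notin> set rs" for rs x
        using that
      proof (induction rs arbitrary: x)
        case (Cons r rs)
        then obtain z where z: "string A x r z" "string A z (concat rs) y" by (auto simp: string_append)
        have "string A x ([F_arr IA r] @ map (F_arr IA) rs) y"
          unfolding string_append using string_F_arr_IA[OF z(1)] Cons.IH[OF z(2)] Cons.prems by auto
        then show ?case by simp
      qed simp
      obtain ps ts where "qs = ps @ q # ts" using q(1) by (meson split_list)
      then have "string A x (concat ps @ q @ concat ts) y" using s qs by simp
      then have "string A (fin x (concat ps)) q (fin (fin x (concat ps)) q)"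
        unfolding string_append3 by blast
      moreover have "q \<noteq> []" using q qs(2) by auto
      ultimately have "val (F_arr IA q) = 0" using F_arr_IA q(2) by simp
      then show "b_op A (map (F_arr IA) qs) = 0"
        using str[of x qs] s qs q by (intro b_op_val_0[of x _ y "F_arr IA q"]) auto
    qed
  qed
  finally show ?thesis .
qed

lemma id_functor_functor: "ainf_functor A A IA"
proof -
  have ob: "fob IA \<in> Obj A \<rightarrow>\<^sub>E Obj A" by (auto simp: fob_IA)
  have no: "fcomp IA as = 0" if "as = [] \<or> (\<nexists>x y. string A x as y)" for as
    using that by (cases as; cases "tl as") (auto simp: id_functor_def)
  have gm: "graded_multilinear A A (fob IA) (fob IA) 1 1 (\<lambda>_. fcomp IA)"
  proof (rule graded_multilinearI)
    fix x as y assume s: "string A x as y" and "1 \<le> length as"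
    have o: "x \<in> Obj A" "y \<in> Obj A" using string_obj[OF s] by auto
    show "fcomp IA as \<in> Hom A (fob IA x) (fob IA y) ((\<Sum>a\<leftarrow>as. deg a) + 1 - int (length as))"
    proof (cases "length as = 1")
      case True
      then obtain a where "as = [a]" by (auto simp: length_Suc_conv)
      then show ?thesis using s o fcomp_IA[OF s] by auto
    next
      case False
      then show ?thesis using Hom_0[OF s] o by (simp add: fcomp_IA[OF s])
    qed
  next
    fix x as z w d u v c bs y
    assume s: "string A x (as @ Arr z w d u # bs) y" "v \<in> Hom A z w d"
    then have s': "string A x (as @ Arr z w d v # bs) y" by (simp add: string_slot)
    have "string A x (as @ Arr z w d (scl A c u + v) # bs) y"
      using s Hom_lin[of z w u d v c] string_obj unfolding string_slot by metis
    from fcomp_IA[OF this] fcomp_IA[OF s(1)] fcomp_IA[OF s']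
    show "fcomp IA (as @ Arr z w d (scl A c u + v) # bs) =
        scl A c (fcomp IA (as @ Arr z w d u # bs)) + fcomp IA (as @ Arr z w d v # bs)" by auto
  qed
  have un: "fcomp IA [unit_arr A x] = unt A (fob IA x)" if x: "x \<in> Obj A" for x
    using x fcomp_IA[of x "[unit_arr A x]" x] unt_Hom[OF x] by (simp add: unit_arr_def)
  have va: "fcomp IA as = 0" if "string A x as y" "2 \<le> length as" for x as y
    using fcomp_IA[OF that(1)] that(2) by simp
  show ?thesis unfolding ainf_functor_def by (intro conjI allI impI ballI; (elim conjE)?;
        (rule ob | (rule no; assumption) | rule gm | (rule id_functor_equation; assumption)
          | (rule un; assumption) | (rule va; assumption)))
qed

lemma functor_category_simps [simp]:
  "Obj CA = {f. ainf_functor A A f}" "Hom CA = transformations A A"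
  "scl CA = (\<lambda>c r x as. scl A c (r x as))" by (simp_all add: functor_category_def)

lemma unt_CA: "unt CA IA = (\<lambda>x as. if x \<in> Obj A \<and> as = [] then unt A x else 0)"
  by (auto simp: functor_category_def fun_eq_iff)

lemma ops_CA: "ops CA \<rho>s x as = (if \<exists>y. string A x as y
    then sg (susp \<rho>s) (sg (susp as) (bR_op A A \<rho>s x as)) else 0)"
  by (simp add: functor_category_def)

section \<open>Transformations and their shifted forms\<close>

abbreviation trans :: "int \<Rightarrow> ('o \<Rightarrow> ('o, 'v) arr list \<Rightarrow> 'v) set" where
  "trans \<equiv> transformations A A IA IA"

abbreviation twist :: "('o \<Rightarrow> ('o, 'v) arr list \<Rightarrow> 'v) \<Rightarrow> 'o \<Rightarrow> ('o, 'v) arr list \<Rightarrow> 'v" where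
  "twist r \<equiv> \<lambda>x as. sg (susp as) (r x as)"

text \<open>The sign is its own inverse; the case distinction restores the normalisation of
  transformations, which vanish off composable strings.\<close>

definition untwist :: "('o \<Rightarrow> ('o, 'v) arr list \<Rightarrow> 'v) \<Rightarrow> 'o \<Rightarrow> ('o, 'v) arr list \<Rightarrow> 'v" where
  "untwist \<phi> x as = (if \<exists>y. string A x as y then sg (susp as) (\<phi> x as) else 0)"

lemma susp_lin: "\<phi>1 = scl A c \<phi>2 + \<phi>3 \<Longrightarrow>
    sg (susp (as @ Arr z w d (u :: 'v) # bs)) \<phi>1 =
    scl A c (sg (susp (as @ Arr z w d v # bs)) \<phi>2) + sg (susp (as @ Arr z w d v' # bs)) \<phi>3"
  unfolding susp_slot[of as z w d u] susp_slot[of as z w d v] susp_slot[of as z w d v']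
  by (simp add: sg_add scale_sgA)

lemma trans_fam:
  assumes "r \<in> trans d"
  shows "fam d (twist r)"
proof -
  have gm: "graded_multilinear A A (fob IA) (fob IA) d 0 r"
    using assms by (simp add: transformations_def)
  show ?thesis
  proof (rule famI)
    fix x as y assume s: "string A x as y"
    then show "twist r x as \<in> Hom A x y (sdeg as + d)"
      using graded_multilinear_mem[OF gm s] string_obj[OF s]
      by (auto simp: sdeg_eq algebra_simps intro: Hom_sg)
  qed (intro susp_lin graded_multilinear_linear[OF gm], simp_all)
qed

lemma untwist_trans:
  assumes "fam d \<phi>"
  shows "untwist \<phi> \<in> trans d"
proof -
  have val: "untwist \<phi> x as = sg (susp as) (\<phi> x as)" if "string A x as y" for x as y
    using that by (auto simp: untwist_def)
  have "graded_multilinear A A (fob IA) (fob IA) d 0 (untwist \<phi>)"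
  proof (rule graded_multilinearI)
    fix x as y assume s: "string A x as y"
    then show "untwist \<phi> x as \<in> Hom A (fob IA x) (fob IA y) ((\<Sum>a\<leftarrow>as. deg a) + d - int (length as))"
      using fam_Hom[OF assms s] string_obj[OF s] val[OF s]
      by (auto simp: sdeg_eq algebra_simps intro: Hom_sg)
  next
    fix x as z w d' u v c bs y
    assume s: "string A x (as @ Arr z w d' u # bs) y" "v \<in> Hom A z w d'"
    then have s': "string A x (as @ Arr z w d' v # bs) y" by (simp add: string_slot)
    have s1: "string A x (as @ Arr z w d' (scl A c u + v) # bs) y"
      using s Hom_lin[of z w u d' v c] string_obj unfolding string_slot by metis
    from susp_lin[OF fam_lin[OF assms s]]
    show "untwist \<phi> x (as @ Arr z w d' (scl A c u + v) # bs) =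
        scl A c (untwist \<phi> x (as @ Arr z w d' u # bs)) + untwist \<phi> x (as @ Arr z w d' v # bs)"
      unfolding val[OF s(1)] val[OF s'] val[OF s1] .
  qed
  moreover have "untwist \<phi> x as = 0" if "\<nexists>y. string A x as y" for x as
    using that by (simp add: untwist_def)
  ultimately show ?thesis by (simp add: transformations_def)
qed

lemma vector_space_CA: "vector_space (scl CA)"
  by unfold_locales
    (auto simp: fun_eq_iff scale_right_distrib scale_left_distrib)

lemma trans_0_iff: "r \<in> trans d \<Longrightarrow> \<nexists>y. string A x as y \<Longrightarrow> r x as = 0"
  by (simp add: transformations_def)

lemma fam_zero: "fam e (\<lambda>_ _. 0)"
  using Hom_0 by (intro famI) auto

lemma subspace_trans: "module.subspace (scl CA) (trans d)"
proof -
  interpret C: vector_space "scl CA" by (rule vector_space_CA)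
  have lin: "(\<lambda>x as. scl A c (r x as) + r' x as) \<in> trans d" if r: "r \<in> trans d" "r' \<in> trans d" for c r r'
  proof -
    have "untwist (\<lambda>x as. scl A c (twist r x as) + twist r' x as) \<in> trans d"
      using r by (intro untwist_trans fam_lincomb trans_fam)
    also have "untwist (\<lambda>x as. scl A c (twist r x as) + twist r' x as) = (\<lambda>x as. scl A c (r x as) + r' x as)"
      using trans_0_iff[OF r(1)] trans_0_iff[OF r(2)]
      by (auto simp: untwist_def fun_eq_iff sg_add scale_sgA)
    finally show ?thesis .
  qed
  have "untwist (\<lambda>_ _. 0) \<in> trans d" by (rule untwist_trans[OF fam_zero])
  also have "untwist (\<lambda>_ _. 0) = 0" by (auto simp: untwist_def fun_eq_iff)
  finally have 0: "0 \<in> trans d" .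
  show ?thesis unfolding C.subspace_def
  proof (intro conjI ballI allI 0)
    fix r r' assume "r \<in> trans d" "r' \<in> trans d"
    from lin[OF this, of 1] show "r + r' \<in> trans d" by (simp add: plus_fun_def)
  next
    fix c r assume "r \<in> trans d"
    from lin[OF this 0, of c] show "scl CA c r \<in> trans d" by (simp add: zero_fun_def)
  qed
qed

end

section \<open>The differential on transformations of the identity functor\<close>

lemma string_append_fin: "string A x (p @ q) y \<longleftrightarrow> string A x p (fin x p) \<and> string A (fin x p) q y"
  by (metis string_append string_fin)

text \<open>The decompositions with one transformation that can contribute for the identity functor:
  every functor block is a single arrow.\<close>

definition singleton_dec :: "'a list \<Rightarrow> 'a list \<Rightarrow> 'a list \<Rightarrow> 'a block list" where
  "singleton_dec p q t = map (\<lambda>a. FBlock [a]) p @ RBlock q # map (\<lambda>a. FBlock [a]) t"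

lemma concat_body_singletons: "concat (map body (map (\<lambda>a. FBlock [a]) p)) = p"
  by (induction p) auto

lemma filter_R_singletons: "filter is_R (map (\<lambda>a. FBlock [a]) p) = []"
  by (induction p) (auto simp: is_R_def)

lemma singleton_dec_in: "(p, q, t) \<in> cuts3 as \<Longrightarrow> singleton_dec p q t \<in> decompositions 1 as"
  using concat_body_singletons[of p] concat_body_singletons[of t] filter_R_singletons[of p] filter_R_singletons[of t]
  by (auto simp: decompositions_def singleton_dec_def cuts3_def is_R_def)

lemma singletons_from_F:
  assumes "filter is_R Ds = []" "\<And>p. FBlock p \<in> set Ds \<Longrightarrow> length p = 1"
  shows "Ds = map (\<lambda>a. FBlock [a]) (concat (map body Ds))" using assms
proof (induction Ds)
  case (Cons D Ds)
  then obtain p where p: "D = FBlock p" by (cases D) (auto simp: is_R_def)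
  then have "length p = 1" using Cons.prems by auto
  then obtain a where "p = [a]" by (auto simp: length_Suc_conv)
  then show ?case using Cons p by (auto simp: is_R_def)
qed simp

lemma decomposition_1_cases:
  assumes Ds: "Ds \<in> decompositions 1 as" and f: "\<And>p. FBlock p \<in> set Ds \<Longrightarrow> length p = 1"
  shows "\<exists>p q t. Ds = singleton_dec p q t \<and> (p, q, t) \<in> cuts3 as"
proof -
  have "length (filter is_R Ds) = 1" using Ds by (simp add: decompositions_def)
  then obtain D where "filter is_R Ds = [D]" by (auto simp: length_Suc_conv)
  then obtain D1 D2 where "Ds = D1 @ D # D2" "\<forall>D\<in>set D1. \<not> is_R D" "is_R D" "[] = filter is_R D2"
    unfolding filter_eq_Cons_iff by blast
  then have D: "Ds = D1 @ D # D2" "filter is_R D1 = []" "filter is_R D2 = []" "is_R D"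
    by (simp_all add: filter_empty_conv)
  then obtain q where q: "D = RBlock q" by (cases D) (auto simp: is_R_def)
  have "D1 = map (\<lambda>a. FBlock [a]) (concat (map body D1))" "D2 = map (\<lambda>a. FBlock [a]) (concat (map body D2))"
    using D f by (auto intro!: singletons_from_F)
  then have "Ds = singleton_dec (concat (map body D1)) q (concat (map body D2))"
    using D q by (simp add: singleton_dec_def)
  moreover have "concat (map body D1) @ q @ concat (map body D2) = as"
    using Ds D q by (simp add: decompositions_def)
  ultimately show ?thesis unfolding cuts3_def by blast
qed

lemma takeWhile_singleton_dec: "takeWhile (\<lambda>D. \<not> is_R D) (singleton_dec p q t) = map (\<lambda>a. FBlock [a]) p"
  unfolding singleton_dec_def by (subst takeWhile_append2) (auto simp: is_R_def)

lemma inj_singleton_dec: "inj_on (\<lambda>(p, q, t). singleton_dec p q t) (cuts3 as)"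
proof (rule inj_onI)
  fix z z' assume m: "(case z of (p, q, t) \<Rightarrow> singleton_dec p q t) = (case z' of (p, q, t) \<Rightarrow> singleton_dec p q t)"
  obtain p q t p' q' t' where z: "z = (p, q, t)" "z' = (p', q', t')" by (cases z; cases z')
  then have e: "singleton_dec p q t = singleton_dec p' q' t'" using m by simp
  \<comment> \<open>The prefix is recovered as the functor blocks before the first transformation
    block, and then the rest can be compared entry by entry.\<close>
  have "map (\<lambda>a. FBlock [a]) p = map (\<lambda>a. FBlock [a]) p'"
    using takeWhile_singleton_dec[of p q t] takeWhile_singleton_dec[of p' q' t'] e by simp
  then have p: "p = p'" by (auto simp: inj_map_eq_map inj_def)
  with e have "RBlock q = RBlock q'" "map (\<lambda>a. FBlock [a]) t = map (\<lambda>a. FBlock [a]) t'"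
    by (auto simp: singleton_dec_def)
  then show "z = z'" using p z by (auto simp: inj_map_eq_map inj_def)
qed

lemma fill_sign_singleton_dec: "fill_sign [\<rho>] e (singleton_dec p q t) = (deg \<rho> - 1) * (e + sdeg p)"
proof -
  have 0: "fill_sign [] e (map (\<lambda>a. FBlock [a]) t) = 0" for e
    by (induction t arbitrary: e) auto
  show ?thesis unfolding singleton_dec_def
  proof (induction p arbitrary: e)
    case (Cons a p)
    show ?case using Cons.IH[of "e + (deg a - 1)"] by (simp add: algebra_simps)
  qed (simp add: 0)
qed

context ainf_cat
begin

definition tloops :: "(('o, 'v, 'o, 'v) afun, 'o \<Rightarrow> ('o, 'v) arr list \<Rightarrow> 'v) arr list \<Rightarrow> bool" where
  "tloops \<rho>s \<longleftrightarrow> (\<forall>\<rho>\<in>set \<rho>s. src \<rho> = IA \<and> tgt \<rho> = IA \<and> val \<rho> \<in> trans (deg \<rho>))"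

lemma tloops_simps [simp]: "tloops []" "tloops (\<rho> # \<rho>s) \<longleftrightarrow>
    src \<rho> = IA \<and> tgt \<rho> = IA \<and> val \<rho> \<in> trans (deg \<rho>) \<and> tloops \<rho>s"
  "tloops (\<rho>s @ \<rho>s') \<longleftrightarrow> tloops \<rho>s \<and> tloops \<rho>s'"
  by (auto simp: tloops_def)

lemma R_arr_IA:
  assumes "src \<rho> = IA" "tgt \<rho> = IA" "string A x p y"
  shows "R_arr \<rho> x p = farr (deg \<rho>) (twist (val \<rho>)) x p"
  using assms string_obj[OF assms(3)] string_fin[OF assms(3)]
  by (simp add: R_arr_def farr_def R_op_def)

lemma string_fill:
  assumes "tloops \<rho>s" "string A x (concat (map body Ds)) y" "FBlock [] \<notin> set Ds"
    "length (filter is_R Ds) = length \<rho>s"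
  shows "string A x (fill IA \<rho>s x Ds) y" using assms
proof (induction Ds arbitrary: \<rho>s x)
  case (Cons D Ds)
  obtain p where p: "body D = p" by simp
  have s: "string A x p (fin x p)" "string A (fin x p) (concat (map body Ds)) y"
    using Cons.prems(2) p by (simp_all add: string_append_fin)
  show ?case
  proof (cases D)
    case (FBlock q)
    then have q: "q = p" "p \<noteq> []" using p Cons.prems(3) by auto
    have "string A (fin x p) (fill IA \<rho>s (fin x p) Ds) y"
      using Cons.prems FBlock s(2) by (intro Cons.IH) (auto simp: is_R_def)
    with string_F_arr_IA[OF s(1) q(2)] have "string A x ([F_arr IA p] @ fill IA \<rho>s (fin x p) Ds) y"
      unfolding string_append by blast
    then show ?thesis by (simp add: FBlock q)
  next
    case (RBlock q)
    then have q: "q = p" using p by simp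
    obtain \<rho> \<rho>' where \<rho>: "\<rho>s = \<rho> # \<rho>'" using Cons.prems(4) RBlock by (cases \<rho>s) (auto simp: is_R_def)
    have "string A (fin x p) (fill IA \<rho>' (fin x p) Ds) y"
      using Cons.prems RBlock s(2) \<rho> by (intro Cons.IH) (auto simp: is_R_def)
    moreover have "fam (deg \<rho>) (twist (val \<rho>))" using Cons.prems(1) \<rho> by (auto intro: trans_fam)
    from fam_Hom[OF this s(1)] have "string A x [R_arr \<rho> x p] (fin x p)"
      using R_arr_IA[OF _ _ s(1), of \<rho>] Cons.prems(1) \<rho> string_obj[OF s(1)] by (simp add: farr_def)
    ultimately have "string A x ([R_arr \<rho> x p] @ fill IA \<rho>' (fin x p) Ds) y"
      unfolding string_append by blast
    then show ?thesis using Cons.prems(1) by (simp add: RBlock q \<rho>)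
  qed
qed simp

text \<open>The identity functor has no higher components, so a functor block of length at least 2
  puts an arrow of value 0 into the filled string.\<close>

lemma fill_long_F:
  assumes "tloops \<rho>s" "string A x (concat (map body Ds)) y" "length (filter is_R Ds) = length \<rho>s"
    "FBlock q \<in> set Ds" "2 \<le> length q"
  shows "\<exists>a\<in>set (fill IA \<rho>s x Ds). val a = 0" using assms
proof (induction Ds arbitrary: \<rho>s x)
  case (Cons D Ds)
  obtain p where p: "body D = p" by simp
  have s: "string A x p (fin x p)" "string A (fin x p) (concat (map body Ds)) y"
    using Cons.prems(2) p by (simp_all add: string_append_fin)
  show ?case
  proof (cases "D = FBlock q")
    case True
    then have "p = q" "q \<noteq> []" using p Cons.prems by auto
    then have "val (F_arr IA q) = 0" using F_arr_IA[of x q] s(1) Cons.prems(5) by auto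
    then show ?thesis by (simp add: True)
  next
    case False
    then have m: "FBlock q \<in> set Ds" using Cons.prems by auto
    show ?thesis
    proof (cases D)
      case (FBlock r)
      then have "\<exists>a\<in>set (fill IA \<rho>s (fin x p) Ds). val a = 0"
        using Cons.prems s(2) m by (intro Cons.IH) (auto simp: is_R_def)
      then show ?thesis using FBlock p by simp
    next
      case (RBlock r)
      obtain \<rho> \<rho>' where \<rho>: "\<rho>s = \<rho> # \<rho>'" using Cons.prems(3) RBlock by (cases \<rho>s) (auto simp: is_R_def)
      have "\<exists>a\<in>set (fill IA \<rho>' (fin x p) Ds). val a = 0"
        using Cons.prems s(2) m \<rho> RBlock by (intro Cons.IH) (auto simp: is_R_def)
      then show ?thesis using RBlock p \<rho> Cons.prems(1) by simp
    qed
  qed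
qed simp

lemma fill_singleton_dec:
  assumes \<rho>: "tloops [\<rho>]" and s: "string A x (p @ q @ t) y"
  shows "fill IA [\<rho>] x (singleton_dec p q t) = p @ farr (deg \<rho>) (twist (val \<rho>)) (fin x p) q # t"
proof -
  have F: "fill f \<rho>s x (map (\<lambda>a. FBlock [a]) p @ Ds) = p @ fill f \<rho>s (fin x p) Ds"
    if "string A x p y" "f = IA" for f \<rho>s x p Ds y using that
  proof (induction p arbitrary: x)
    case (Cons a p)
    then have "string A x [a] (tgt a)" using string_obj by fastforce
    from F_arr_IA[OF this] Cons show ?case by simp
  qed simp
  have st: "string A x p (fin x p)" "string A (fin x p) q (fin (fin x p) q)" "string A (fin (fin x p) q) t y"
    using s unfolding string_append3 by auto
  show ?thesis
    unfolding singleton_dec_def F[OF st(1) refl] using F[OF st(3), of _ "[]" "[]"] R_arr_IA[OF _ _ st(2), of \<rho>] \<rho>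
    by simp
qed

text \<open>Identifies the differential of the functor category with the commutator with b.
  Decompositions with a long functor block vanish, and the others correspond to cuts into three
  parts, the index set of \<open>gcomp\<close>.\<close>

lemma bR_op_single:
  assumes \<rho>: "tloops [\<rho>]" and s: "string A x as y"
  shows "bR_op A A [\<rho>] x as = delta (deg \<rho>) (twist (val \<rho>)) x as"
proof -
  let ?g = "\<lambda>Ds. sg (fill_sign [\<rho>] 0 Ds) (b_op A (fill IA [\<rho>] x Ds))"
  have fam: "fam (deg \<rho>) (twist (val \<rho>))" using \<rho> by (auto intro: trans_fam)
  have "(\<Sum>Ds\<in>decompositions 1 as. ?g Ds) = (\<Sum>Ds\<in>(\<lambda>(p, q, t). singleton_dec p q t) ` cuts3 as. ?g Ds)"
  proof (rule sum.mono_neutral_right[OF finite_decompositions])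
    show "(\<lambda>(p, q, t). singleton_dec p q t) ` cuts3 as \<subseteq> decompositions 1 as"
      using singleton_dec_in by fastforce
    show "\<forall>Ds\<in>decompositions 1 as - (\<lambda>(p, q, t). singleton_dec p q t) ` cuts3 as. ?g Ds = 0"
    proof
      fix Ds assume Ds: "Ds \<in> decompositions 1 as - (\<lambda>(p, q, t). singleton_dec p q t) ` cuts3 as"
      then have D: "concat (map body Ds) = as" "FBlock [] \<notin> set Ds" "length (filter is_R Ds) = length [\<rho>]"
        by (auto simp: decompositions_def)
      obtain q where q: "FBlock q \<in> set Ds" "length q \<noteq> 1"
        using decomposition_1_cases[of Ds as] Ds by force
      then have "2 \<le> length q" using D(2) by (cases q; cases "tl q") auto
      then obtain a where "a \<in> set (fill IA [\<rho>] x Ds)" "val a = 0"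
        using fill_long_F[OF \<rho> _ D(3) q(1)] s D(1) by blast
      then have "b_op A (fill IA [\<rho>] x Ds) = 0"
        using string_fill[OF \<rho> _ D(2,3)] s D(1) by (intro b_op_val_0) auto
      then show "?g Ds = 0" by simp
    qed
  qed
  also have "\<dots> = (\<Sum>(p, q, t)\<in>cuts3 as. ?g (singleton_dec p q t))"
    by (subst sum.reindex[OF inj_singleton_dec]) (simp add: case_prod_beta)
  also have "\<dots> = gcomp (deg \<rho>) b_fam (twist (val \<rho>)) x as" unfolding gcomp_def
  proof (intro sum.cong refl, clarify)
    fix p q t assume "(p, q, t) \<in> cuts3 as"
    then have "string A x (p @ q @ t) y" using s by (simp add: cuts3_def)
    from fill_singleton_dec[OF \<rho> this] show "?g (singleton_dec p q t) =
        sg ((deg \<rho> - 1) * sdeg p) (b_fam x (p @ farr (deg \<rho>) (twist (val \<rho>)) (fin x p) q # t))"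
      by (simp add: fill_sign_singleton_dec b_fam_def)
  qed
  finally have "(\<Sum>Ds\<in>decompositions 1 as. ?g Ds) = gcomp (deg \<rho>) b_fam (twist (val \<rho>)) x as" .
  moreover have "(\<Sum>(p, q, t)\<in>splits as. sg (sdeg p) (R_op \<rho> x (p @ b_arr A q # t))) = gcomp 2 (twist (val \<rho>)) b_fam x as"
    unfolding gcomp_b_fam_right[OF fam s] R_op_def ..
  ultimately show ?thesis using \<rho> by (simp add: bR_op_def delta_def)
qed

lemma ops_CA_single: "r \<in> trans d \<Longrightarrow> ops CA [Arr IA IA d r] = untwist (delta d (twist r))"
proof (intro ext)
  fix x as assume r: "r \<in> trans d"
  show "ops CA [Arr IA IA d r] x as = untwist (delta d (twist r)) x as"
    using bR_op_single[of "Arr IA IA d r" x as] r by (auto simp: ops_CA untwist_def)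
qed

lemma ops_CA_closed: "r \<in> trans d \<Longrightarrow> ops CA [Arr IA IA d r] \<in> trans (d + 1)"
  by (simp add: ops_CA_single untwist_trans fam_delta trans_fam)

text \<open>Twisting the result of \<open>untwist\<close> gives back the family only on composable
  strings. This congruence allows \<open>delta\<close> to be iterated nevertheless.\<close>

lemma delta_cong:
  assumes "string A x as y" "\<And>x as y. string A x as y \<Longrightarrow> R x as = R' x as" "fam d R"
  shows "delta d R x as = delta d R' x as"
proof -
  have "gcomp d b_fam R x as = gcomp d b_fam R' x as"
    by (rule gcomp_cong[OF assms(1)]) (use assms in auto)
  moreover have "gcomp 2 R b_fam x as = gcomp 2 R' b_fam x as"
    by (rule gcomp_cong[OF assms(1)]) (use assms fam_b_fam in auto)
  ultimately show ?thesis by (simp add: delta_def)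
qed

lemma ops_CA_ops:
  assumes r: "r \<in> trans d"
  shows "ops CA [Arr IA IA (d + 1) (ops CA [Arr IA IA d r])] = 0"
proof (intro ext)
  fix x as
  let ?r = "ops CA [Arr IA IA d r]"
  have r': "?r \<in> trans (d + 1)" by (rule ops_CA_closed[OF r])
  have twist: "twist ?r x as = delta d (twist r) x as" if "string A x as y" for x as y
    using that by (auto simp: ops_CA_single[OF r] untwist_def)
  have "delta (d + 1) (twist ?r) x as = 0" if s: "string A x as y" for y
    using delta_cong[OF s twist trans_fam[OF r']] delta_delta[OF trans_fam[OF r] s] by simp
  then show "ops CA [Arr IA IA (d + 1) ?r] x as = 0 x as"
    by (auto simp: ops_CA_single[OF r'] untwist_def)
qed

text \<open>Each decomposition puts the slot into one entry of the filled string, so linearity of b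
  there is enough. The correction term, present only for a single transformation, is linear by
  inspection.\<close>

lemma bR_op_linear:
  assumes l: "tloops (\<rho>1 @ Arr IA IA d u # \<rho>2)" and v: "v \<in> trans d" and s: "string A x as y"
  shows "bR_op A A (\<rho>1 @ Arr IA IA d (scl CA c u + v) # \<rho>2) x as =
    scl A c (bR_op A A (\<rho>1 @ Arr IA IA d u # \<rho>2) x as) + bR_op A A (\<rho>1 @ Arr IA IA d v # \<rho>2) x as"
proof -
  let ?\<rho> = "\<lambda>r. \<rho>1 @ Arr IA IA d r # \<rho>2"
  let ?w = "scl CA c u + v"
  let ?k = "length (?\<rho> u)"
  have src: "src (hd (?\<rho> r)) = IA" for r using l by (cases \<rho>1) auto
  have lv: "tloops (?\<rho> v)" using l v by simp
  have R: "R_op (Arr IA IA d ?w) z q = scl A c (R_op (Arr IA IA d u) z q) + R_op (Arr IA IA d v) z q" for z q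
    by (simp add: R_op_def sg_add scale_sgA)
  let ?g = "\<lambda>r Ds. sg (fill_sign (?\<rho> r) 0 Ds) (b_op A (fill IA (?\<rho> r) x Ds))"
  have "?g ?w Ds = scl A c (?g u Ds) + ?g v Ds" if Ds: "Ds \<in> decompositions ?k as" for Ds
  proof -
    have D: "concat (map body Ds) = as" "FBlock [] \<notin> set Ds" "length (filter is_R Ds) = ?k"
      using Ds by (auto simp: decompositions_def)
    obtain L z p K where f: "\<And>r. fill IA (?\<rho> r) x Ds = L @ R_arr (Arr IA IA d r) z p # K"
      using fill_slot[of Ds \<rho>1 IA IA d \<rho>2 IA x] D(3) by auto
    let ?a = "Arr (fob IA z) (fob IA (fin z p)) (sdeg p + d)"
    have Ra: "R_arr (Arr IA IA d r) z p = ?a (R_op (Arr IA IA d r) z p)" for r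
      by (simp add: R_arr_def)
    have su: "string A x (L @ ?a (R_op (Arr IA IA d u) z p) # K) y"
      using string_fill[OF l, of x Ds y] D s f[of u] Ra[of u] by simp
    have "string A x (L @ ?a (R_op (Arr IA IA d v) z p) # K) y"
      using string_fill[OF lv, of x Ds y] D s f[of v] Ra[of v] by simp
    then have "R_op (Arr IA IA d v) z p \<in> Hom A (fob IA z) (fob IA (fin z p)) (sdeg p + d)"
      by (simp add: string_slot)
    from fam_lin[OF fam_b_fam su this, of c]
    have "b_op A (fill IA (?\<rho> ?w) x Ds) = scl A c (b_op A (fill IA (?\<rho> u) x Ds)) + b_op A (fill IA (?\<rho> v) x Ds)"
      by (simp add: f Ra R[unfolded functor_category_simps] b_fam_def)
    moreover have "fill_sign (?\<rho> ?w) 0 Ds = fill_sign (?\<rho> u) 0 Ds" "fill_sign (?\<rho> v) 0 Ds = fill_sign (?\<rho> u) 0 Ds"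
      by (rule fill_sign_slot)+
    ultimately show ?thesis by (simp add: sg_add scale_sgA)
  qed
  then have 1: "(\<Sum>Ds\<in>decompositions ?k as. ?g ?w Ds) =
      scl A c (\<Sum>Ds\<in>decompositions ?k as. ?g u Ds) + (\<Sum>Ds\<in>decompositions ?k as. ?g v Ds)"
    by (simp add: scale_sum_right sum.distrib)
  let ?h = "\<lambda>r. case ?\<rho> r of [\<rho>] \<Rightarrow> sg (deg \<rho> - 1) (\<Sum>(p, q, t)\<in>splits as. sg (sdeg p) (R_op \<rho> x (p @ b_arr A q # t)))
      | _ \<Rightarrow> 0"
  have 2: "?h ?w = scl A c (?h u) + ?h v"
  proof (cases "\<rho>1 = [] \<and> \<rho>2 = []")
    case True
    then show ?thesis
      by (simp add: R[unfolded functor_category_simps] sg_add scale_sgA case_prod_beta sum.distrib scale_sum_right)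
  next
    case False
    then have "?h r = 0" for r by (cases \<rho>1; cases \<rho>2) (auto split: list.splits)
    then show ?thesis by simp
  qed
  have e: "bR_op A A (?\<rho> r) x as = (\<Sum>Ds\<in>decompositions ?k as. ?g r Ds) - ?h r" for r
    unfolding bR_op_def src by simp
  show ?thesis unfolding e 1 2 by (simp add: scale_right_diff_distrib)
qed

lemma ops_CA_linear:
  assumes l: "tloops (\<rho>1 @ Arr IA IA d u # \<rho>2)" and v: "v \<in> trans d"
  shows "ops CA (\<rho>1 @ Arr IA IA d (scl CA c u + v) # \<rho>2) =
    scl CA c (ops CA (\<rho>1 @ Arr IA IA d u # \<rho>2)) + ops CA (\<rho>1 @ Arr IA IA d v # \<rho>2)"
proof (intro ext)
  fix x as
  show "ops CA (\<rho>1 @ Arr IA IA d (scl CA c u + v) # \<rho>2) x as =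
    (scl CA c (ops CA (\<rho>1 @ Arr IA IA d u # \<rho>2)) + ops CA (\<rho>1 @ Arr IA IA d v # \<rho>2)) x as"
  proof (cases "\<exists>y. string A x as y")
    case True
    then obtain y where s: "string A x as y" by blast
    show ?thesis using True bR_op_linear[OF l v s, of c]
        susp_slot[of \<rho>1 IA IA d u \<rho>2] susp_slot[of \<rho>1 IA IA d v \<rho>2] susp_slot[of \<rho>1 IA IA d "scl CA c u + v" \<rho>2]
      by (simp add: ops_CA sg_add scale_sgA)
  next
    case False
    then have "ops CA \<rho>s x as = 0" for \<rho>s by (auto simp: ops_CA)
    then show ?thesis by simp
  qed
qed

end

section \<open>The unit transformation\<close>

context ainf_cat
begin

abbreviation unit_trans :: "'o \<Rightarrow> ('o, 'v) arr list \<Rightarrow> 'v" where "unit_trans \<equiv> unt CA IA"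

definition unit_fam :: "'o \<Rightarrow> ('o, 'v) arr list \<Rightarrow> 'v" where
  "unit_fam x as = (if as = [] then unt A x else 0)"

lemma fam_unit_fam: "fam 0 unit_fam"
proof (rule famI)
  fix x as y assume s: "string A x as y"
  then show "unit_fam x as \<in> Hom A x y (sdeg as + 0)"
    using Hom_0[OF s] unt_Hom by (cases "as = []") (auto simp: unit_fam_def)
qed (simp add: unit_fam_def)

lemma unt_untwist: "unit_trans = untwist unit_fam"
  by (auto simp: unt_CA untwist_def unit_fam_def fun_eq_iff)

lemma unt_trans: "unit_trans \<in> trans 0"
  unfolding unt_untwist by (rule untwist_trans[OF fam_unit_fam])

lemma R_arr_unit: "R_arr (unit_arr CA IA) z p =
    (if z \<in> Obj A \<and> p = [] then unit_arr A z else Arr (fob IA z) (fob IA (fin z p)) (sdeg p) 0)"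
  by (simp add: R_arr_def R_op_def unit_arr_def unt_CA)

text \<open>On an empty block the unit transformation yields a unit of \<open>A\<close>, which kills
  b on three or more entries; on a nonempty block it yields 0.\<close>

lemma b_op_unit_fill:
  assumes l: "tloops (\<rho>1 @ unit_arr CA IA # \<rho>2)" and s: "string A x as y"
    and Ds: "Ds \<in> decompositions (length (\<rho>1 @ unit_arr CA IA # \<rho>2)) as" and len: "3 \<le> length Ds"
  shows "b_op A (fill IA (\<rho>1 @ unit_arr CA IA # \<rho>2) x Ds) = 0"
proof -
  let ?\<rho>s = "\<rho>1 @ unit_arr CA IA # \<rho>2" let ?f = "fill IA ?\<rho>s x Ds"
  have D: "concat (map body Ds) = as" "FBlock [] \<notin> set Ds" "length (filter is_R Ds) = length ?\<rho>s"
    using Ds by (auto simp: decompositions_def)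
  have sf: "string A x ?f y" using string_fill[OF l _ D(2,3)] s D(1) by simp
  obtain L z p K where "?f = L @ R_arr (unit_arr CA IA) z p # K"
    using fill_slot[of Ds \<rho>1 IA IA 0 \<rho>2 IA x] D(3) by (auto simp: unit_arr_def)
  then have m: "R_arr (unit_arr CA IA) z p \<in> set ?f" by simp
  show ?thesis
  proof (cases "z \<in> Obj A \<and> p = []")
    case True
    then have "unit_arr A z \<in> set ?f" using m by (simp add: R_arr_unit)
    then have "ops A ?f = 0" using ops3_unit[OF sf] length_fill[OF D(3)] len by simp
    then show ?thesis by (simp add: b_op_def)
  next
    case False
    have "val (R_arr (unit_arr CA IA) z p) = 0" unfolding R_arr_unit if_not_P[OF False] by simp
    then show ?thesis by (rule b_op_val_0[OF sf m])
  qed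
qed

lemma ops_CA_unit_ge3:
  assumes l: "tloops \<rho>s" and len: "3 \<le> length \<rho>s" and u: "unit_arr CA IA \<in> set \<rho>s"
  shows "ops CA \<rho>s = 0"
proof (intro ext)
  fix x as
  obtain \<rho>1 \<rho>2 where \<rho>: "\<rho>s = \<rho>1 @ unit_arr CA IA # \<rho>2" using u by (meson split_list)
  have src: "src (hd \<rho>s) = IA" using l len by (cases \<rho>s) auto
  have "bR_op A A \<rho>s x as = 0" if s: "string A x as y" for y
  proof -
    have "b_op A (fill IA \<rho>s x Ds) = 0" if Ds: "Ds \<in> decompositions (length \<rho>s) as" for Ds
    proof -
      have "length \<rho>s \<le> length Ds"
        using Ds by (metis (mono_tags, lifting) decompositions_def length_filter_le mem_Collect_eq)
      then show ?thesis using b_op_unit_fill[OF l[unfolded \<rho>] s] Ds len unfolding \<rho> by simp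
    qed
    moreover obtain a b r where "\<rho>s = a # b # r" using len by (cases \<rho>s; cases "tl \<rho>s") auto
    ultimately show ?thesis using src by (simp add: bR_op_def)
  qed
  then show "ops CA \<rho>s x as = 0 x as" by (auto simp: ops_CA)
qed

lemma decompositions_2_short:
  assumes "Ds \<in> decompositions 2 as" "\<not> 3 \<le> length Ds"
  shows "\<exists>p q. Ds = [RBlock p, RBlock q] \<and> p @ q = as"
proof -
  have D: "concat (map body Ds) = as" "length (filter is_R Ds) = 2"
    using assms(1) by (auto simp: decompositions_def)
  then have "length Ds = 2" using assms(2) length_filter_le[of is_R Ds] by linarith
  then obtain a b where ab: "Ds = [a, b]" by (auto simp: length_Suc_conv numeral_2_eq_2)
  then have "is_R a" "is_R b" using D(2) by (auto split: if_splits)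
  then obtain p q where "a = RBlock p" "b = RBlock q" by (cases a; cases b) (auto simp: is_R_def)
  then show ?thesis using ab D(1) by simp
qed

text \<open>Tailored to the case where one argument is the unit: only the decomposition that gives
  the unit the empty block survives.\<close>

lemma bR_op_two:
  assumes l: "tloops [\<rho>, \<rho>']" and s: "string A x as y" and pq: "p @ q = as"
    and z: "\<And>Ds. Ds \<in> decompositions 2 as \<Longrightarrow> 3 \<le> length Ds \<Longrightarrow> b_op A (fill IA [\<rho>, \<rho>'] x Ds) = 0"
    and z': "\<And>p' q'. p' @ q' = as \<Longrightarrow> p' \<noteq> p \<Longrightarrow>
      b_op A [R_arr \<rho> x p', R_arr \<rho>' (fin x p') q'] = 0"
  shows "bR_op A A [\<rho>, \<rho>'] x as = sg ((deg \<rho>' - 1) * sdeg p) (b_op A [R_arr \<rho> x p, R_arr \<rho>' (fin x p) q])"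
proof -
  let ?g = "\<lambda>Ds. sg (fill_sign [\<rho>, \<rho>'] 0 Ds) (b_op A (fill IA [\<rho>, \<rho>'] x Ds))"
  have "(\<Sum>Ds\<in>decompositions 2 as. ?g Ds) = (\<Sum>Ds\<in>{[RBlock p, RBlock q]}. ?g Ds)"
  proof (rule sum.mono_neutral_right[OF finite_decompositions])
    show "{[RBlock p, RBlock q]} \<subseteq> decompositions 2 as"
      using pq by (simp add: decompositions_def is_R_def)
    show "\<forall>Ds\<in>decompositions 2 as - {[RBlock p, RBlock q]}. ?g Ds = 0"
    proof
      fix Ds assume Ds: "Ds \<in> decompositions 2 as - {[RBlock p, RBlock q]}"
      show "?g Ds = 0"
      proof (cases "3 \<le> length Ds")
        case True
        then show ?thesis using z Ds by simp
      next
        case False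
        then obtain p' q' where p: "Ds = [RBlock p', RBlock q']" "p' @ q' = as"
          using decompositions_2_short Ds by blast
        then have "p' \<noteq> p" using Ds pq by auto
        from z'[OF p(2) this] show ?thesis using l p(1) by simp
      qed
    qed
  qed
  then show ?thesis using l by (simp add: bR_op_def numeral_2_eq_2)
qed

lemma farr_twist_Arr:
  assumes "r \<in> trans d" "string A x as y"
  shows "farr d (twist r) x as = Arr x y (sdeg as + d) (twist r x as)" "twist r x as \<in> Hom A x y (sdeg as + d)"
  using fam_Hom[OF trans_fam[OF assms(1)] assms(2)] string_fin[OF assms(2)] by (simp_all add: farr_def)

lemma ops_CA_unit_left:
  assumes r: "r \<in> trans d"
  shows "ops CA [unit_arr CA IA, Arr IA IA d r] = r"
proof (intro ext)
  fix x as
  let ?U = "unit_arr CA IA" and ?\<rho> = "Arr IA IA d r"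
  have l: "tloops [?U, ?\<rho>]" using r unt_trans by (simp add: unit_arr_def)
  show "ops CA [?U, ?\<rho>] x as = r x as"
  proof (cases "\<exists>y. string A x as y")
    case True
    then obtain y where s: "string A x as y" by blast
    have o: "x \<in> Obj A" "y \<in> Obj A" using string_obj[OF s] by auto
    have "bR_op A A [?U, ?\<rho>] x as = sg ((deg ?\<rho> - 1) * sdeg ([] :: ('o, 'v) arr list))
        (b_op A [R_arr ?U x [], R_arr ?\<rho> (fin x ([] :: ('o, 'v) arr list)) as])"
    proof (rule bR_op_two[OF l s])
      show "b_op A (fill IA [?U, ?\<rho>] x Ds) = 0" if "Ds \<in> decompositions 2 as" "3 \<le> length Ds" for Ds
        using b_op_unit_fill[of "[]" "[?\<rho>]" x as y Ds] l s that by (simp add: numeral_2_eq_2)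
      show "b_op A [R_arr ?U x p', R_arr ?\<rho> (fin x p') q'] = 0" if "p' @ q' = as" "p' \<noteq> []" for p' q'
      proof -
        have "string A x (fill IA [?U, ?\<rho>] x [RBlock p', RBlock q']) y"
          using s that by (intro string_fill[OF l]) (auto simp: is_R_def)
        moreover have "fill IA [?U, ?\<rho>] x [RBlock p', RBlock q'] = [R_arr ?U x p', R_arr ?\<rho> (fin x p') q']"
          by (simp add: unit_arr_def)
        ultimately have "string A x [R_arr ?U x p', R_arr ?\<rho> (fin x p') q'] y" by (simp only:)
        then show ?thesis
          by (rule b_op_val_0[of _ _ _ "R_arr ?U x p'"]) (use that in \<open>auto simp: R_arr_unit\<close>)
      qed
    qed simp
    also have "\<dots> = b_op A [unit_arr A x, Arr x y (sdeg as + d) (twist r x as)]"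
      using o R_arr_IA[OF _ _ s, of ?\<rho>] farr_twist_Arr[OF r s] by (simp add: R_arr_unit)
    also have "\<dots> = - twist r x as"
      using ops2_unit_left[OF o farr_twist_Arr(2)[OF r s]] by (simp add: b_op_def unit_arr_def sg_def)
    finally have "bR_op A A [?U, ?\<rho>] x as = - twist r x as" .
    \<comment> \<open>Desuspending the two transformations produces the same sign as desuspending
      the two arrows in \<open>A\<close>, so the signs cancel.\<close>
    moreover have "susp [?U, ?\<rho>] = - 1" by (simp add: unit_arr_def)
    ultimately show ?thesis using True by (simp add: ops_CA) (simp add: sg_def)
  next
    case False
    then show ?thesis using trans_0_iff[OF r False] by (auto simp: ops_CA)
  qed
qed

lemma ops_CA_unit_right:
  assumes r: "r \<in> trans d"
  shows "ops CA [Arr IA IA d r, unit_arr CA IA] = r"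
proof (intro ext)
  fix x as
  let ?U = "unit_arr CA IA" and ?\<rho> = "Arr IA IA d r"
  have l: "tloops [?\<rho>, ?U]" using r unt_trans by (simp add: unit_arr_def)
  have dU: "deg ?U = 0" by (simp add: unit_arr_def)
  show "ops CA [?\<rho>, ?U] x as = r x as"
  proof (cases "\<exists>y. string A x as y")
    case True
    then obtain y where s: "string A x as y" by blast
    have o: "x \<in> Obj A" "y \<in> Obj A" using string_obj[OF s] by auto
    have "bR_op A A [?\<rho>, ?U] x as = sg ((deg ?U - 1) * sdeg as)
        (b_op A [R_arr ?\<rho> x as, R_arr ?U (fin x as) []])"
    proof (rule bR_op_two[OF l s])
      show "b_op A (fill IA [?\<rho>, ?U] x Ds) = 0" if "Ds \<in> decompositions 2 as" "3 \<le> length Ds" for Ds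
        using b_op_unit_fill[of "[?\<rho>]" "[]" x as y Ds] l s that by (simp add: numeral_2_eq_2)
      show "b_op A [R_arr ?\<rho> x p', R_arr ?U (fin x p') q'] = 0" if "p' @ q' = as" "p' \<noteq> as" for p' q'
      proof -
        have "string A x (fill IA [?\<rho>, ?U] x [RBlock p', RBlock q']) y"
          using s that by (intro string_fill[OF l]) (auto simp: is_R_def)
        moreover have "fill IA [?\<rho>, ?U] x [RBlock p', RBlock q'] = [R_arr ?\<rho> x p', R_arr ?U (fin x p') q']"
          by (simp add: unit_arr_def)
        ultimately have "string A x [R_arr ?\<rho> x p', R_arr ?U (fin x p') q'] y" by (simp only:)
        then show ?thesis
          by (rule b_op_val_0[of _ _ _ "R_arr ?U (fin x p') q'"]) (use that in \<open>auto simp: R_arr_unit\<close>)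
      qed
    qed simp
    also have "\<dots> = sg (- sdeg as) (b_op A [Arr x y (sdeg as + d) (twist r x as), unit_arr A y])"
      using o R_arr_IA[OF _ _ s, of ?\<rho>] farr_twist_Arr[OF r s] string_fin[OF s] by (simp add: R_arr_unit dU)
    also have "\<dots> = sg (- sdeg as) (sg (sdeg as + d - 1) (twist r x as))"
      using ops2_unit_right[OF o farr_twist_Arr(2)[OF r s]] by (simp add: b_op_def unit_arr_def)
    \<comment> \<open>The Koszul sign for moving the unit past \<open>as\<close> cancels the
      dependence on \<open>sdeg as\<close>; what is left equals the desuspension sign of the pair of
      transformations.\<close>
    also have "\<dots> = sg (d - 1) (twist r x as)" by (simp add: sg_sg algebra_simps)
    finally have "bR_op A A [?\<rho>, ?U] x as = sg (d - 1) (twist r x as)" .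
    moreover have "susp [?\<rho>, ?U] = d - 1" by simp
    ultimately show ?thesis using True by (simp add: ops_CA) (simp add: sg_def)
  next
    case False
    then show ?thesis using trans_0_iff[OF r False] by (auto simp: ops_CA)
  qed
qed

text \<open>For the empty string this is \<open>m\<^sub>1\<close> of a unit; for one arrow the left
  and right unit insertions cancel; for longer strings the unit sits among at least three
  arguments.\<close>

lemma gcomp_b_fam_unit_fam:
  assumes s: "string A x as y"
  shows "gcomp 0 b_fam unit_fam x as = 0"
proof -
  have z: "b_fam x (p @ farr 0 unit_fam (fin x p) q # t) = 0"
    if "p @ q @ t = as" "q \<noteq> [] \<or> 2 \<le> length as" for p q t
  proof -
    have st: "string A x (p @ farr 0 unit_fam (fin x p) q # t) y"
      using string_farr[OF fam_unit_fam, of x p q t y] s that by simp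
    show ?thesis
    proof (cases "q = []")
      case True
      then have "farr 0 unit_fam (fin x p) q = unit_arr A (fin x p)"
        by (simp add: farr_def unit_fam_def unit_arr_def)
      moreover have "3 \<le> length (p @ farr 0 unit_fam (fin x p) q # t)" using that True by auto
      ultimately have "ops A (p @ farr 0 unit_fam (fin x p) q # t) = 0"
        using ops3_unit[OF st, of "fin x p"] by simp
      then show ?thesis by (simp add: b_fam_def b_op_def)
    next
      case False
      then show ?thesis
        by (intro fam_val_0[OF fam_b_fam st, of "farr 0 unit_fam (fin x p) q"]) (auto simp: farr_def unit_fam_def)
    qed
  qed
  consider "as = []" | a where "as = [a]" | "2 \<le> length as" by (cases as; cases "tl as") auto
  then show ?thesis
  proof cases
    case 1
    then have "cuts3 as = {([], [], [])}" by (auto simp: cuts3_def)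
    then show ?thesis
      using 1 string_obj[OF s] ops1_unit[of x] by (simp add: gcomp_def b_fam_def b_op_def farr_def unit_fam_def unit_arr_def)
  next
    case (2 a)
    have "cuts3 [a] = {([], [], [a]), ([], [a], []), ([a], [], [])}"
      by (auto simp: cuts3_def Cons_eq_append_conv append_eq_Cons_conv)
    moreover have "b_fam x ([] @ farr 0 unit_fam (fin x []) [a] # []) = 0" using z[of "[]" "[a]" "[]"] 2 by simp
    moreover obtain w d v where a: "a = Arr x w d v" using s 2 by (cases a) auto
    have o: "x \<in> Obj A" "w \<in> Obj A" "v \<in> Hom A x w d" using s 2 a by auto
    ultimately have "gcomp 0 b_fam unit_fam x as = b_op A [unit_arr A x, a] + sg (1 - d) (b_op A [a, unit_arr A w])"
      using 2 a by (simp add: gcomp_def b_fam_def farr_def unit_fam_def unit_arr_def)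
    then show ?thesis using ops2_unit_left[OF o] ops2_unit_right[OF o] a
      by (simp add: b_op_def unit_arr_def sg_sg) (simp add: sg_def)
  next
    case 3
    then show ?thesis unfolding gcomp_def using z by (intro sum.neutral) (auto simp: cuts3_def)
  qed
qed

lemma ops_CA_unit: "ops CA [unit_arr CA IA] = 0"
proof -
  have twist: "twist unit_trans x as = unit_fam x as" if "string A x as y" for x as y
    using that by (auto simp: unt_untwist untwist_def)
  have "delta 0 (twist unit_trans) x as = 0" if s: "string A x as y" for x as y
  proof -
    \<comment> \<open>After an insertion the outer string is nonempty, where \<open>unit_fam\<close>
      vanishes.\<close>
    have "gcomp 2 unit_fam b_fam x as = 0"
      unfolding gcomp_def by (intro sum.neutral) (auto simp: unit_fam_def)
    then have "delta 0 unit_fam x as = 0" using gcomp_b_fam_unit_fam[OF s] by (simp add: delta_def)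
    then show ?thesis using delta_cong[OF s twist trans_fam[OF unt_trans]] by simp
  qed
  then show ?thesis
    unfolding unit_arr_def ops_CA_single[OF unt_trans] by (auto simp: untwist_def fun_eq_iff)
qed

lemma tloops_iff: "(\<forall>a\<in>set as. src a = IA \<and> tgt a = IA \<and> val a \<in> Hom CA IA IA (deg a)) \<longleftrightarrow> tloops as"
  by (simp add: tloops_def)

lemma ops_CA_slot_0:
  assumes "tloops (as @ Arr IA IA d u # bs)"
  shows "ops CA (as @ Arr IA IA d 0 # bs) = 0"
proof -
  interpret C: vector_space "scl CA" by (rule vector_space_CA)
  have 0: "0 \<in> trans d" using C.subspace_0[OF subspace_trans] .
  then have "tloops (as @ Arr IA IA d 0 # bs)" using assms by simp
  from ops_CA_linear[OF this 0, of 1] show ?thesis by simp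
qed

end

text \<open>Here the Hochschild side meets the nerve side: the endomorphisms of the identity functor
  satisfy the requirements under which the homotopy groups of the mapping space were
  computed.\<close>

sublocale ainf_cat \<subseteq> endo: endo_complex CA IA
proof -
  interpret C: vector_space "scl CA" by (rule vector_space_CA)
  show "endo_complex CA IA"
  proof (unfold_locales, goal_cases)
    case 1 show ?case using id_functor_functor by simp
  next
    case (2 d) show ?case using subspace_trans by simp
  next
    case (3 v d) then show ?case using ops_CA_closed by simp
  next
    case (4 u d v)
    then show ?case using ops_CA_linear[of "[]" d u "[]" v 1] by simp
  next
    case (5 v d) then show ?case using ops_CA_ops by simp
  next
    case (6 as d u bs c)
    then have l: "tloops (as @ Arr IA IA d u # bs)" unfolding tloops_iff .
    have "0 \<in> trans d" using C.subspace_0[OF subspace_trans] .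
    from ops_CA_linear[OF l this, of c] show ?case unfolding ops_CA_slot_0[OF l] by simp
  next
    case 7 show ?case using unt_trans by simp
  next
    case 8 show ?case by (rule ops_CA_unit)
  next
    case (9 v d) then show ?case using ops_CA_unit_left by simp
  next
    case (10 v d) then show ?case using ops_CA_unit_right by simp
  next
    case (11 as) then show ?case using ops_CA_unit_ge3 unfolding tloops_iff by blast
  qed
qed

theorem theorem0p5:
  fixes A :: "('o, 'v::ab_group_add, 'k::field_char_0) ainf" and i :: nat
  assumes "ainf_category A"
  shows "let X = nerve (functor_category A A);
             x = nerve_vertex (functor_category A A) (id_functor A);
             M = left_mapping_space X x x;
             e = const_spx X 1 x
         in (i = 0 \<longrightarrow> (\<exists>\<phi>. bij_betw \<phi> (homotopy_set M e 0) (carrier (HH A 0)))) \<and>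
            (i \<ge> 1 \<longrightarrow> group (homotopy_group M e i) \<and> homotopy_group M e i \<cong> HH A (- int i))"
proof -
  have "vector_space (scl A)" using assms by (simp add: ainf_category_def)
  then interpret ainf_cat A using assms by (simp add: ainf_cat_def ainf_cat_axioms_def)
  show ?thesis using endo.pi0_bij endo.pi_iso[of i] by (simp add: HH_def Let_def)
qed

end
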